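(* For $i\in\{0,1\}$ and every $\sigma\in[0,\frac12)$, $\bar u^i_{\mathrm{sing}}\in H^{\frac{2+\sigma}{3}}((x_0,x_1);L^2(-1,1))\cap L^2((x_0,x_1);H^{2+\sigma}(-1,1))$.
   Context: Fix $x_0<x_1$, $\Omega=(x_0,x_1)\times(-1,1)$, coordinates $(x,z)$. Let $M(a,b,\zeta)=\sum_{n\ge0}\frac{(a)_n}{(b)_n}\frac{\zeta^n}{n!}$ be Kummer's function and $\Lambda_0(t)=9^{1/6}(1+t^2)^{-1/4}\big[\frac{\Gamma(1/3)}{\Gamma(1/6)}M(-\frac16,\frac23,-\frac{t^3}9)-\frac{t}{9^{1/3}}\frac{\Gamma(-1/3)}{\Gamma(-1/6)}M(\frac16,\frac43,-\frac{t^3}9)\big]$. For $i=0,1$ let $\chi_i\in C^\infty(\overline\Omega)$ with $\chi_i\equiv1$ near $(x_i,0)$ and $\operatorname{supp}\chi_i\subset B((x_i,0),\bar R)$, $\bar R<\min(1,x_1-x_0)/2$; $r_i=(z^2+|x-x_i|^{2/3})^{1/2}$, $t_i=(-1)^iz|x-x_i|^{-1/3}$, and $\bar u^i_{\mathrm{sing}}:=r_i^{1/2}\Lambda_0(t_i)\chi_i$. *)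

theory Defs
  imports "HOL-Analysis.Analysis"
begin

definition kummerM :: "real \<Rightarrow> real \<Rightarrow> real \<Rightarrow> real" where
  "kummerM a b \<zeta> = (\<Sum>n. pochhammer a n / pochhammer b n * \<zeta> ^ n / fact n)"

definition Lambda0 :: "real \<Rightarrow> real" where
  "Lambda0 t = 9 powr (1/6) * (1 + t^2) powr (-1/4) *
     (Gamma (1/3) / Gamma (1/6) * kummerM (-1/6) (2/3) (- (t ^ 3) / 9)
      - t / 9 powr (1/3) * Gamma (-1/3) / Gamma (-1/6) * kummerM (1/6) (4/3) (- (t ^ 3) / 9))"

fun dirderivs :: "('a::real_normed_vector \<Rightarrow> real) \<Rightarrow> 'a list \<Rightarrow> 'a \<Rightarrow> real" where
  "dirderivs f [] = f"
| "dirderivs f (v # vs) = (\<lambda>x. frechet_derivative (dirderivs f vs) (at x) v)"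

definition smooth_on :: "'a::real_normed_vector set \<Rightarrow> ('a \<Rightarrow> real) \<Rightarrow> bool" where
  "smooth_on U f \<longleftrightarrow> (\<forall>vs. dirderivs f vs differentiable_on U)"

definition smooth_upto :: "'a::real_normed_vector set \<Rightarrow> ('a \<Rightarrow> real) \<Rightarrow> bool" where
  "smooth_upto S f \<longleftrightarrow> (\<exists>U. open U \<and> closure S \<subseteq> U \<and> smooth_on U f)"

definition Omega :: "real \<Rightarrow> real \<Rightarrow> (real \<times> real) set" where
  "Omega x0 x1 = {x0<..<x1} \<times> {-1<..<1}"

definition r_i :: "real \<Rightarrow> real \<times> real \<Rightarrow> real" where
  "r_i xi p = sqrt ((snd p)^2 + \<bar>fst p - xi\<bar> powr (2/3))"

definition t_i :: "nat \<Rightarrow> real \<Rightarrow> real \<times> real \<Rightarrow> real" where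
  "t_i i xi p = (-1) ^ i * snd p * \<bar>fst p - xi\<bar> powr (-1/3)"

definition u_sing :: "nat \<Rightarrow> real \<Rightarrow> (real \<times> real \<Rightarrow> real) \<Rightarrow> real \<times> real \<Rightarrow> real" where
  "u_sing i xi chi p = r_i xi p powr (1/2) * Lambda0 (t_i i xi p) * chi p"

definition L2_on :: "('a::euclidean_space \<Rightarrow> real) \<Rightarrow> 'a set \<Rightarrow> bool" where
  "L2_on f S \<longleftrightarrow> (\<lambda>p. indicator S p * f p) \<in> borel_measurable lebesgue \<and>
     (\<integral>\<^sup>+p. ennreal (indicator S p * (f p)^2) \<partial>lebesgue) < \<infinity>"

definition weak_deriv_on :: "(real \<Rightarrow> real) \<Rightarrow> (real \<Rightarrow> real) \<Rightarrow> real \<Rightarrow> real \<Rightarrow> bool" where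
  "weak_deriv_on f g a b \<longleftrightarrow>
     (\<forall>K. compact K \<and> K \<subseteq> {a<..<b} \<longrightarrow> set_integrable lebesgue K f \<and> set_integrable lebesgue K g) \<and>
     (\<forall>\<phi>. smooth_on UNIV \<phi> \<and> compact (closure {x. \<phi> x \<noteq> 0}) \<and> closure {x. \<phi> x \<noteq> 0} \<subseteq> {a<..<b} \<longrightarrow>
        (LINT x:{a<..<b}|lebesgue. f x * deriv \<phi> x) = - (LINT x:{a<..<b}|lebesgue. g x * \<phi> x))"

text \<open>u \<in> L^2((a,b); H^{2+sigma}(c,d)), 0 \<le> sigma < 1: z-weak derivatives up to order 2 in L^2,
  and (if sigma > 0) the Gagliardo seminorm of order sigma of the second z-derivative is square integrable in x.\<close>
definition L2_H2s :: "(real \<times> real \<Rightarrow> real) \<Rightarrow> real \<Rightarrow> real \<Rightarrow> real \<Rightarrow> real \<Rightarrow> real \<Rightarrow> bool" where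
  "L2_H2s u a b c d \<sigma> \<longleftrightarrow> (\<exists>g1 g2.
     L2_on u ({a<..<b} \<times> {c<..<d}) \<and> L2_on g1 ({a<..<b} \<times> {c<..<d}) \<and> L2_on g2 ({a<..<b} \<times> {c<..<d}) \<and>
     (AE x in lebesgue. x \<in> {a<..<b} \<longrightarrow>
        weak_deriv_on (\<lambda>z. u (x, z)) (\<lambda>z. g1 (x, z)) c d \<and>
        weak_deriv_on (\<lambda>z. g1 (x, z)) (\<lambda>z. g2 (x, z)) c d) \<and>
     (\<sigma> > 0 \<longrightarrow>
        (\<integral>\<^sup>+x. \<integral>\<^sup>+z. \<integral>\<^sup>+w. ennreal (indicator {a<..<b} x * indicator {c<..<d} z * indicator {c<..<d} w *
            (g2 (x, z) - g2 (x, w))^2 / \<bar>z - w\<bar> powr (1 + 2 * \<sigma>)) \<partial>lebesgue \<partial>lebesgue \<partial>lebesgue) < \<infinity>))"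

text \<open>u \<in> H^s((a,b); L^2(c,d)) for 0 < s < 1 (Sobolev--Slobodeckij norm).\<close>
definition Hs_L2 :: "(real \<times> real \<Rightarrow> real) \<Rightarrow> real \<Rightarrow> real \<Rightarrow> real \<Rightarrow> real \<Rightarrow> real \<Rightarrow> bool" where
  "Hs_L2 u a b c d s \<longleftrightarrow> L2_on u ({a<..<b} \<times> {c<..<d}) \<and>
     (\<integral>\<^sup>+x. \<integral>\<^sup>+y. \<integral>\<^sup>+z. ennreal (indicator {a<..<b} x * indicator {a<..<b} y * indicator {c<..<d} z *
         (u (x, z) - u (y, z))^2 / \<bar>x - y\<bar> powr (1 + 2 * s)) \<partial>lebesgue \<partial>lebesgue \<partial>lebesgue) < \<infinity>"

end

theory Submission
  imports Defs
begin

text \<open>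
  With \<open>y = |x - x\<^sub>i|\<close> the factor \<open>(1 + t\<^sup>2) powr (-1/4)\<close> of \<open>Lambda0\<close> cancels against \<open>r_i\<close>, so that the
  singular function is \<open>y powr (1/6) * F (z * y powr (-1/3))\<close> times the cut-off, where \<open>F\<close> is a
  combination of two Kummer functions of \<open>- t\<^sup>3 / 9\<close>. Put \<open>P = F'\<close> and \<open>E = F/6 - t P/3\<close>; Kummer's equation
  becomes the system \<open>P' = t E\<close>, \<open>E' = - P/6 - t\<^sup>2 E/3\<close>. For \<open>t > 0\<close> it is dissipative. For \<open>t < 0\<close>
  generic solutions grow like \<open>exp (|t|\<^sup>3 / 9)\<close>; the Gamma factors in \<open>Lambda0\<close> make the leading growth
  cancel, which by a Wronskian argument forces \<open>E > 0 \<ge> P\<close> there and hence decay. The outcome is that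
  \<open>P\<close>, \<open>(1 + |t|) F''\<close>, the third derivative of \<open>F\<close> and \<open>(1 + |t|) E\<close> are bounded.

  Interpolating these bounds, the squared differences of \<open>\<partial>\<^sub>z\<^sup>2 u\<close> in \<open>z\<close> and of \<open>u\<close> in \<open>x\<close> are dominated by
  products of integrable powers of \<open>y\<close> and \<open>|z|\<close> with \<open>|z - w| powr (2 \<theta>)\<close>, \<open>\<theta> > \<sigma>\<close>, respectively
  \<open>|x - x'| powr (2 \<theta>)\<close>, \<open>\<theta> > (2 + \<sigma>)/3\<close>. Multiplication by a Lipschitz function preserves such bounds,
  which takes care of the cut-off.
\<close>

section \<open>Kummer's function\<close>

text \<open>For \<open>t < 0\<close> the profile combines two Kummer functions that both have size
  \<open>exp (|t|^3 / 9)\<close> up to powers, and cancellation of the leading terms alone says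
  nothing about the remainder. No finer expansion is used: the limit of a ratio of two growing
  solutions, together with the monotonicity of that ratio, yields signs, and the signs yield decay
  through the equations.

  \<open>E\<close> is also the profile of the derivative in \<open>y\<close>: that of y^(1/6) F(z
  y^(-1/3)) is y^(-5/6) E. Its decay therefore controls differences in x, while F'' = t E controls
  those in z.

  The threshold 1/2 for \<sigma> appears in both directions. The square of the second z-derivative
  scales like 1/y, which just fails to be integrable. The decay of F'' trades part of this for
  |z|^(-b); the Hoelder estimate then carries y^(-(1 + 2 \<theta>/3 - b/3)), and integrability asks
  for 2 \<theta> < b < 1. In x, weights |z|^(-2 \<mu>) and y^(-2 \<mu>) with 2 \<mu> < 1 admit the
  Hoelder exponent 1/6 + 4 \<mu>/3, which stays below 5/6 = (2 + 1/2)/3.\<close>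

definition kummer_coeff :: "real \<Rightarrow> real \<Rightarrow> nat \<Rightarrow> real" where
  "kummer_coeff a b n = pochhammer a n / pochhammer b n / fact n"

lemma kummerM_eq: "kummerM a b x = (\<Sum>n. kummer_coeff a b n * x ^ n)"
  by (simp add: kummerM_def kummer_coeff_def)

text \<open>Factor by factor, |a + n| <= |a| + n and b + n >= b give |a + n| / (b + n) <= |a| / b +
  1. The bound is crude, but it provides an exponential series as majorant, hence convergence
  everywhere.\<close>

lemma kummer_ratio_bound:
  fixes a b :: real
  assumes "b > 0"
  shows "\<bar>pochhammer a n / pochhammer b n\<bar> \<le> (\<bar>a\<bar> / b + 1) ^ n"
proof (induction n)
  case (Suc n)
  have pos: "b + real n > 0" using assms by simp
  have "\<bar>a\<bar> * b \<le> \<bar>a\<bar> * (b + real n)" by (intro mult_left_mono) auto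
  then have "\<bar>a\<bar> + real n \<le> (\<bar>a\<bar> / b + 1) * (b + real n)"
    using assms by (simp add: field_simps)
  then have "\<bar>a + real n\<bar> \<le> (\<bar>a\<bar> / b + 1) * (b + real n)" by linarith
  then have "\<bar>(a + real n) / (b + real n)\<bar> \<le> \<bar>a\<bar> / b + 1"
    using pos by (simp add: pos_divide_le_eq)
  with Suc have "\<bar>pochhammer a n / pochhammer b n\<bar> * \<bar>(a + real n) / (b + real n)\<bar>
      \<le> (\<bar>a\<bar> / b + 1) ^ n * (\<bar>a\<bar> / b + 1)"
    using assms by (intro mult_mono) auto
  then show ?case by (simp add: pochhammer_Suc abs_mult mult.commute)
qed simp

lemma summable_kummer_abs:
  assumes "b > 0"
  shows "summable (\<lambda>n. norm (kummer_coeff a b n * x ^ n))"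
proof (rule summable_comparison_test')
  show "summable (\<lambda>n. inverse (fact n) * ((\<bar>a\<bar> / b + 1) * \<bar>x\<bar>) ^ n)"
    by (rule summable_exp)
next
  fix n :: nat
  have "norm (kummer_coeff a b n * x ^ n)
      = \<bar>pochhammer a n / pochhammer b n\<bar> * (\<bar>x\<bar> ^ n / fact n)"
    by (simp add: kummer_coeff_def abs_mult power_abs)
  also have "\<dots> \<le> (\<bar>a\<bar> / b + 1) ^ n * (\<bar>x\<bar> ^ n / fact n)"
    by (intro mult_right_mono kummer_ratio_bound assms) auto
  also have "\<dots> = inverse (fact n) * ((\<bar>a\<bar> / b + 1) * \<bar>x\<bar>) ^ n"
    by (simp add: power_mult_distrib divide_inverse mult_ac)
  finally show "norm (norm (kummer_coeff a b n * x ^ n))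
      \<le> inverse (fact n) * ((\<bar>a\<bar> / b + 1) * \<bar>x\<bar>) ^ n" by simp
qed

lemma summable_kummer: "b > 0 \<Longrightarrow> summable (\<lambda>n. kummer_coeff a b n * x ^ n)"
  by (rule summable_norm_cancel) (rule summable_kummer_abs)

lemma diffs_kummer_coeff:
  assumes "b > 0"
  shows "diffs (kummer_coeff a b) n = a / b * kummer_coeff (a + 1) (b + 1) n"
proof -
  have "real (Suc n) \<noteq> 0" by simp
  then show ?thesis
    unfolding diffs_def kummer_coeff_def pochhammer_rec fact_Suc
    by (simp del: of_nat_Suc)
qed

lemma DERIV_kummerM:
  assumes "b > 0"
  shows "(kummerM a b has_real_derivative a / b * kummerM (a + 1) (b + 1) x) (at x)"
proof -
  have "((\<lambda>x. \<Sum>n. kummer_coeff a b n * x ^ n) has_real_derivative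
      (\<Sum>n. diffs (kummer_coeff a b) n * x ^ n)) (at x)"
    using summable_kummer[OF assms] by (rule termdiffs_strong_converges_everywhere)
  moreover have "(\<Sum>n. diffs (kummer_coeff a b) n * x ^ n) = a / b * kummerM (a + 1) (b + 1) x"
    unfolding kummerM_eq diffs_kummer_coeff[OF assms] mult.assoc
    using assms by (intro suminf_mult summable_kummer) simp
  ultimately show ?thesis unfolding kummerM_eq[abs_def] by simp
qed

text \<open>The term for \<open>n = 0\<close> vanishes, which permits the shift of index. With
  \<open>x\<close> times the derivative as basic operator, Kummer's equation can be checked
  coefficient by coefficient without a second shift.\<close>

lemma sums_index_times:
  fixes c :: "nat \<Rightarrow> real"
  assumes "summable (\<lambda>n. diffs c n * x ^ n)"
  shows "(\<lambda>n. real n * c n * x ^ n) sums (x * (\<Sum>n. diffs c n * x ^ n))"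
proof -
  have "(\<lambda>n. x * (diffs c n * x ^ n)) sums (x * (\<Sum>n. diffs c n * x ^ n))"
    using assms by (intro sums_mult summable_sums)
  then have "(\<lambda>n. real (Suc n) * c (Suc n) * x ^ Suc n) sums (x * (\<Sum>n. diffs c n * x ^ n))"
    by (simp add: diffs_def mult_ac)
  then show ?thesis by (subst (asm) sums_Suc_iff) simp
qed

lemma sums_index_times_kummer:
  assumes "b > 0"
  shows "(\<lambda>n. real n * kummer_coeff a b n * x ^ n) sums (x * (a / b * kummerM (a + 1) (b + 1) x))"
proof -
  have s: "summable (\<lambda>n. a / b * (kummer_coeff (a + 1) (b + 1) n * x ^ n))"
    using assms by (intro summable_mult summable_kummer) simp
  have "(\<Sum>n. diffs (kummer_coeff a b) n * x ^ n) = a / b * kummerM (a + 1) (b + 1) x"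
    unfolding kummerM_eq diffs_kummer_coeff[OF assms] mult.assoc
    using assms by (intro suminf_mult summable_kummer) simp
  with sums_index_times[of "kummer_coeff a b" x] s show ?thesis
    by (simp add: diffs_kummer_coeff[OF assms] mult.assoc)
qed

text \<open>Coefficientwise this is (a + n) (a)_n = a (a + 1)_n. The contiguous relation serves to
  remove the derivatives from \<open>profE\<close>.\<close>

lemma kummerM_raise:
  assumes "b > 0"
  shows "a * kummerM a b x + x * (a / b * kummerM (a + 1) (b + 1) x) = a * kummerM (a + 1) b x"
proof -
  have "(\<lambda>n. a * (kummer_coeff a b n * x ^ n) + real n * kummer_coeff a b n * x ^ n) sums
      (a * kummerM a b x + x * (a / b * kummerM (a + 1) (b + 1) x))"
    unfolding kummerM_eq[of a b]
    by (intro sums_add sums_mult summable_sums summable_kummer sums_index_times_kummer assms)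
  moreover have "a * (kummer_coeff a b n * x ^ n) + real n * kummer_coeff a b n * x ^ n
      = a * (kummer_coeff (a + 1) b n * x ^ n)" for n
  proof -
    have "(a + real n) * pochhammer a n = a * pochhammer (a + 1) n"
      using pochhammer_rec[of a n] pochhammer_rec'[of a n] by simp
    then have "(a + real n) * kummer_coeff a b n = a * kummer_coeff (a + 1) b n"
      by (simp add: kummer_coeff_def)
    then have "(a + real n) * kummer_coeff a b n * x ^ n = a * kummer_coeff (a + 1) b n * x ^ n"
      by simp
    then show ?thesis by (simp add: algebra_simps)
  qed
  ultimately have "(\<lambda>n. a * (kummer_coeff (a + 1) b n * x ^ n)) sums
      (a * kummerM a b x + x * (a / b * kummerM (a + 1) (b + 1) x))" by simp
  moreover have "(\<lambda>n. a * (kummer_coeff (a + 1) b n * x ^ n)) sums (a * kummerM (a + 1) b x)"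
    unfolding kummerM_eq by (intro sums_mult summable_sums summable_kummer assms)
  ultimately show ?thesis by (rule sums_unique2)
qed

text \<open>\<open>y1\<close> and \<open>y2\<close> are the first two derivatives of
  \<open>kummerM a b\<close> at \<open>x\<close>, so this is Kummer's equation. For the coefficients
  c it reduces to (n + b) (n + 1) c_(n+1) = (n + a) c_n.\<close>

lemma kummerM_ode:
  fixes a b x :: real
  assumes "b > 0"
  defines "y1 \<equiv> a / b * kummerM (a + 1) (b + 1) x"
    and "y2 \<equiv> a / b * ((a + 1) / (b + 1) * kummerM (a + 2) (b + 2) x)"
  shows "x * y2 + (b - x) * y1 - a * kummerM a b x = 0"
proof -
  have b1: "b + 1 > 0" using assms by simp
  have 1: "(\<lambda>n. a / b * (real n * kummer_coeff (a + 1) (b + 1) n * x ^ n)) sums (x * y2)"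
    using sums_mult[OF sums_index_times_kummer[OF b1, of "a + 1" x], of "a / b"]
    by (simp add: y2_def add.assoc mult.left_commute)
  have 2: "(\<lambda>n. b * (a / b * (kummer_coeff (a + 1) (b + 1) n * x ^ n))) sums (b * y1)"
    unfolding y1_def kummerM_eq
    by (intro sums_mult summable_sums summable_kummer b1)
  have 3: "(\<lambda>n. a * (kummer_coeff a b n * x ^ n)) sums (a * kummerM a b x)"
    unfolding kummerM_eq by (intro sums_mult summable_sums summable_kummer assms)
  have "(\<lambda>n. a / b * (real n * kummer_coeff (a + 1) (b + 1) n * x ^ n)
        + b * (a / b * (kummer_coeff (a + 1) (b + 1) n * x ^ n))
        - (real n * kummer_coeff a b n * x ^ n + a * (kummer_coeff a b n * x ^ n)))
      sums (x * y2 + b * y1 - (x * y1 + a * kummerM a b x))"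
    by (intro sums_add sums_diff 1 2 3 sums_index_times_kummer[OF assms(1), of a x, folded y1_def])
  moreover have "a / b * (real n * kummer_coeff (a + 1) (b + 1) n * x ^ n)
        + b * (a / b * (kummer_coeff (a + 1) (b + 1) n * x ^ n))
        - (real n * kummer_coeff a b n * x ^ n + a * (kummer_coeff a b n * x ^ n)) = 0" for n
  proof -
    have pb: "pochhammer b n > 0" "b + real n > 0" using assms by (auto intro: pochhammer_pos)
    have "(real n + b) * diffs (kummer_coeff a b) n = (real n + a) * kummer_coeff a b n"
    proof -
      have "real (Suc n) \<noteq> 0" by simp
      then show ?thesis using pb
        unfolding diffs_def kummer_coeff_def pochhammer_rec' fact_Suc
        by (simp del: of_nat_Suc add: add.commute)
    qed
    then have "(real n + b) * (a / b * kummer_coeff (a + 1) (b + 1) n) * x ^ n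
        = (real n + a) * kummer_coeff a b n * x ^ n"
      by (simp add: diffs_kummer_coeff[OF assms(1)])
    moreover have "(real n + b) * (q * k) * X = (real n + a) * c * X \<Longrightarrow>
        q * (real n * k * X) + b * (q * (k * X)) - (real n * c * X + a * (c * X)) = 0"
      for q k c X :: real by (simp add: algebra_simps)
    ultimately show ?thesis by blast
  qed
  ultimately have "(\<lambda>n. 0) sums (x * y2 + b * y1 - (x * y1 + a * kummerM a b x))" by simp
  then have "x * y2 + b * y1 - (x * y1 + a * kummerM a b x) = 0"
    using sums_unique2[OF _ sums_zero] by blast
  then show ?thesis by (simp add: algebra_simps)
qed

text \<open>All terms are nonnegative and the constant term is 1. Needed for the positivity of one
  solution on the negative half line.\<close>

lemma kummerM_ge_1:
  assumes "a > 0" "b > 0" "x \<ge> 0"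
  shows "kummerM a b x \<ge> 1"
proof -
  have "(\<Sum>n<1. kummer_coeff a b n * x ^ n) \<le> (\<Sum>n. kummer_coeff a b n * x ^ n)"
    using assms by (intro sum_le_suminf summable_kummer)
      (auto simp: kummer_coeff_def intro!: divide_nonneg_nonneg mult_nonneg_nonneg pochhammer_nonneg)
  then show ?thesis by (simp add: kummerM_eq kummer_coeff_def)
qed

section \<open>Growth at infinity\<close>

lemma powr_le_affine:
  fixes u \<alpha> :: real
  assumes "u > 0" "0 \<le> \<alpha>" "\<alpha> \<le> 1"
  shows "u powr \<alpha> \<le> 1 + \<alpha> * (u - 1)"
proof -
  have "exp ((1 - \<alpha>) *\<^sub>R 0 + \<alpha> *\<^sub>R ln u) \<le> (1 - \<alpha>) * exp 0 + \<alpha> * exp (ln u)"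
    using assms by (intro convex_onD[OF exp_convex]) auto
  then show ?thesis using assms by (simp add: powr_def algebra_simps)
qed

text \<open>The lower bound is 1 + \<alpha> ln u <= u^\<alpha> combined with 1 - 1/u <= ln u <= u -
  1; the upper one is Bernoulli's inequality for u, or for 1/u if \<alpha> is negative. Only u and
  1/u occur, whose Poisson means can be computed.\<close>

lemma powr_between:
  fixes u \<alpha> :: real
  assumes "u > 0" "\<bar>\<alpha>\<bar> \<le> 1"
  shows "min (1 + \<alpha> * (u - 1)) (1 + \<alpha> * (1 - 1 / u)) \<le> u powr \<alpha>"
    and "u powr \<alpha> \<le> max (1 + \<alpha> * (u - 1)) (1 + \<alpha> * (1 - 1 / u))"
proof -
  have e: "1 + \<alpha> * ln u \<le> u powr \<alpha>"
    using assms exp_ge_add_one_self[of "\<alpha> * ln u"] by (simp add: powr_def)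
  have l1: "ln u \<le> u - 1" using assms ln_le_minus_one by blast
  have l2: "1 - 1 / u \<le> ln u"
    using assms ln_le_minus_one[of "1 / u"] by (simp add: ln_div)
  show "min (1 + \<alpha> * (u - 1)) (1 + \<alpha> * (1 - 1 / u)) \<le> u powr \<alpha>"
  proof (cases "\<alpha> \<ge> 0")
    case True
    then have "\<alpha> * (1 - 1 / u) \<le> \<alpha> * ln u" using l2 by (rule mult_left_mono[rotated])
    with e show ?thesis by linarith
  next
    case False
    then have "\<alpha> * (u - 1) \<le> \<alpha> * ln u" using l1 by (intro mult_left_mono_neg) auto
    with e show ?thesis by linarith
  qed
  show "u powr \<alpha> \<le> max (1 + \<alpha> * (u - 1)) (1 + \<alpha> * (1 - 1 / u))"
  proof (cases "\<alpha> \<ge> 0")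
    case True
    then show ?thesis using powr_le_affine[of u \<alpha>] assms by linarith
  next
    case False
    have "(1 / u) powr (- \<alpha>) \<le> 1 + (- \<alpha>) * (1 / u - 1)"
      using assms False by (intro powr_le_affine) auto
    moreover have "(1 / u) powr (- \<alpha>) = u powr \<alpha>"
      using assms by (simp add: powr_divide powr_minus field_simps)
    ultimately show ?thesis by (simp add: algebra_simps)
  qed
qed

lemma exp_sums: "(\<lambda>n. x ^ n / fact n) sums exp (x::real)"
  using exp_converges[of x] by (simp add: scaleR_conv_of_real field_simps)

lemma Suc_exp_sums: "(\<lambda>n. real (Suc n) * (x ^ n / fact n)) sums ((x + 1) * exp x)"
proof -
  have "(\<lambda>n. x * (x ^ n / fact n)) sums (x * exp x)" by (intro sums_mult exp_sums)
  then have "(\<lambda>n. real (Suc n) * (x ^ Suc n / fact (Suc n))) sums (x * exp x)"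
    by (simp add: field_simps del: of_nat_Suc)
  then have "(\<lambda>n. real n * (x ^ n / fact n)) sums (x * exp x)"
    by (subst (asm) sums_Suc_iff) simp
  from sums_add[OF this exp_sums[of x]] show ?thesis by (simp add: algebra_simps add_divide_distrib)
qed

lemma inverse_Suc_exp_sums:
  assumes "x \<noteq> 0"
  shows "(\<lambda>n. x ^ n / fact n / real (Suc n)) sums ((exp x - 1) / x)"
proof -
  have "(\<lambda>n. x ^ Suc n / fact (Suc n)) sums (exp x - 1)"
    by (subst sums_Suc_iff) (simp add: exp_sums)
  then have "(\<lambda>n. x ^ Suc n / fact (Suc n) / x) sums ((exp x - 1) / x)" by (rule sums_divide)
  moreover have "x ^ Suc n / fact (Suc n) / x = x ^ n / fact n / real (Suc n)" for n
    using assms by (simp add: mult.commute)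
  ultimately show ?thesis by simp
qed

lemma summable_powr_exp:
  fixes \<alpha> x :: real
  assumes "\<bar>\<alpha>\<bar> \<le> 1" "x \<ge> 0"
  shows "summable (\<lambda>n. real (Suc n) powr \<alpha> * (x ^ n / fact n))"
proof (rule summable_comparison_test')
  show "summable (\<lambda>n. real (Suc n) * (x ^ n / fact n))"
    using Suc_exp_sums sums_summable by blast
  show "norm (real (Suc n) powr \<alpha> * (x ^ n / fact n)) \<le> real (Suc n) * (x ^ n / fact n)" for n
  proof -
    have "real (Suc n) powr \<alpha> \<le> real (Suc n) powr 1"
      using assms by (intro powr_mono) auto
    then show ?thesis using assms by (auto intro!: divide_right_mono mult_right_mono)
  qed
qed

text \<open>With \<open>u = (n + 1) / x\<close> the power \<open>u powr \<alpha>\<close> lies between two functions whose means under the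
  Poisson distribution of parameter \<open>x\<close> are explicit.\<close>
lemma poisson_powr_mean:
  fixes \<alpha> x :: real
  assumes "\<bar>\<alpha>\<bar> \<le> 1" "x > 0"
  shows "\<bar>(\<Sum>n. real (Suc n) powr \<alpha> * (x ^ n / fact n)) * exp (- x) * x powr (- \<alpha>) - 1\<bar>
    \<le> 1 / x + exp (- x)"
proof -
  define w where "w n = x ^ n / fact n" for n
  define u where "u n = real (Suc n) / x" for n
  define S where "S = (\<Sum>n. real (Suc n) powr \<alpha> * w n)"
  have w: "w n \<ge> 0" for n using assms by (simp add: w_def)
  have u: "u n > 0" for n using assms by (simp add: u_def)
  have "(\<lambda>n. real (Suc n) powr \<alpha> * w n) sums S"
    unfolding S_def w_def using assms by (intro summable_sums summable_powr_exp) auto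
  from sums_mult[OF this, of "x powr (- \<alpha>)"]
  have Su: "(\<lambda>n. u n powr \<alpha> * w n) sums (x powr (- \<alpha>) * S)"
    using assms by (simp add: u_def powr_divide powr_minus field_simps)
  have e: "w sums exp x" unfolding w_def by (rule exp_sums)
  \<comment> \<open>Under the Poisson weights the mean of \<open>u\<close> is 1 + 1/x, and that of
    its reciprocal, needed for \<open>B\<close>, is 1 - exp(-x).\<close>
  have "(\<lambda>n. real (Suc n) * w n / x) sums ((x + 1) * exp x / x)"
    unfolding w_def by (intro sums_divide Suc_exp_sums)
  from sums_add[OF e sums_mult[OF sums_diff[OF this e], of \<alpha>]]
  have A: "(\<lambda>n. (1 + \<alpha> * (u n - 1)) * w n) sums (exp x * (1 + \<alpha> / x))"
    using assms by (simp add: u_def field_simps)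
  have "(\<lambda>n. x * (w n / real (Suc n))) sums (x * ((exp x - 1) / x))"
    unfolding w_def using assms by (intro sums_mult inverse_Suc_exp_sums) simp
  from sums_add[OF e sums_mult[OF sums_diff[OF e this], of \<alpha>]]
  have B: "(\<lambda>n. (1 + \<alpha> * (1 - 1 / u n)) * w n) sums (exp x + \<alpha>)"
    using assms by (simp add: u_def field_simps)
  have bd: "\<bar>x powr (- \<alpha>) * S - exp x\<bar> \<le> exp x / x + 1"
  proof (cases "\<alpha> \<ge> 0")
    case True
    \<comment> \<open>The sign of \<alpha> decides which bound is the upper one, because (u - 1) -
      (1 - 1/u) = (u - 1)^2 / u.\<close>
    have m: "1 + \<alpha> * (1 - 1 / u n) \<le> 1 + \<alpha> * (u n - 1)" for n
    proof -
      have "(u n - 1) ^ 2 / u n \<ge> 0" using u[of n] by (intro divide_nonneg_nonneg) auto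
      then have "1 - 1 / u n \<le> u n - 1"
        using u[of n] by (simp add: field_simps power2_eq_square)
      then show ?thesis using True by (simp add: mult_left_mono)
    qed
    have "exp x + \<alpha> \<le> x powr (- \<alpha>) * S"
      by (rule sums_le[OF _ B Su]) (use powr_between(1)[OF u assms(1)] m w in \<open>auto intro!: mult_right_mono simp: min_absorb2\<close>)
    moreover have "x powr (- \<alpha>) * S \<le> exp x * (1 + \<alpha> / x)"
      by (rule sums_le[OF _ Su A]) (use powr_between(2)[OF u assms(1)] m w in \<open>auto intro!: mult_right_mono simp: max_absorb1\<close>)
    moreover have "exp x * \<alpha> / x \<le> exp x * 1 / x"
      using assms by (intro divide_right_mono mult_left_mono) auto
    ultimately show ?thesis using assms True by (simp add: algebra_simps)
  next
    case False
    have m: "1 + \<alpha> * (u n - 1) \<le> 1 + \<alpha> * (1 - 1 / u n)" for n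
    proof -
      have "(u n - 1) ^ 2 / u n \<ge> 0" using u[of n] by (intro divide_nonneg_nonneg) auto
      then have "1 - 1 / u n \<le> u n - 1"
        using u[of n] by (simp add: field_simps power2_eq_square)
      then show ?thesis using False by (simp add: mult_left_mono_neg)
    qed
    have "exp x * (1 + \<alpha> / x) \<le> x powr (- \<alpha>) * S"
      by (rule sums_le[OF _ A Su]) (use powr_between(1)[OF u assms(1)] m w in \<open>auto intro!: mult_right_mono simp: min_absorb1\<close>)
    moreover have "x powr (- \<alpha>) * S \<le> exp x + \<alpha>"
      by (rule sums_le[OF _ Su B]) (use powr_between(2)[OF u assms(1)] m w in \<open>auto intro!: mult_right_mono simp: max_absorb2\<close>)
    moreover have "exp x * (-1) / x \<le> exp x * \<alpha> / x"
      using assms by (intro divide_right_mono mult_left_mono) auto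
    ultimately show ?thesis using assms False by (simp add: algebra_simps)
  qed
  have "S * exp (- x) * x powr (- \<alpha>) - 1 = (x powr (- \<alpha>) * S - exp x) * exp (- x)"
    by (simp add: algebra_simps flip: exp_add)
  also have "\<bar>\<dots>\<bar> \<le> (exp x / x + 1) * exp (- x)"
    using bd by (simp add: abs_mult)
  also have "\<dots> = 1 / x + exp (- x)" by (simp add: algebra_simps flip: exp_add)
  finally show ?thesis by (simp add: S_def w_def)
qed

lemma poisson_powr_tendsto:
  fixes \<alpha> :: real
  assumes "\<bar>\<alpha>\<bar> \<le> 1"
  shows "((\<lambda>x. (\<Sum>n. real (Suc n) powr \<alpha> * (x ^ n / fact n)) * exp (- x) * x powr (- \<alpha>)) \<longlongrightarrow> 1) at_top"
proof (rule Lim_transform2[OF tendsto_const], rule Lim_null_comparison)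
  show "\<forall>\<^sub>F x in at_top. norm (1 - (\<Sum>n. real (Suc n) powr \<alpha> * (x ^ n / fact n)) * exp (- x) * x powr (- \<alpha>))
      \<le> 1 / x + exp (- x)"
    using eventually_gt_at_top[of 0]
    by eventually_elim (use poisson_powr_mean[OF assms] in \<open>simp add: abs_minus_commute\<close>)
  have "((\<lambda>x::real. 1 / x + exp (- x)) \<longlongrightarrow> 0 + 0) at_top"
    by (intro tendsto_add tendsto_divide_0[OF tendsto_const] filterlim_at_top_imp_at_infinity filterlim_ident
        filterlim_compose[OF exp_at_bot] filterlim_uminus_at_bot_at_top)
  then show "((\<lambda>x::real. 1 / x + exp (- x)) \<longlongrightarrow> 0) at_top" by simp
qed

text \<open>Gauss's limit for the reciprocal Gamma function, taken as a quotient so that the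
  factorials cancel. The base \<open>Suc n\<close> keeps the weight positive at \<open>n = 0\<close>
  and matches the Poisson estimate; the mismatch between \<open>n\<close> and \<open>n + 2\<close>
  in the proof costs only a factor tending to 1.\<close>

lemma pochhammer_ratio_tendsto:
  fixes a b :: real
  assumes "a > 0" "b > 0"
  shows "(\<lambda>n. pochhammer a n / pochhammer b n / real (Suc n) powr (a - b)) \<longlonglongrightarrow> Gamma b / Gamma a"
proof (rule LIMSEQ_imp_Suc)
  have nz: "rGamma b \<noteq> 0" using assms by (simp add: rGamma_eq_zero_iff nonpos_Ints_def)
  have "(\<lambda>n. rGamma_series a n / rGamma_series b n) \<longlonglongrightarrow> rGamma a / rGamma b"
    using nz by (intro tendsto_intros)
  moreover have "(\<lambda>n. (real n / real (Suc (Suc n))) powr (a - b)) \<longlonglongrightarrow> 1 powr (a - b)"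
  proof (intro tendsto_intros)
    have "(\<lambda>n. 1 - 2 / real (n + 2)) \<longlonglongrightarrow> 1 - 0"
      by (intro tendsto_intros LIMSEQ_ignore_initial_segment lim_const_over_n)
    moreover have "1 - 2 / real (n + 2) = real n / real (Suc (Suc n))" for n
      by (simp add: field_simps)
    ultimately show "(\<lambda>n. real n / real (Suc (Suc n))) \<longlonglongrightarrow> 1" by simp
  qed auto
  ultimately have lim: "(\<lambda>n. rGamma_series a n / rGamma_series b n * (real n / real (Suc (Suc n))) powr (a - b))
      \<longlonglongrightarrow> rGamma a / rGamma b * 1 powr (a - b)"
    by (rule tendsto_mult)
  have val: "rGamma a / rGamma b * 1 powr (a - b) = Gamma b / Gamma a"
    by (simp add: rGamma_inverse_Gamma field_simps)
  have ev: "\<forall>\<^sub>F n in sequentially. rGamma_series a n / rGamma_series b n * (real n / real (Suc (Suc n))) powr (a - b)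
      = pochhammer a (Suc n) / pochhammer b (Suc n) / real (Suc (Suc n)) powr (a - b)"
    using eventually_gt_at_top[of 0]
  proof eventually_elim
    case (elim n)
    have quot: "exp (a * ln (real n)) / exp (b * ln (real n)) = real n powr (a - b)"
      using elim by (simp add: powr_def exp_diff left_diff_distrib)
    have "rGamma_series a n / rGamma_series b n
        = pochhammer a (Suc n) / pochhammer b (Suc n) / (exp (a * ln (real n)) / exp (b * ln (real n)))"
      unfolding rGamma_series_def Suc_eq_plus1 by simp
    then have "rGamma_series a n / rGamma_series b n
        = pochhammer a (Suc n) / pochhammer b (Suc n) / real n powr (a - b)" unfolding quot .
    moreover have "(real n / real (Suc (Suc n))) powr (a - b)
        = real n powr (a - b) / real (Suc (Suc n)) powr (a - b)"
      by (rule powr_divide) 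
    moreover have "real n powr (a - b) \<noteq> 0" using elim by simp
    ultimately show ?case by simp
  qed
  show "(\<lambda>n. pochhammer a (Suc n) / pochhammer b (Suc n) / real (Suc (Suc n)) powr (a - b)) \<longlonglongrightarrow> Gamma b / Gamma a"
    using Lim_transform_eventually[OF lim ev] unfolding val .
qed

text \<open>An Abelian argument. Up to the index where \<open>f n / h n\<close> is close to its
  limit, the error is a polynomial in \<open>x\<close>, which \<open>gp\<close> sends to 0; beyond
  it, the error is at most \<eta> times the series of \<open>h\<close>, which \<open>gh\<close>
  normalises.\<close>

lemma exp_series_weighted_tendsto:
  fixes f h :: "nat \<Rightarrow> real" and g :: "real \<Rightarrow> real"
  assumes h: "\<And>n. h n > 0" and lim: "(\<lambda>n. f n / h n) \<longlonglongrightarrow> c"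
    and sf: "\<And>x. x > 0 \<Longrightarrow> summable (\<lambda>n. f n * (x ^ n / fact n))"
    and sh: "\<And>x. x > 0 \<Longrightarrow> summable (\<lambda>n. h n * (x ^ n / fact n))"
    and g: "\<And>x. x > 0 \<Longrightarrow> g x \<ge> 0"
    and gh: "((\<lambda>x. (\<Sum>n. h n * (x ^ n / fact n)) * g x) \<longlongrightarrow> 1) at_top"
    and gp: "\<And>k. ((\<lambda>x. x ^ k * g x) \<longlongrightarrow> 0) at_top"
  shows "((\<lambda>x. (\<Sum>n. f n * (x ^ n / fact n)) * g x) \<longlongrightarrow> c) at_top"
proof (rule tendstoI)
  fix \<epsilon> :: real assume \<epsilon>: "\<epsilon> > 0"
  define \<eta> where "\<eta> = \<epsilon> / 2"
  have \<eta>: "\<eta> > 0" "\<eta> < \<epsilon>" using \<epsilon> by (auto simp: \<eta>_def)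
  from tendstoD[OF lim \<eta>(1)] obtain N where N: "\<And>n. n \<ge> N \<Longrightarrow> \<bar>f n / h n - c\<bar> < \<eta>"
    by (auto simp: eventually_sequentially dist_real_def)
  define H where "H x = (\<Sum>n. h n * (x ^ n / fact n))" for x
  define F where "F x = (\<Sum>n. f n * (x ^ n / fact n))" for x
  define R where "R x = (\<Sum>n<N. \<bar>f n - c * h n\<bar> / fact n * (x ^ n * g x))" for x
  have diff: "\<bar>f n - c * h n\<bar> \<le> (if n < N then \<bar>f n - c * h n\<bar> else 0) + \<eta> * h n" for n
  proof (cases "n < N")
    case False
    then have "\<bar>f n / h n - c\<bar> * h n \<le> \<eta> * h n"
      using N[of n] h[of n] by (intro mult_right_mono) auto
    moreover have "\<bar>f n / h n - c\<bar> * h n = \<bar>(f n / h n - c) * h n\<bar>"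
      using h[of n] by (simp add: abs_mult)
    moreover have "(f n / h n - c) * h n = f n - c * h n"
      using h[of n] by (simp add: field_simps)
    ultimately show ?thesis using False by simp
  qed (use h[of n] \<eta> in auto)
  have main: "\<bar>F x * g x - c\<bar> \<le> R x + \<eta> * (H x * g x) + \<bar>c\<bar> * \<bar>H x * g x - 1\<bar>" if x: "x > 0" for x
  proof -
    define w where "w n = x ^ n / fact n" for n
    have w: "w n \<ge> 0" for n using x by (simp add: w_def)
    have H: "(\<lambda>n. h n * w n) sums H x" and F: "(\<lambda>n. f n * w n) sums F x"
      unfolding H_def F_def w_def using sf[OF x] sh[OF x] by (auto intro: summable_sums)
    have 1: "(\<lambda>n. f n * w n - c * (h n * w n)) sums (F x - c * H x)"
      by (intro sums_diff sums_mult H F)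
    have "(\<lambda>n. if n < N then \<bar>f n - c * h n\<bar> * w n else 0) sums (\<Sum>n | n < N. \<bar>f n - c * h n\<bar> * w n)"
      by (rule sums_If_finite) simp
    from sums_add[OF this sums_mult[OF H, of \<eta>]]
    have 2: "(\<lambda>n. (if n < N then \<bar>f n - c * h n\<bar> * w n else 0) + \<eta> * (h n * w n)) sums
        ((\<Sum>n<N. \<bar>f n - c * h n\<bar> * w n) + \<eta> * H x)"
      by (simp add: lessThan_def)
    have le: "\<bar>f n * w n - c * (h n * w n)\<bar> \<le> (if n < N then \<bar>f n - c * h n\<bar> * w n else 0) + \<eta> * (h n * w n)" for n
    proof -
      have "\<bar>f n * w n - c * (h n * w n)\<bar> = \<bar>f n - c * h n\<bar> * w n"
        using w[of n] by (metis abs_mult abs_of_nonneg left_diff_distrib mult.assoc)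
      also have "\<dots> \<le> ((if n < N then \<bar>f n - c * h n\<bar> else 0) + \<eta> * h n) * w n"
        using diff w by (intro mult_right_mono) auto
      finally show ?thesis by (auto simp: algebra_simps split: if_splits)
    qed
    have up: "F x - c * H x \<le> (\<Sum>n<N. \<bar>f n - c * h n\<bar> * w n) + \<eta> * H x"
      by (rule sums_le[OF _ 1 2]) (use le in \<open>metis abs_le_D1\<close>)
    have lo: "- (F x - c * H x) \<le> (\<Sum>n<N. \<bar>f n - c * h n\<bar> * w n) + \<eta> * H x"
      by (rule sums_le[OF _ sums_minus[OF 1] 2]) (use le in \<open>metis abs_le_D2\<close>)
    have "\<bar>F x - c * H x\<bar> * g x \<le> ((\<Sum>n<N. \<bar>f n - c * h n\<bar> * w n) + \<eta> * H x) * g x"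
      using up lo g[OF x] by (intro mult_right_mono) auto
    also have "\<dots> = R x + \<eta> * (H x * g x)"
      by (simp add: R_def w_def algebra_simps sum_distrib_left sum_distrib_right)
    finally have "\<bar>(F x - c * H x) * g x\<bar> \<le> R x + \<eta> * (H x * g x)"
      using g[OF x] by (simp add: abs_mult)
    moreover have "\<bar>c * (H x * g x - 1)\<bar> = \<bar>c\<bar> * \<bar>H x * g x - 1\<bar>" by (rule abs_mult)
    moreover have "F x * g x - c = (F x - c * H x) * g x + c * (H x * g x - 1)"
      by (simp add: algebra_simps)
    ultimately show ?thesis by linarith
  qed
  have "((\<lambda>x. R x + \<eta> * (H x * g x) + \<bar>c\<bar> * \<bar>H x * g x - 1\<bar>) \<longlongrightarrow>
      (\<Sum>n<N. \<bar>f n - c * h n\<bar> / fact n * 0) + \<eta> * 1 + \<bar>c\<bar> * \<bar>1 - 1\<bar>) at_top"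
    unfolding R_def H_def by (intro tendsto_intros gh gp)
  then have "((\<lambda>x. R x + \<eta> * (H x * g x) + \<bar>c\<bar> * \<bar>H x * g x - 1\<bar>) \<longlongrightarrow> \<eta>) at_top" by simp
  then have "\<forall>\<^sub>F x in at_top. R x + \<eta> * (H x * g x) + \<bar>c\<bar> * \<bar>H x * g x - 1\<bar> < \<epsilon>"
    using \<eta>(2) by (rule order_tendstoD)
  with eventually_gt_at_top[of 0]
  show "\<forall>\<^sub>F x in at_top. dist ((\<Sum>n. f n * (x ^ n / fact n)) * g x) c < \<epsilon>"
    by eventually_elim (use main in \<open>fastforce simp: dist_real_def F_def\<close>)
qed

lemma power_exp_powr_tendsto_0:
  fixes \<alpha> :: real
  assumes "\<bar>\<alpha>\<bar> \<le> 1"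
  shows "((\<lambda>x. x ^ k * (exp (- x) * x powr (- \<alpha>))) \<longlongrightarrow> 0) at_top"
proof (rule Lim_null_comparison)
  show "\<forall>\<^sub>F x in at_top. norm (x ^ k * (exp (- x) * x powr (- \<alpha>))) \<le> x ^ Suc k / exp x"
    using eventually_ge_at_top[of 1]
  proof eventually_elim
    case (elim x)
    have "x powr (- \<alpha>) \<le> x powr 1" using elim assms by (intro powr_mono) auto
    then have "x ^ k * exp (- x) * x powr (- \<alpha>) \<le> x ^ k * exp (- x) * x"
      using elim by (intro mult_left_mono) auto
    then show ?case using elim by (simp add: exp_minus field_simps)
  qed
  show "((\<lambda>x::real. x ^ Suc k / exp x) \<longlongrightarrow> 0) at_top" by (rule tendsto_power_div_exp_0)
qed

text \<open>The leading term Gamma(b)/Gamma(a) e^x x^(a-b), by comparing (a)_n/(b)_n with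
  (n+1)^(a-b). The restriction on |a - b| comes from the Poisson estimate.\<close>

lemma kummerM_asymptotic:
  assumes "a > 0" "b > 0" "\<bar>a - b\<bar> \<le> 1"
  shows "((\<lambda>x. kummerM a b x * (exp (- x) * x powr (b - a))) \<longlongrightarrow> Gamma b / Gamma a) at_top"
proof -
  have k: "kummer_coeff a b n * x ^ n = pochhammer a n / pochhammer b n * (x ^ n / fact n)" for n x
    by (simp add: kummer_coeff_def)
  have g0: "((\<lambda>x. x ^ k * (exp (- x) * x powr (b - a))) \<longlongrightarrow> 0) at_top" for k
    using power_exp_powr_tendsto_0[of "a - b" k] assms by simp
  have gh: "((\<lambda>x. (\<Sum>n. real (Suc n) powr (a - b) * (x ^ n / fact n)) * (exp (- x) * x powr (b - a))) \<longlongrightarrow> 1) at_top"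
    using poisson_powr_tendsto[of "a - b"] assms by (simp add: mult.assoc)
  show ?thesis
    unfolding kummerM_eq k
    by (rule exp_series_weighted_tendsto[where h = "\<lambda>n. real (Suc n) powr (a - b)", OF _ pochhammer_ratio_tendsto _ _ _ gh g0])
      (use assms summable_kummer[of b a] summable_powr_exp[of "a - b"] in \<open>auto simp: k\<close>)
qed

text \<open>The parameters are those of \<open>profE_closed\<close>. The exponentials cancel, and
  the powers x^(1/6) and x^(-1/6) leave x^(1/3).\<close>

lemma kummerM_ratio_tendsto:
  "((\<lambda>x. kummerM (5/6) (2/3) x / (x powr (1/3) * kummerM (7/6) (4/3) x)) \<longlongrightarrow>
     (Gamma (2/3) / Gamma (5/6)) / (Gamma (4/3) / Gamma (7/6))) at_top"
proof -
  have nz: "Gamma (4/3::real) \<noteq> 0" "Gamma (7/6::real) \<noteq> 0"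
    using Gamma_real_pos[of "4/3"] Gamma_real_pos[of "7/6"] by linarith+
  have "((\<lambda>x. kummerM (5/6) (2/3) x * (exp (- x) * x powr (2/3 - 5/6)) /
      (kummerM (7/6) (4/3) x * (exp (- x) * x powr (4/3 - 7/6)))) \<longlongrightarrow>
     (Gamma (2/3) / Gamma (5/6)) / (Gamma (4/3) / Gamma (7/6))) at_top"
    using nz by (intro tendsto_divide kummerM_asymptotic) auto
  moreover have "\<forall>\<^sub>F x in at_top. kummerM (5/6) (2/3) x * (exp (- x) * x powr (2/3 - 5/6)) /
      (kummerM (7/6) (4/3) x * (exp (- x) * x powr (4/3 - 7/6)))
     = kummerM (5/6) (2/3) x / (x powr (1/3) * kummerM (7/6) (4/3) x)"
    using eventually_gt_at_top[of 0]
  proof eventually_elim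
    case (elim x)
    have e: "x powr (4/3 - 7/6) = x powr (1/3) * x powr (2/3 - 5/6)"
      by (simp flip: powr_add)
    have "exp (- x) * x powr (2/3 - 5/6) \<noteq> 0" using elim by simp
    then show ?case unfolding e by (simp add: mult_ac)
  qed
  ultimately show ?thesis by (rule Lim_transform_eventually)
qed

section \<open>The similarity profile\<close>

text \<open>The bracket of \<open>Lambda0\<close> with free constants. The fundamental solutions
  used later are \<open>A = 1, B = 0\<close> and \<open>A = 0, B = -1\<close>.\<close>

definition profF :: "real \<Rightarrow> real \<Rightarrow> real \<Rightarrow> real" where
  "profF A B t = A * kummerM (-1/6) (2/3) (- (t ^ 3) / 9) - B * (t * kummerM (1/6) (4/3) (- (t ^ 3) / 9))"

text \<open>The derivative of \<open>profF\<close>, written out: -t^2/3 is the derivative of the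
  inner function, and -1/4 = (-1/6)/(2/3) and 1/8 = (1/6)/(4/3) are the factors a/b of Kummer's
  derivative formula.\<close>

definition profP :: "real \<Rightarrow> real \<Rightarrow> real \<Rightarrow> real" where
  "profP A B t = A * (- (t\<^sup>2) / 3 * (-1/4 * kummerM (5/6) (5/3) (- (t ^ 3) / 9)))
     - B * (kummerM (1/6) (4/3) (- (t ^ 3) / 9)
            + t * (- (t\<^sup>2) / 3 * (1/8 * kummerM (7/6) (7/3) (- (t ^ 3) / 9))))"

definition profE :: "real \<Rightarrow> real \<Rightarrow> real \<Rightarrow> real" where
  "profE A B t = profF A B t / 6 - t * profP A B t / 3"

text \<open>The shifted parameters are separate variables tied by equations, so that instances carry
  evaluated fractions.\<close>

lemma DERIV_kummerM_cube:
  assumes "b > 0" "c = a / b" "a' = a + 1" "b' = b + 1"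
  shows "((\<lambda>t. kummerM a b (- (t ^ 3) / 9)) has_real_derivative
     (- (t\<^sup>2) / 3 * (c * kummerM a' b' (- (t ^ 3) / 9)))) (at t)"
proof -
  have "((\<lambda>t::real. - (t ^ 3) / 9) has_real_derivative - (t\<^sup>2) / 3) (at t)"
    by (auto intro!: derivative_eq_intros)
  from DERIV_chain2[OF DERIV_kummerM[OF assms(1)] this] show ?thesis
    using assms by (simp add: mult.commute)
qed

lemma DERIV_profF: "(profF A B has_real_derivative profP A B t) (at t)"
proof -
  note k1 = DERIV_kummerM_cube[of "2/3" "-1/4" "-1/6" "5/6" "5/3" t, simplified]
  note k2 = DERIV_kummerM_cube[of "4/3" "1/8" "1/6" "7/6" "7/3" t, simplified]
  show ?thesis
    unfolding profF_def[abs_def] profP_def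
    by (rule DERIV_cong, (rule derivative_intros k1 k2 | simp)+) (simp add: algebra_simps)
qed

lemma DERIV_profP: "(profP A B has_real_derivative t * profE A B t) (at t)"
proof -
  define z where "z = - (t ^ 3) / 9"
  have o1: "z * (-1/4 * (1/2 * kummerM (11/6) (8/3) z)) + (2/3 - z) * (-1/4 * kummerM (5/6) (5/3) z)
      + 1/6 * kummerM (-1/6) (2/3) z = 0"
    using kummerM_ode[of "2/3" z "-1/6"] by simp
  have o2: "z * (1/8 * (1/2 * kummerM (13/6) (10/3) z)) + (4/3 - z) * (1/8 * kummerM (7/6) (7/3) z)
      - 1/6 * kummerM (1/6) (4/3) z = 0"
    using kummerM_ode[of "4/3" z "1/6"] by simp
  define k0 k1 k2 l0 l1 l2 where "k0 = kummerM (-1/6) (2/3) z" and "k1 = kummerM (5/6) (5/3) z"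
    and "k2 = kummerM (11/6) (8/3) z" and "l0 = kummerM (1/6) (4/3) z"
    and "l1 = kummerM (7/6) (7/3) z" and "l2 = kummerM (13/6) (10/3) z"
  have "(profP A B has_real_derivative
     A * (- (2 * t) / 3 * (-1/4 * k1) + (- (t\<^sup>2) / 3) * (-1/4 * (- (t\<^sup>2) / 3 * (1/2 * k2))))
     - B * ((- (t\<^sup>2) / 3 * (1/8 * l1)) + ((- (t\<^sup>2) / 3 * (1/8 * l1))
        + t * (- (2 * t) / 3 * (1/8 * l1) + (- (t\<^sup>2) / 3) * (1/8 * (- (t\<^sup>2) / 3 * (1/2 * l2))))))) (at t)"
  proof -
    note d1 = DERIV_kummerM_cube[of "5/3" "1/2" "5/6" "11/6" "8/3" t, simplified]
    note d2 = DERIV_kummerM_cube[of "4/3" "1/8" "1/6" "7/6" "7/3" t, simplified]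
    note d3 = DERIV_kummerM_cube[of "7/3" "1/2" "7/6" "13/6" "10/3" t, simplified]
    show ?thesis
      unfolding profP_def[abs_def] k1_def k2_def l1_def l2_def z_def
      by (rule DERIV_cong, (rule derivative_intros d1 d2 d3 | simp)+) (simp add: algebra_simps)
  qed
  moreover have "A * (- (2 * t) / 3 * (-1/4 * k1) + (- (t\<^sup>2) / 3) * (-1/4 * (- (t\<^sup>2) / 3 * (1/2 * k2))))
     - B * ((- (t\<^sup>2) / 3 * (1/8 * l1)) + ((- (t\<^sup>2) / 3 * (1/8 * l1))
        + t * (- (2 * t) / 3 * (1/8 * l1) + (- (t\<^sup>2) / 3) * (1/8 * (- (t\<^sup>2) / 3 * (1/2 * l2))))))
     = t * profE A B t"
  proof -
    have E: "profE A B t = A * (k0 / 6 - t * (- (t\<^sup>2) / 3 * (-1/4 * k1)) / 3)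
        - B * (t * l0 / 6 - t * (l0 + t * (- (t\<^sup>2) / 3 * (1/8 * l1))) / 3)"
      unfolding profE_def profF_def profP_def z_def[symmetric] k0_def k1_def l0_def l1_def
      by (simp add: algebra_simps diff_divide_distrib add_divide_distrib)
    \<comment> \<open>The differences in \<open>p1\<close> and \<open>p2\<close> are -t and -t^2
      times the left sides of Kummer's equations \<open>o1\<close> and \<open>o2\<close>, hence
      zero.\<close>
    have p1: "- (2 * t) / 3 * (-1/4 * k1) + (- (t\<^sup>2) / 3) * (-1/4 * (- (t\<^sup>2) / 3 * (1/2 * k2)))
        - t * (k0 / 6 - t * (- (t\<^sup>2) / 3 * (-1/4 * k1)) / 3)
       = - t * (z * (-1/4 * (1/2 * k2)) + (2/3 - z) * (-1/4 * k1) + 1/6 * k0)"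
      unfolding z_def by (simp add: field_simps power2_eq_square power3_eq_cube)
    have p2: "(- (t\<^sup>2) / 3 * (1/8 * l1)) + ((- (t\<^sup>2) / 3 * (1/8 * l1))
        + t * (- (2 * t) / 3 * (1/8 * l1) + (- (t\<^sup>2) / 3) * (1/8 * (- (t\<^sup>2) / 3 * (1/2 * l2)))))
        - t * (t * l0 / 6 - t * (l0 + t * (- (t\<^sup>2) / 3 * (1/8 * l1))) / 3)
       = - (t\<^sup>2) * (z * (1/8 * (1/2 * l2)) + (4/3 - z) * (1/8 * l1) - 1/6 * l0)"
      unfolding z_def by (simp add: field_simps power2_eq_square power3_eq_cube)
    have q1: "- (2 * t) / 3 * (-1/4 * k1) + (- (t\<^sup>2) / 3) * (-1/4 * (- (t\<^sup>2) / 3 * (1/2 * k2)))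
        = t * (k0 / 6 - t * (- (t\<^sup>2) / 3 * (-1/4 * k1)) / 3)"
      using p1 unfolding o1[folded k0_def k1_def k2_def] mult_zero_right by (simp only: right_minus_eq)
    have q2: "(- (t\<^sup>2) / 3 * (1/8 * l1)) + ((- (t\<^sup>2) / 3 * (1/8 * l1))
        + t * (- (2 * t) / 3 * (1/8 * l1) + (- (t\<^sup>2) / 3) * (1/8 * (- (t\<^sup>2) / 3 * (1/2 * l2)))))
        = t * (t * l0 / 6 - t * (l0 + t * (- (t\<^sup>2) / 3 * (1/8 * l1))) / 3)"
      using p2 unfolding o2[folded l0_def l1_def l2_def] mult_zero_right by (simp only: right_minus_eq)
    show ?thesis unfolding q1 q2 E by (simp only: right_diff_distrib mult.left_commute)
  qed
  ultimately show ?thesis by simp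
qed

lemma DERIV_profE:
  "(profE A B has_real_derivative (- profP A B t / 6 - t\<^sup>2 * profE A B t / 3)) (at t)"
proof -
  have "((\<lambda>t. profF A B t / 6 - t * profP A B t / 3) has_real_derivative
      (profP A B t / 6 - (1 * profP A B t + (t * profE A B t) * t) / 3)) (at t)"
    by (intro DERIV_diff DERIV_cdivide DERIV_mult DERIV_ident DERIV_profF DERIV_profP)
  moreover have "profP A B t / 6 - (1 * profP A B t + (t * profE A B t) * t) / 3
      = - profP A B t / 6 - t\<^sup>2 * profE A B t / 3"
    by (simp add: field_simps power2_eq_square)
  moreover have "profE A B = (\<lambda>t. profF A B t / 6 - t * profP A B t / 3)"
    by (simp add: profE_def fun_eq_iff)
  ultimately show ?thesis by (simp only:)
qed

lemma kummerM_0 [simp]: "kummerM a b 0 = 1"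
  using powser_zero[of "kummer_coeff a b"] by (simp add: kummerM_eq) (simp add: kummer_coeff_def)

lemma profP_0: "profP A B 0 = - B"
  by (simp add: profP_def)

lemma profE_0: "profE A B 0 = A / 6"
  by (simp add: profE_def profF_def)

text \<open>By \<open>kummerM_raise\<close>, since t d/dt acts as 3 z d/dz on functions of z =
  -t^3/9. Here all Kummer parameters are positive, unlike in \<open>profF\<close>, so for t < 0 both
  series have positive terms and \<open>kummerM_asymptotic\<close> applies.\<close>

lemma profE_closed:
  "profE A B t = A / 6 * kummerM (5/6) (2/3) (- (t ^ 3) / 9) + B / 6 * (t * kummerM (7/6) (4/3) (- (t ^ 3) / 9))"
proof -
  define z where "z = - (t ^ 3) / 9"
  have r1: "-1/6 * kummerM (-1/6) (2/3) z + z * (-1/4 * kummerM (5/6) (5/3) z) = -1/6 * kummerM (5/6) (2/3) z"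
    using kummerM_raise[of "2/3" "-1/6" z] by simp
  have r2: "1/6 * kummerM (1/6) (4/3) z + z * (1/8 * kummerM (7/6) (7/3) z) = 1/6 * kummerM (7/6) (4/3) z"
    using kummerM_raise[of "4/3" "1/6" z] by simp
  have "profE A B t = A * - (-1/6 * kummerM (-1/6) (2/3) z + z * (-1/4 * kummerM (5/6) (5/3) z))
      + B * (t * (1/6 * kummerM (1/6) (4/3) z + z * (1/8 * kummerM (7/6) (7/3) z)))"
    unfolding profE_def profF_def profP_def z_def
    by (simp add: field_simps power2_eq_square power3_eq_cube)
  then have "profE A B t = A * - (-1/6 * kummerM (5/6) (2/3) z) + B * (t * (1/6 * kummerM (7/6) (4/3) z))"
    unfolding r1 r2 .
  then show ?thesis unfolding z_def by simp
qed

lemma prof_linear: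
  "profP A B t = A * profP 1 0 t - B * profP 0 (-1) t"
  "profE A B t = A * profE 1 0 t - B * profE 0 (-1) t"
  by (simp_all add: profP_def profE_closed)

section \<open>A priori bounds for positive arguments\<close>

lemma exp_barrier:
  fixes g \<phi> :: "real \<Rightarrow> real"
  assumes g: "\<And>t. t \<ge> a \<Longrightarrow> (g has_real_derivative r t - t\<^sup>2 * g t / 3) (at t)"
    and \<phi>: "\<And>t. t \<ge> a \<Longrightarrow> (\<phi> has_real_derivative \<phi>' t) (at t)"
    and r: "\<And>t. t \<ge> a \<Longrightarrow> \<bar>r t\<bar> \<le> t\<^sup>2 * \<phi> t / 3 + \<phi>' t"
    and init: "\<bar>g a\<bar> \<le> \<phi> a" and "t \<ge> a"
  shows "\<bar>g t\<bar> \<le> \<phi> t"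
proof -
  have le: "0 \<le> \<phi> t + s * g t" if s: "s = 1 \<or> s = -1" for s :: real
  proof -
    \<comment> \<open>exp(t^3/9) is the integrating factor of g' = r - t^2 g/3. Assumption
      \<open>r\<close> makes \<phi> a supersolution, so the product is nondecreasing for both signs
      of \<open>s\<close>.\<close>
    let ?h = "\<lambda>t. exp (t ^ 3 / 9) * (\<phi> t + s * g t)"
    have "?h a \<le> ?h t"
    proof (rule DERIV_nonneg_imp_nondecreasing[OF \<open>t \<ge> a\<close>])
      fix x assume x: "a \<le> x" "x \<le> t"
      have "(?h has_real_derivative exp (x ^ 3 / 9) * (x\<^sup>2 * \<phi> x / 3 + \<phi>' x + s * r x)) (at x)"
        using s by (auto intro!: derivative_eq_intros g[OF x(1)] \<phi>[OF x(1)] simp: field_simps)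
      moreover have "0 \<le> exp (x ^ 3 / 9) * (x\<^sup>2 * \<phi> x / 3 + \<phi>' x + s * r x)"
        using r[OF x(1)] s by (intro mult_nonneg_nonneg) auto
      ultimately show "\<exists>y. (?h has_real_derivative y) (at x) \<and> 0 \<le> y" by blast
    qed
    moreover have "0 \<le> ?h a" using init s by (intro mult_nonneg_nonneg) auto
    ultimately have "0 \<le> ?h t" by linarith
    then show ?thesis by (simp add: zero_le_mult_iff)
  qed
  from le[of 1] le[of "-1"] show ?thesis by auto
qed

text \<open>This is E'. It gets its own name because it solves an equation of the same dissipative
  type as E, so that \<open>exp_barrier\<close> applies again, and because F''' = E + t H.\<close>

definition profH :: "real \<Rightarrow> real \<Rightarrow> real \<Rightarrow> real" where
  "profH A B t = - profP A B t / 6 - t\<^sup>2 * profE A B t / 3"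

lemma DERIV_profE': "(profE A B has_real_derivative profH A B t) (at t)"
  unfolding profH_def by (rule DERIV_profE)

lemma DERIV_profH:
  "(profH A B has_real_derivative (- 5/6 * (t * profE A B t) - t\<^sup>2 * profH A B t / 3)) (at t)"
proof -
  have "((\<lambda>t. - profP A B t / 6 - t\<^sup>2 * profE A B t / 3) has_real_derivative
      (- (t * profE A B t) / 6 - ((2 * t) * profE A B t + profH A B t * t\<^sup>2) / 3)) (at t)"
    by (rule DERIV_diff DERIV_cdivide DERIV_minus DERIV_mult DERIV_profP DERIV_profE' refl
        | (auto intro!: derivative_eq_intros)[1])+
  moreover have "- (t * profE A B t) / 6 - ((2 * t) * profE A B t + profH A B t * t\<^sup>2) / 3
      = - 5/6 * (t * profE A B t) - t\<^sup>2 * profH A B t / 3" by (simp add: field_simps)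
  moreover have "profH A B = (\<lambda>t. - profP A B t / 6 - t\<^sup>2 * profE A B t / 3)"
    by (simp add: profH_def fun_eq_iff)
  ultimately show ?thesis by (simp only:)
qed

text \<open>Each bound is the source term of the next: the Lyapunov function bounds P, P drives the
  equation of E, and t E drives that of H.\<close>

lemma prof_bounds_pos:
  "\<exists>C. \<forall>t\<ge>2. \<bar>profP A B t\<bar> \<le> C \<and> t\<^sup>2 * \<bar>profE A B t\<bar> \<le> C \<and> t * \<bar>profH A B t\<bar> \<le> C"
proof -
  let ?P = "profP A B" and ?E = "profE A B" and ?H = "profH A B"
  \<comment> \<open>Lyapunov function of the system \<open>P' = t E\<close>, \<open>E' = - P / 6 - t\<^sup>2 E / 3\<close>\<close>
  let ?V = "\<lambda>t. (?P t)\<^sup>2 / 2 + 3 * t * (?E t)\<^sup>2"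
  have V: "?V t \<le> ?V 2" if "t \<ge> 2" for t
  proof (rule DERIV_nonpos_imp_nonincreasing[OF that])
    fix x :: real assume x: "2 \<le> x" "x \<le> t"
    \<comment> \<open>The weight 3 t makes the mixed terms t P E cancel; what remains is negative
      once 2 x^3 > 3.\<close>
    have "(?V has_real_derivative ((3 - 2 * x ^ 3) * (?E x)\<^sup>2)) (at x)"
      by (auto intro!: derivative_eq_intros DERIV_profP DERIV_profE
          simp: field_simps power2_eq_square power3_eq_cube)
    moreover have "2 ^ 3 \<le> x ^ 3" using x by (intro power_mono) auto
    ultimately show "\<exists>y. (?V has_real_derivative y) (at x) \<and> y \<le> 0"
      by (intro exI[of _ "(3 - 2 * x ^ 3) * (?E x)\<^sup>2"]) (auto intro!: mult_nonpos_nonneg)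
  qed
  define b where "b = sqrt (2 * ?V 2)"
  have b: "b \<ge> 0" by (simp add: b_def)
  have P: "\<bar>?P t\<bar> \<le> b" if "t \<ge> 2" for t
  proof -
    have "0 \<le> 3 * t * (?E t)\<^sup>2" using that by simp
    moreover have "x / 2 + y \<le> z \<Longrightarrow> 0 \<le> y \<Longrightarrow> x \<le> 2 * z" for x y z :: real by linarith
    ultimately have "(?P t)\<^sup>2 \<le> 2 * ?V 2" using V[OF that] by blast
    then have "sqrt ((?P t)\<^sup>2) \<le> b" unfolding b_def by (rule real_sqrt_le_mono)
    then show ?thesis by simp
  qed
  \<comment> \<open>4 |E(2)| covers the initial condition at t = 2. With 2 b, the barrier leaves K/3
    - 2K/8 = K/12 >= b/6, which is the bound for the source -P/6.\<close>
  define K where "K = 2 * b + 4 * \<bar>?E 2\<bar>"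
  have K: "K \<ge> 2 * b" "K \<ge> 4 * \<bar>?E 2\<bar>" "K \<ge> 0" using b by (auto simp: K_def)
  have E: "\<bar>?E t\<bar> \<le> K / t\<^sup>2" if "t \<ge> 2" for t
  proof (rule exp_barrier[where a = 2 and r = "\<lambda>t. - ?P t / 6" and \<phi>' = "\<lambda>t. - 2 * K / t ^ 3", OF _ _ _ _ that])
    show "(?E has_real_derivative - ?P t / 6 - t\<^sup>2 * ?E t / 3) (at t)" for t by (rule DERIV_profE)
    show "((\<lambda>t. K / t\<^sup>2) has_real_derivative - 2 * K / t ^ 3) (at t)" if "2 \<le> t" for t
      using that by (auto intro!: derivative_eq_intros simp: field_simps power2_eq_square power3_eq_cube)
    show "\<bar>- ?P t / 6\<bar> \<le> t\<^sup>2 * (K / t\<^sup>2) / 3 + - 2 * K / t ^ 3" if t: "2 \<le> t" for t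
    proof -
      have "2 ^ 3 \<le> t ^ 3" using t by (intro power_mono) auto
      then have "2 * K / t ^ 3 \<le> 2 * K / 8" using K t by (intro divide_left_mono) auto
      moreover have "t\<^sup>2 * (K / t\<^sup>2) / 3 = K / 3" using t by simp
      moreover have "\<bar>- ?P t / 6\<bar> \<le> b / 6" using P[OF t] by simp
      ultimately show ?thesis using K by simp
    qed
    show "\<bar>?E 2\<bar> \<le> K / 2\<^sup>2" using K by simp
  qed
  \<comment> \<open>2 |H(2)| covers the initial condition; the barrier leaves 2L/3 - L/4 = 5L/12,
    against a source of at most 5K/12.\<close>
  define L where "L = 2 * K + 2 * \<bar>?H 2\<bar>"
  have L: "L \<ge> 2 * K" "L \<ge> 2 * \<bar>?H 2\<bar>" "L \<ge> 0" using K by (auto simp: L_def)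
  have H: "\<bar>?H t\<bar> \<le> L / t" if "t \<ge> 2" for t
  proof (rule exp_barrier[where a = 2 and r = "\<lambda>t. - 5/6 * (t * ?E t)" and \<phi>' = "\<lambda>t. - L / t\<^sup>2", OF _ _ _ _ that])
    show "(?H has_real_derivative - 5/6 * (t * ?E t) - t\<^sup>2 * ?H t / 3) (at t)" for t by (rule DERIV_profH)
    show "((\<lambda>t. L / t) has_real_derivative - L / t\<^sup>2) (at t)" if "2 \<le> t" for t
      using that by (auto intro!: derivative_eq_intros simp: field_simps power2_eq_square)
    show "\<bar>- 5/6 * (t * ?E t)\<bar> \<le> t\<^sup>2 * (L / t) / 3 + - L / t\<^sup>2" if t: "2 \<le> t" for t
    proof -
      have "2 ^ 2 \<le> t ^ 2" using t by (intro power_mono) auto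
      then have "L / t\<^sup>2 \<le> L / 4" using L t by (intro divide_left_mono) auto
      moreover have "t\<^sup>2 * (L / t) / 3 = t * L / 3" using t by (simp add: power2_eq_square)
      moreover have "2 * L \<le> t * L" using t L by (intro mult_right_mono) auto
      moreover have "\<bar>- 5/6 * (t * ?E t)\<bar> \<le> 5/6 * (K / 2)"
      proof -
        have "t * \<bar>?E t\<bar> \<le> t * (K / t\<^sup>2)" using E[OF t] t by (intro mult_left_mono) auto
        also have "\<dots> = K / t" using t by (simp add: power2_eq_square)
        also have "\<dots> \<le> K / 2" using t K by (intro divide_left_mono) auto
        finally show ?thesis using t by (simp add: abs_mult)
      qed
      moreover have "- L / t\<^sup>2 = - (L / t\<^sup>2)" by simp
      ultimately show ?thesis using L by linarith
    qed
    show "\<bar>?H 2\<bar> \<le> L / 2" using L by simp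
  qed
  have "\<bar>?P t\<bar> \<le> b + K + L \<and> t\<^sup>2 * \<bar>?E t\<bar> \<le> b + K + L \<and> t * \<bar>?H t\<bar> \<le> b + K + L" if "t \<ge> 2" for t
    using P[OF that] E[OF that] H[OF that] that b K(3) L(3) by (auto simp: field_simps)
  then show ?thesis by blast
qed

section \<open>Signs and a priori bounds for negative arguments\<close>

lemma DERIV_profP_reflect:
  "((\<lambda>\<tau>. profP A B (- \<tau>)) has_real_derivative \<tau> * profE A B (- \<tau>)) (at \<tau>)"
  using DERIV_chain2[OF DERIV_profP DERIV_minus[OF DERIV_ident], of A B \<tau>] by simp

lemma DERIV_profE_reflect:
  "((\<lambda>\<tau>. profE A B (- \<tau>)) has_real_derivative - profH A B (- \<tau>)) (at \<tau>)"
  using DERIV_chain2[OF DERIV_profE' DERIV_minus[OF DERIV_ident], of A B \<tau>] by simp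

lemma DERIV_profH_reflect:
  "((\<lambda>\<tau>. profH A B (- \<tau>)) has_real_derivative (- 5/6 * (\<tau> * profE A B (- \<tau>)) + \<tau>\<^sup>2 * profH A B (- \<tau>) / 3)) (at \<tau>)"
  using DERIV_chain2[OF DERIV_profH DERIV_minus[OF DERIV_ident], of A B \<tau>] by simp

text \<open>Let index 1 and 2 denote the fundamental solutions at -\<tau>. A negative Wronskian
  makes e1/e2 decrease, p1/p2 increase and p1/p2 stay below e1/e2. As e1/e2 tends to B/A, both
  quotients are separated by B/A, and this is the claim for A e1 - B e2 and A p1 - B p2.\<close>

lemma prof_signs_neg:
  assumes "A > 0"
    and lim: "((\<lambda>\<tau>. profE 1 0 (- \<tau>) / profE 0 (-1) (- \<tau>)) \<longlongrightarrow> B / A) at_top"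
    and "\<tau> > 0"
  shows "profE A B (- \<tau>) > 0" "profP A B (- \<tau>) \<le> 0"
proof -
  define e1 e2 p1 p2 where "e1 = (\<lambda>\<tau>. profE 1 0 (- \<tau>))" and "e2 = (\<lambda>\<tau>. profE 0 (-1) (- \<tau>))"
    and "p1 = (\<lambda>\<tau>. profP 1 0 (- \<tau>))" and "p2 = (\<lambda>\<tau>. profP 0 (-1) (- \<tau>))"
  note D = DERIV_profE_reflect[of 1 0, folded e1_def] DERIV_profE_reflect[of 0 "-1", folded e2_def]
    DERIV_profP_reflect[of 1 0, folded p1_def] DERIV_profP_reflect[of 0 "-1", folded p2_def]
  have H: "profH 1 0 (- s) = - p1 s / 6 - s\<^sup>2 * e1 s / 3" "profH 0 (-1) (- s) = - p2 s / 6 - s\<^sup>2 * e2 s / 3" for s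
    by (auto simp: profH_def e1_def e2_def p1_def p2_def)
  have De1: "(e1 has_real_derivative p1 s / 6 + s\<^sup>2 * e1 s / 3) (at s)"
   and De2: "(e2 has_real_derivative p2 s / 6 + s\<^sup>2 * e2 s / 3) (at s)"
   and Dp1: "(p1 has_real_derivative s * e1 s) (at s)"
   and Dp2: "(p2 has_real_derivative s * e2 s) (at s)" for s
    using D(1,2)[of s] D(3,4)[of s] unfolding H by (auto simp: e1_def e2_def add.commute)
  \<comment> \<open>The reflected system p' = s e, e' = p/6 + s^2 e/3 has trace s^2/3, so w(s) =
    exp(s^3/9) w(0), with w(0) = -1/6.\<close>
  define w where "w = (\<lambda>s. p1 s * e2 s - e1 s * p2 s)"
  have e2: "e2 s > 0" if "s > 0" for s
    using kummerM_ge_1[of "7/6" "4/3" "s ^ 3 / 9"] that by (auto simp: e2_def profE_closed)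
  have p2: "p2 s > 0" if "s \<ge> 0" for s
  proof -
    have "p2 0 \<le> p2 s"
      by (rule DERIV_nonneg_imp_nondecreasing[OF that])
        (use Dp2 e2 in \<open>metis less_eq_real_def mult_nonneg_nonneg mult_zero_left\<close>)
    then show ?thesis by (simp add: p2_def profP_0)
  qed
  have w: "w s < 0" if "s \<ge> 0" for s
  proof -
    let ?h = "\<lambda>s. exp (- (s ^ 3 / 9)) * w s"
    have "(?h has_real_derivative 0) (at x)" for x
      unfolding w_def
      by (auto intro!: derivative_eq_intros De1 De2 Dp1 Dp2 simp: field_simps power2_eq_square)
    then have "?h s = ?h 0" by (intro DERIV_isconst_all) auto
    also have "\<dots> < 0" by (simp add: w_def p1_def e2_def e1_def p2_def profP_0 profE_0)
    finally show ?thesis by (simp add: mult_less_0_iff)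
  qed
  have dec: "e1 y / e2 y < e1 x / e2 x" if "0 < x" "x < y" for x y
  proof (rule DERIV_neg_imp_decreasing[OF that(2)])
    fix s assume s: "x \<le> s" "s \<le> y"
    then have s0: "e2 s > 0" "w s < 0" using that e2 w by auto
    have "((\<lambda>s. e1 s / e2 s) has_real_derivative w s / 6 / (e2 s)\<^sup>2) (at s)"
      using s0 by (auto intro!: derivative_eq_intros De1 De2 simp: w_def field_simps power2_eq_square)
    then show "\<exists>d. ((\<lambda>s. e1 s / e2 s) has_real_derivative d) (at s) \<and> d < 0"
      using s0 by (intro exI[of _ "w s / 6 / (e2 s)\<^sup>2"]) (auto simp: divide_less_0_iff)
  qed
  have inc: "p1 x / p2 x \<le> p1 y / p2 y" if "0 < x" "x \<le> y" for x y
  proof (rule DERIV_nonneg_imp_nondecreasing[OF that(2)])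
    fix s assume s: "x \<le> s" "s \<le> y"
    then have s0: "p2 s > 0" "w s < 0" "s > 0" using that p2 w by auto
    have "((\<lambda>s. p1 s / p2 s) has_real_derivative - s * w s / (p2 s)\<^sup>2) (at s)"
      using s0 by (auto intro!: derivative_eq_intros Dp1 Dp2 simp: w_def field_simps power2_eq_square)
    then show "\<exists>d. ((\<lambda>s. p1 s / p2 s) has_real_derivative d) (at s) \<and> 0 \<le> d"
      using s0 by (intro exI[of _ "- s * w s / (p2 s)\<^sup>2"]) (auto intro!: divide_nonpos_nonneg mult_nonneg_nonpos)
  qed
  have cmp: "p1 s / p2 s \<le> e1 s / e2 s" if "s > 0" for s
    using w[of s] p2[of s] e2[of s] that by (simp add: w_def divide_le_eq le_divide_eq field_simps)
  have lim': "((\<lambda>\<tau>. e1 \<tau> / e2 \<tau>) \<longlongrightarrow> B / A) at_top" using lim by (simp add: e1_def e2_def)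
  \<comment> \<open>A limit gives only a weak inequality; passing through \<tau> + 1 and using
    strict decrease makes it strict at \<tau>.\<close>
  have "B / A \<le> e1 (\<tau> + 1) / e2 (\<tau> + 1)"
    by (rule tendsto_upperbound[OF lim'])
      (use eventually_gt_at_top[of "\<tau> + 1"] in \<open>eventually_elim, use dec \<open>\<tau> > 0\<close> in \<open>fastforce intro: less_imp_le\<close>\<close>, simp)
  also have "\<dots> < e1 \<tau> / e2 \<tau>" using dec \<open>\<tau> > 0\<close> by simp
  finally show "profE A B (- \<tau>) > 0"
    using e2[OF \<open>\<tau> > 0\<close>] \<open>A > 0\<close> by (subst prof_linear) (simp add: e1_def e2_def field_simps)
  have "p1 \<tau> / p2 \<tau> \<le> B / A"
  proof (rule tendsto_lowerbound[OF lim'])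
    show "\<forall>\<^sub>F x in at_top. p1 \<tau> / p2 \<tau> \<le> e1 x / e2 x"
      using eventually_ge_at_top[of \<tau>]
    proof eventually_elim
      case (elim x)
      then show ?case using inc[of \<tau> x] cmp[of x] \<open>\<tau> > 0\<close> by linarith
    qed
  qed simp
  then show "profP A B (- \<tau>) \<le> 0"
    using p2[of \<tau>] \<open>\<tau> > 0\<close> \<open>A > 0\<close> by (subst prof_linear) (simp add: p1_def p2_def field_simps)
qed

text \<open>The signs make \<open>p\<close> increase within [-B, 0]. Once \<open>h >= 0\<close> is
  known, the identity \<open>h_eq\<close> bounds \<tau>^2 e and \<open>h\<close>; only the extra
  decay of \<open>h\<close> needs a barrier.\<close>

lemma prof_bounds_neg:
  assumes "A > 0" "B > 0"
    and lim: "((\<lambda>\<tau>. profE 1 0 (- \<tau>) / profE 0 (-1) (- \<tau>)) \<longlongrightarrow> B / A) at_top"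
  shows "\<exists>C. \<forall>\<tau>\<ge>1. \<bar>profP A B (- \<tau>)\<bar> \<le> C \<and> \<tau>\<^sup>2 * \<bar>profE A B (- \<tau>)\<bar> \<le> C \<and> \<tau> * \<bar>profH A B (- \<tau>)\<bar> \<le> C"
proof -
  define e p h where "e = (\<lambda>\<tau>. profE A B (- \<tau>))" and "p = (\<lambda>\<tau>. profP A B (- \<tau>))"
    and "h = (\<lambda>\<tau>. profH A B (- \<tau>))"
  have De: "(e has_real_derivative - h \<tau>) (at \<tau>)" for \<tau>
    using DERIV_profE_reflect[of A B] by (simp add: e_def h_def)
  have Dp: "(p has_real_derivative \<tau> * e \<tau>) (at \<tau>)" for \<tau>
    using DERIV_profP_reflect[of A B] by (simp add: e_def p_def)
  have Dh: "(h has_real_derivative - 5/6 * (\<tau> * e \<tau>) + \<tau>\<^sup>2 * h \<tau> / 3) (at \<tau>)" for \<tau>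
    using DERIV_profH_reflect[of A B] by (simp add: e_def h_def)
  have h_eq: "h \<tau> = - p \<tau> / 6 - \<tau>\<^sup>2 * e \<tau> / 3" for \<tau>
    by (simp add: h_def p_def e_def profH_def)
  have e: "e \<tau> > 0" and p: "p \<tau> \<le> 0" if "\<tau> > 0" for \<tau>
    using prof_signs_neg[OF \<open>A > 0\<close> lim that] by (auto simp: e_def p_def)
  have p_lb: "- B \<le> p \<tau>" if "\<tau> \<ge> 0" for \<tau>
  proof -
    have "p 0 \<le> p \<tau>"
      by (rule DERIV_nonneg_imp_nondecreasing[OF that])
        (use Dp e in \<open>metis less_eq_real_def mult_nonneg_nonneg mult_zero_left\<close>)
    then show ?thesis by (simp add: p_def profP_0)
  qed
  \<comment> \<open>If \<open>e' = - h\<close> became positive, \<open>e\<close> would stay bounded below and \<open>p\<close> would change sign.\<close>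
  have h: "h \<tau> \<ge> 0" if "\<tau> > 0" for \<tau>
  proof (rule ccontr)
    assume "\<not> h \<tau> \<ge> 0"
    then have neg: "h \<tau> < 0" by simp
    have h_neg: "h s < 0" if "s \<ge> \<tau>" for s
    proof -
      let ?g = "\<lambda>s. exp (- (s ^ 3 / 9)) * h s"
      have "?g s \<le> ?g \<tau>"
      proof (rule DERIV_nonpos_imp_nonincreasing[OF that])
        fix x assume x: "\<tau> \<le> x" "x \<le> s"
        have "(?g has_real_derivative exp (- (x ^ 3 / 9)) * (- 5/6 * (x * e x))) (at x)"
          by (auto intro!: derivative_eq_intros Dh simp: field_simps)
        moreover have "exp (- (x ^ 3 / 9)) * (- 5/6 * (x * e x)) \<le> 0"
          using e[of x] x \<open>\<tau> > 0\<close> by (intro mult_nonneg_nonpos[OF exp_ge_zero]) auto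
        ultimately show "\<exists>y. (?g has_real_derivative y) (at x) \<and> y \<le> 0" by blast
      qed
      also have "\<dots> < 0" using neg by (simp add: mult_less_0_iff)
      finally show ?thesis by (simp add: mult_less_0_iff)
    qed
    have e_mono: "e \<tau> \<le> e s" if "s \<ge> \<tau>" for s
    proof (rule DERIV_nonneg_imp_nondecreasing[OF that])
      fix x assume "\<tau> \<le> x"
      then show "\<exists>y. (e has_real_derivative y) (at x) \<and> 0 \<le> y"
        using De[of x] h_neg[of x] by (intro exI[of _ "- h x"]) auto
    qed
    let ?d = "\<tau> * e \<tau>"
    have d: "?d > 0" using e that by simp
    have lin: "p \<tau> + ?d * (s - \<tau>) \<le> p s" if "s \<ge> \<tau>" for s
    proof -
      have "p \<tau> - ?d * \<tau> \<le> p s - ?d * s"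
      proof (rule DERIV_nonneg_imp_nondecreasing[OF that, of "\<lambda>x. p x - ?d * x"])
        fix x assume x: "\<tau> \<le> x" "x \<le> s"
        have "((\<lambda>x. p x - ?d * x) has_real_derivative x * e x - ?d) (at x)"
          by (auto intro!: derivative_eq_intros Dp)
        moreover have "?d \<le> x * e x" using x e[of \<tau>] e_mono[of x] \<open>\<tau> > 0\<close> by (intro mult_mono) auto
        ultimately show "\<exists>y. ((\<lambda>x. p x - ?d * x) has_real_derivative y) (at x) \<and> 0 \<le> y"
          by (intro exI[of _ "x * e x - ?d"]) auto
      qed
      then show ?thesis by (simp add: algebra_simps)
    qed
    \<comment> \<open>At this point the linear lower bound exceeds -B + (B + 1) = 1, against p <=
      0.\<close>
    define s where "s = \<tau> + (B + 1) / ?d"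
    have s: "s \<ge> \<tau>" "s > 0" using d \<open>B > 0\<close> that by (auto simp: s_def add_pos_pos)
    have "?d * (s - \<tau>) = B + 1" using e[OF that] that by (simp add: s_def)
    with lin[OF s(1)] p_lb[of \<tau>] p[OF s(2)] that show False by linarith
  qed
  \<comment> \<open>In \<open>h_eq\<close>, h >= 0 reads \<tau>^2 e <= -p/2.\<close>
  have tau2: "\<tau>\<^sup>2 * e \<tau> \<le> B / 2" if "\<tau> > 0" for \<tau>
    using h[OF that] p_lb[of \<tau>] that unfolding h_eq by linarith
  have h_ub: "h \<tau> \<le> B / 6" if "\<tau> > 0" for \<tau>
  proof -
    have "\<tau>\<^sup>2 * e \<tau> \<ge> 0" using e[OF that] by simp
    then show ?thesis using p_lb[of \<tau>] that unfolding h_eq by linarith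
  qed
  \<comment> \<open>K/3 equals 5/6 times the bound B/2 from \<open>tau2\<close>, so the source 5/6 x
    e is absorbed by x K/3 for x >= 1.\<close>
  define K where "K = 5 * B / 4"
  have hK: "h \<tau> \<le> K / \<tau>" if "\<tau> \<ge> 1" for \<tau>
  proof -
    let ?g = "\<lambda>s. exp (- (s ^ 3 / 9)) * (K / s - h s)"
    have dec: "?g s \<le> ?g \<tau>" if "s \<ge> \<tau>" for s
    proof (rule DERIV_nonpos_imp_nonincreasing[OF that])
      fix x assume x: "\<tau> \<le> x" "x \<le> s"
      then have x1: "x \<ge> 1" using \<open>\<tau> \<ge> 1\<close> by simp
      have "(?g has_real_derivative exp (- (x ^ 3 / 9)) * (- x\<^sup>2 / 3 * (K / x) - K / x\<^sup>2 + 5/6 * (x * e x))) (at x)"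
        using x1 by (auto intro!: derivative_eq_intros Dh simp: field_simps power2_eq_square)
      moreover have "exp (- (x ^ 3 / 9)) * (- x\<^sup>2 / 3 * (K / x) - K / x\<^sup>2 + 5/6 * (x * e x)) \<le> 0"
      proof -
        have "x * e x \<le> x\<^sup>2 * e x"
          using x1 e[of x] by (intro mult_right_mono) (auto simp: power2_eq_square)
        then have "x * e x \<le> B / 2" using tau2[of x] x1 by linarith
        moreover have "- x\<^sup>2 / 3 * (K / x) = - (x * K / 3)" using x1 by (simp add: power2_eq_square)
        moreover have "1 * K \<le> x * K" using x1 \<open>B > 0\<close> by (intro mult_right_mono) (auto simp: K_def)
        moreover have "K / x\<^sup>2 \<ge> 0" using \<open>B > 0\<close> by (simp add: K_def)
        ultimately have "- x\<^sup>2 / 3 * (K / x) - K / x\<^sup>2 + 5/6 * (x * e x) \<le> 0"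
          using K_def by linarith
        then show ?thesis by (intro mult_nonneg_nonpos) auto
      qed
      ultimately show "\<exists>y. (?g has_real_derivative y) (at x) \<and> y \<le> 0" by blast
    qed
    \<comment> \<open>In this direction the equation amplifies errors, so the barrier is started at
      infinity: ?g decreases, and the boundedness of \<open>h\<close> with the factor exp(-s^3/9)
      bounds it below by a quantity tending to 0.\<close>
    have "0 \<le> ?g \<tau>"
    proof (rule tendsto_upperbound)
      show "((\<lambda>s. - (B / 6) * exp (- s)) \<longlongrightarrow> 0) at_top"
        using tendsto_mult[OF tendsto_const[of "- (B/6)"] filterlim_compose[OF exp_at_bot filterlim_uminus_at_bot_at_top]]
        by simp
      show "\<forall>\<^sub>F s in at_top. - (B / 6) * exp (- s) \<le> ?g \<tau>"
        using eventually_ge_at_top[of "max \<tau> 9"]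
      proof eventually_elim
        case (elim s)
        then have s: "s \<ge> 9" "s \<ge> \<tau>" by auto
        have "9 * 1 * s \<le> s * s * s" using s by (intro mult_mono) auto
        then have ex: "exp (- (s ^ 3 / 9)) \<le> exp (- s)" by (simp add: power3_eq_cube)
        have "K / s \<ge> 0" using s \<open>B > 0\<close> by (simp add: K_def)
        then have "- (B / 6) \<le> K / s - h s" using h_ub[of s] s by linarith
        then have "exp (- (s ^ 3 / 9)) * - (B / 6) \<le> ?g s" by (intro mult_left_mono) auto
        moreover have "exp (- s) * - (B / 6) \<le> exp (- (s ^ 3 / 9)) * - (B / 6)"
          using ex \<open>B > 0\<close> by (intro mult_right_mono_neg) auto
        ultimately show ?case using dec[OF s(2)] by (simp add: mult.commute)
      qed
    qed simp
    then show ?thesis by (simp add: zero_le_mult_iff)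
  qed
  have "\<bar>p \<tau>\<bar> \<le> 2 * B \<and> \<tau>\<^sup>2 * \<bar>e \<tau>\<bar> \<le> 2 * B \<and> \<tau> * \<bar>h \<tau>\<bar> \<le> 2 * B" if t: "\<tau> \<ge> 1" for \<tau>
  proof (intro conjI)
    show "\<bar>p \<tau>\<bar> \<le> 2 * B" using p[of \<tau>] p_lb[of \<tau>] t \<open>B > 0\<close> by simp
    show "\<tau>\<^sup>2 * \<bar>e \<tau>\<bar> \<le> 2 * B" using tau2[of \<tau>] e[of \<tau>] t \<open>B > 0\<close> by simp
    have "\<tau> * h \<tau> \<le> K" using hK[OF t] t by (simp add: field_simps)
    then show "\<tau> * \<bar>h \<tau>\<bar> \<le> 2 * B" using h[of \<tau>] t \<open>B > 0\<close> by (simp add: K_def)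
  qed
  then show ?thesis unfolding e_def p_def h_def by blast
qed

text \<open>The interface between the special functions and the integral estimates: P, Q, T are the
  first three derivatives of F. It is stable under reflection and under constant factors, so both
  end points are covered by one argument.\<close>

locale profile =
  fixes F P Q T :: "real \<Rightarrow> real" and C :: real
  assumes DERIV_F: "\<And>t. (F has_real_derivative P t) (at t)"
    and DERIV_P: "\<And>t. (P has_real_derivative Q t) (at t)"
    and DERIV_Q: "\<And>t. (Q has_real_derivative T t) (at t)"
    and F_bound: "\<And>t. \<bar>F t\<bar> \<le> C * (1 + \<bar>t\<bar>)"
    and P_bound: "\<And>t. \<bar>P t\<bar> \<le> C"
    and Q_bound: "\<And>t. (1 + \<bar>t\<bar>) * \<bar>Q t\<bar> \<le> C"
    and T_bound: "\<And>t. \<bar>T t\<bar> \<le> C"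
    and Euler_bound: "\<And>t. (1 + \<bar>t\<bar>) * \<bar>F t / 6 - t * P t / 3\<bar> \<le> C"

lemma (in profile) profile_reflect:
  "profile (\<lambda>t. F (- t)) (\<lambda>t. - P (- t)) (\<lambda>t. Q (- t)) (\<lambda>t. - T (- t)) C"
proof
  show "((\<lambda>t. F (- t)) has_real_derivative - P (- t)) (at t)" for t
    using DERIV_chain2[OF DERIV_F DERIV_minus[OF DERIV_ident], of t] by simp
  show "((\<lambda>t. - P (- t)) has_real_derivative Q (- t)) (at t)" for t
    using DERIV_minus[OF DERIV_chain2[OF DERIV_P DERIV_minus[OF DERIV_ident]], of t] by simp
  show "((\<lambda>t. Q (- t)) has_real_derivative - T (- t)) (at t)" for t
    using DERIV_chain2[OF DERIV_Q DERIV_minus[OF DERIV_ident], of t] by simp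
qed (use F_bound[of "- _"] P_bound Q_bound[of "- _"] T_bound Euler_bound[of "- _"] in auto)

lemma bounded_on_Icc:
  fixes f :: "real \<Rightarrow> real"
  assumes "continuous_on {a..b} f"
  shows "\<exists>M\<ge>0. \<forall>x\<in>{a..b}. \<bar>f x\<bar> \<le> M"
proof -
  have "bounded (f ` {a..b})"
    using assms by (intro compact_imp_bounded compact_continuous_image) auto
  then obtain M where "\<forall>x\<in>{a..b}. \<bar>f x\<bar> \<le> M" by (auto simp: bounded_iff)
  then show ?thesis by (intro exI[of _ "max M 0"]) fastforce
qed

lemma prof_bounds:
  assumes "A > 0" "B > 0"
    and lim: "((\<lambda>\<tau>. profE 1 0 (- \<tau>) / profE 0 (-1) (- \<tau>)) \<longlongrightarrow> B / A) at_top"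
  shows "\<exists>C. \<forall>t. \<bar>profP A B t\<bar> \<le> C \<and> (1 + t\<^sup>2) * \<bar>profE A B t\<bar> \<le> C \<and> (1 + \<bar>t\<bar>) * \<bar>profH A B t\<bar> \<le> C"
proof -
  let ?P = "profP A B" and ?E = "profE A B" and ?H = "profH A B"
  obtain c1 where c1: "\<And>t. t \<ge> 2 \<Longrightarrow> \<bar>?P t\<bar> \<le> c1 \<and> t\<^sup>2 * \<bar>?E t\<bar> \<le> c1 \<and> t * \<bar>?H t\<bar> \<le> c1"
    using prof_bounds_pos by blast
  obtain c2 where c2: "\<And>t. t \<ge> 1 \<Longrightarrow> \<bar>?P (-t)\<bar> \<le> c2 \<and> t\<^sup>2 * \<bar>?E (-t)\<bar> \<le> c2 \<and> t * \<bar>?H (-t)\<bar> \<le> c2"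
    using prof_bounds_neg[OF assms] by blast
  have "continuous_on {-2..2} ?P" "continuous_on {-2..2} ?E" "continuous_on {-2..2} ?H"
    using DERIV_profP DERIV_profE' DERIV_profH
    by (meson DERIV_continuous continuous_at_imp_continuous_on)+
  then obtain m1 m2 m3 where m: "m1 \<ge> 0" "m2 \<ge> 0" "m3 \<ge> 0"
    "\<forall>t\<in>{-2..2}. \<bar>?P t\<bar> \<le> m1" "\<forall>t\<in>{-2..2}. \<bar>?E t\<bar> \<le> m2" "\<forall>t\<in>{-2..2}. \<bar>?H t\<bar> \<le> m3"
    using bounded_on_Icc[of "-2" 2 ?P] bounded_on_Icc[of "-2" 2 ?E] bounded_on_Icc[of "-2" 2 ?H] by metis
  \<comment> \<open>Far out, 1 + t^2 <= 2 t^2 and 1 + |t| <= 2 |t|; on [-2, 2] these quantities are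
    at most 5 and 3.\<close>
  define C where "C = 2 * c1 + 2 * c2 + m1 + 5 * m2 + 3 * m3"
  have pos: "c1 \<ge> 0" "c2 \<ge> 0" using c1[of 2] c2[of 1] by auto
  have far: "\<bar>p\<bar> \<le> C \<and> (1 + t\<^sup>2) * \<bar>e\<bar> \<le> C \<and> (1 + \<bar>t\<bar>) * \<bar>h\<bar> \<le> C"
    if "\<bar>p\<bar> \<le> c" "t\<^sup>2 * \<bar>e\<bar> \<le> c" "\<bar>t\<bar> * \<bar>h\<bar> \<le> c" "\<bar>t\<bar> \<ge> 2" "2 * c \<le> C" "c \<ge> 0" for p e h c t
  proof -
    have "1 * 1 \<le> \<bar>t\<bar> * \<bar>t\<bar>" using that by (intro mult_mono) auto
    then have "1 \<le> t\<^sup>2" by (simp add: power2_eq_square flip: abs_mult)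
    then have "1 * \<bar>e\<bar> \<le> t\<^sup>2 * \<bar>e\<bar>" by (intro mult_right_mono) auto
    moreover have "1 * \<bar>h\<bar> \<le> \<bar>t\<bar> * \<bar>h\<bar>" using that by (intro mult_right_mono) auto
    ultimately show ?thesis using that by (simp add: distrib_right)
  qed
  have "\<bar>?P t\<bar> \<le> C \<and> (1 + t\<^sup>2) * \<bar>?E t\<bar> \<le> C \<and> (1 + \<bar>t\<bar>) * \<bar>?H t\<bar> \<le> C" for t
  proof -
    consider "t \<ge> 2" | "t \<le> -2" | "t \<in> {-2..2}" by fastforce
    then show ?thesis
    proof cases
      case 1
      show ?thesis by (rule far[of _ c1]) (use c1[of t] 1 pos m in \<open>auto simp: C_def\<close>)
    next
      case 2
      show ?thesis by (rule far[of _ c2]) (use c2[of "- t"] 2 pos m in \<open>auto simp: C_def\<close>)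
    next
      case 3
      have "\<bar>t\<bar> * \<bar>t\<bar> \<le> 2 * 2" using 3 by (intro mult_mono) auto
      then have "t\<^sup>2 \<le> 4" by (simp add: power2_eq_square flip: abs_mult)
      then have "(1 + t\<^sup>2) * \<bar>?E t\<bar> \<le> 5 * m2" using m 3 by (intro mult_mono) auto
      moreover have "(1 + \<bar>t\<bar>) * \<bar>?H t\<bar> \<le> 3 * m3" using m 3 by (intro mult_mono) auto
      moreover have "\<bar>?P t\<bar> \<le> m1" using m 3 by blast
      ultimately show ?thesis using pos m unfolding C_def by linarith
    qed
  qed
  then show ?thesis by blast
qed

lemma profile_profF:
  assumes "A > 0" "B > 0"
    and lim: "((\<lambda>\<tau>. profE 1 0 (- \<tau>) / profE 0 (-1) (- \<tau>)) \<longlongrightarrow> B / A) at_top"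
  shows "\<exists>P Q T C. profile (profF A B) P Q T C"
proof -
  let ?P = "profP A B" and ?E = "profE A B" and ?H = "profH A B"
  obtain c where c: "\<And>t. \<bar>?P t\<bar> \<le> c" "\<And>t. (1 + t\<^sup>2) * \<bar>?E t\<bar> \<le> c" "\<And>t. (1 + \<bar>t\<bar>) * \<bar>?H t\<bar> \<le> c"
    using prof_bounds[OF assms] by blast
  have c0: "c \<ge> 0" using c(1)[of 0] by linarith
  have E1: "\<bar>?E t\<bar> \<le> c" for t
  proof -
    have "1 * \<bar>?E t\<bar> \<le> (1 + t\<^sup>2) * \<bar>?E t\<bar>" by (intro mult_right_mono) auto
    with c(2)[of t] show ?thesis by linarith
  qed
  have tE: "\<bar>t\<bar> * \<bar>?E t\<bar> \<le> c" for t
  proof -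
    have "0 \<le> (\<bar>t\<bar> - 1)\<^sup>2" by (rule zero_le_power2)
    then have "2 * \<bar>t\<bar> \<le> 1 + t\<^sup>2" by (simp add: power2_diff)
    then have "\<bar>t\<bar> * \<bar>?E t\<bar> \<le> (1 + t\<^sup>2) * \<bar>?E t\<bar>" by (intro mult_right_mono) auto
    with c(2)[of t] show ?thesis by linarith
  qed
  have ttE: "t\<^sup>2 * \<bar>?E t\<bar> \<le> c" for t
    using c(2)[of t] by (simp add: distrib_right)
  have tH: "\<bar>t\<bar> * \<bar>?H t\<bar> \<le> c" for t
    using c(3)[of t] by (simp add: distrib_right)
  have F: "profF A B t = 6 * ?E t + 2 * t * ?P t" for t by (simp add: profE_def)
  \<comment> \<open>F'' = t E and F''' = E + t H; the factor 6 is dictated by F = 6 E + 2 t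
    P.\<close>
  have "profile (profF A B) ?P (\<lambda>t. t * ?E t) (\<lambda>t. ?E t + t * ?H t) (6 * c)"
  proof
    fix t
    show "(profF A B has_real_derivative ?P t) (at t)" by (rule DERIV_profF)
    show "(?P has_real_derivative t * ?E t) (at t)" by (rule DERIV_profP)
    show "((\<lambda>t. t * ?E t) has_real_derivative ?E t + t * ?H t) (at t)"
      by (auto intro!: derivative_eq_intros DERIV_profE')
    have "\<bar>2 * t * ?P t\<bar> \<le> 2 * \<bar>t\<bar> * c"
      unfolding abs_mult using c(1)[of t] by (intro mult_mono) auto
    moreover have "\<bar>t\<bar> * c \<ge> 0" using c0 by simp
    ultimately show "\<bar>profF A B t\<bar> \<le> 6 * c * (1 + \<bar>t\<bar>)"
      unfolding F using E1[of t] by (simp add: algebra_simps)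
    show "\<bar>?P t\<bar> \<le> 6 * c" using c(1)[of t] c0 by linarith
    show "(1 + \<bar>t\<bar>) * \<bar>t * ?E t\<bar> \<le> 6 * c"
    proof -
      have "\<bar>t\<bar> * \<bar>t\<bar> = t\<^sup>2" by (simp add: power2_eq_square)
      moreover have "(1 + \<bar>t\<bar>) * \<bar>t * ?E t\<bar> = \<bar>t\<bar> * \<bar>?E t\<bar> + (\<bar>t\<bar> * \<bar>t\<bar>) * \<bar>?E t\<bar>"
        by (simp only: abs_mult distrib_right mult_1 mult.assoc)
      ultimately show ?thesis using tE[of t] ttE[of t] c0 by simp
    qed
    show "\<bar>?E t + t * ?H t\<bar> \<le> 6 * c"
    proof -
      have "\<bar>t * ?H t\<bar> \<le> c" using tH[of t] by (simp only: abs_mult)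
      then show ?thesis using E1[of t] c0 by linarith
    qed
    show "(1 + \<bar>t\<bar>) * \<bar>profF A B t / 6 - t * ?P t / 3\<bar> \<le> 6 * c"
      unfolding profE_def[symmetric] distrib_right using E1[of t] tE[of t] c0 by linarith
  qed
  then show ?thesis by blast
qed

section \<open>The constants of \<open>Lambda0\<close>\<close>

definition singA :: real where "singA = Gamma (1/3) / Gamma (1/6)"
definition singB :: real where "singB = Gamma (-1/3) / Gamma (-1/6) / 9 powr (1/3)"

lemma Lambda0_eq: "Lambda0 t = 9 powr (1/6) * (1 + t\<^sup>2) powr (-1/4) * profF singA singB t"
  by (simp add: Lambda0_def profF_def singA_def singB_def mult_ac)

text \<open>The functional equation links the Gamma values in the Kummer asymptotics to those in
  \<open>Lambda0\<close>, and also shows that Gamma is negative at -1/3 and -1/6.\<close>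

lemma Gamma_shifts:
  "Gamma (2/3::real) = -1/3 * Gamma (-1/3)" "Gamma (7/6::real) = 1/6 * Gamma (1/6)"
  "Gamma (5/6::real) = -1/6 * Gamma (-1/6)" "Gamma (4/3::real) = 1/3 * Gamma (1/3)"
proof -
  have *: "(x::real) \<notin> \<int>\<^sub>\<le>\<^sub>0" if "-1 < x" "x \<noteq> 0" for x
  proof
    assume "x \<in> \<int>\<^sub>\<le>\<^sub>0"
    then obtain n where "x = - of_nat n" by (elim nonpos_Ints_cases')
    with that show False by (cases n) auto
  qed
  show "Gamma (2/3::real) = -1/3 * Gamma (-1/3)" "Gamma (7/6::real) = 1/6 * Gamma (1/6)"
  "Gamma (5/6::real) = -1/6 * Gamma (-1/6)" "Gamma (4/3::real) = 1/3 * Gamma (1/3)"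
    using Gamma_plus1[of "-1/3::real"] Gamma_plus1[of "1/6::real"]
      Gamma_plus1[of "-1/6::real"] Gamma_plus1[of "1/3::real"] by (auto simp: *)
qed

text \<open>At t = -\<tau> the Kummer argument is x = \<tau>^3/9, so the factor \<tau> of the second
  solution is 9^(1/3) x^(1/3).\<close>

lemma profE_ratio_tendsto:
  "((\<lambda>\<tau>. profE 1 0 (- \<tau>) / profE 0 (-1) (- \<tau>)) \<longlongrightarrow>
    (Gamma (2/3) / Gamma (5/6)) / (Gamma (4/3) / Gamma (7/6)) / 9 powr (1/3)) at_top"
proof -
  let ?f = "\<lambda>x. kummerM (5/6) (2/3) x / (x powr (1/3) * kummerM (7/6) (4/3) x)"
  have "filterlim (\<lambda>\<tau>::real. \<tau> ^ 3 / 9) at_top at_top"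
  proof (rule filterlim_at_top_mono[OF filterlim_ident])
    show "\<forall>\<^sub>F \<tau>::real in at_top. \<tau> \<le> \<tau> ^ 3 / 9"
      using eventually_ge_at_top[of 3]
    proof eventually_elim
      case (elim x)
      then have "3 * 3 * x \<le> x * x * x" by (intro mult_mono) auto
      then show ?case by (simp add: power3_eq_cube)
    qed
  qed
  from tendsto_divide[OF filterlim_compose[OF kummerM_ratio_tendsto this] tendsto_const[of "9 powr (1/3)"]]
  have "((\<lambda>\<tau>. ?f (\<tau> ^ 3 / 9) / 9 powr (1/3)) \<longlongrightarrow>
    (Gamma (2/3) / Gamma (5/6)) / (Gamma (4/3) / Gamma (7/6)) / 9 powr (1/3)) at_top" by simp
  moreover have "\<forall>\<^sub>F \<tau> in at_top. ?f (\<tau> ^ 3 / 9) / 9 powr (1/3) = profE 1 0 (- \<tau>) / profE 0 (-1) (- \<tau>)"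
    using eventually_gt_at_top[of 0]
  proof eventually_elim
    case (elim \<tau>)
    have "\<tau> ^ 3 = \<tau> powr 3" using elim by simp
    then have "(\<tau> ^ 3 / 9) powr (1/3) = \<tau> / 9 powr (1/3)"
      using elim by (simp add: powr_divide powr_powr del: powr_numeral)
    then show ?case using elim by (simp add: profE_closed)
  qed
  ultimately show ?thesis by (rule Lim_transform_eventually)
qed

theorem profile_Lambda0: "\<exists>P Q T C. profile (profF singA singB) P Q T C"
proof (rule profile_profF)
  have pos: "Gamma (2/3::real) > 0" "Gamma (5/6::real) > 0" "Gamma (1/3::real) > 0" "Gamma (1/6::real) > 0"
    by (auto intro: Gamma_real_pos)
  then have neg: "Gamma (-1/3::real) < 0" "Gamma (-1/6::real) < 0" by (auto simp: Gamma_shifts)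
  show "singA > 0" using pos by (simp add: singA_def)
  show "singB > 0" unfolding singB_def by (intro divide_pos_pos divide_neg_neg neg) simp
  \<comment> \<open>This equality singles out the constants of \<open>Lambda0\<close>: B/A is
    exactly the ratio at which the growing parts cancel.\<close>
  have "(Gamma (2/3) / Gamma (5/6)) / (Gamma (4/3) / Gamma (7/6)) / 9 powr (1/3) = singB / singA"
    using pos neg by (simp add: Gamma_shifts singA_def singB_def)
  then show "((\<lambda>\<tau>. profE 1 0 (- \<tau>) / profE 0 (-1) (- \<tau>)) \<longlongrightarrow> singB / singA) at_top"
    using profE_ratio_tendsto by simp
qed

section \<open>Gagliardo integrals with power weights\<close>

definition pker :: "real \<Rightarrow> real \<Rightarrow> real \<Rightarrow> real \<Rightarrow> ennreal" where
  "pker R a x0 x = ennreal (indicator {-R..R} x * \<bar>x - x0\<bar> powr (- a))"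

lemma pker_measurable [measurable]: "pker R a x0 \<in> borel_measurable borel"
  unfolding pker_def[abs_def] by measurable

lemma nn_integral_powr_Icc_finite:
  fixes a R :: real
  assumes "a < 1" "R \<ge> 0"
  shows "(\<integral>\<^sup>+x. ennreal (indicator {-R..R} x * \<bar>x\<bar> powr (- a)) \<partial>lborel) < \<infinity>"
proof -
  let ?f = "\<lambda>x::real. indicator {0..R} x * x powr (- a)"
  have "((\<lambda>x. x powr (- a)) has_integral (R powr (- a + 1) / (- a + 1))) {0..R}"
    using assms by (intro has_integral_powr_from_0) auto
  then have "((\<lambda>x. if x \<in> {0..R} then x powr (- a) else 0) has_integral (R powr (- a + 1) / (- a + 1))) UNIV"
    by (simp only: has_integral_restrict_UNIV)
  moreover have "(\<lambda>x. if x \<in> {0..R} then x powr (- a) else 0) = ?f"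
    by (auto simp: fun_eq_iff indicator_def)
  ultimately have "(?f has_integral (R powr (- a + 1) / (- a + 1))) UNIV" by simp
  then have fin: "(\<integral>\<^sup>+x. ennreal (?f x) \<partial>lborel) = ennreal (R powr (- a + 1) / (- a + 1))"
    by (intro nn_integral_has_integral_lborel) auto
  have refl: "(\<integral>\<^sup>+x. ennreal (?f x) \<partial>lborel) = (\<integral>\<^sup>+x. ennreal (?f (- x)) \<partial>lborel)"
    using nn_integral_real_affine[of "\<lambda>x. ennreal (?f x)" "-1" 0] by simp
  have "(\<integral>\<^sup>+x. ennreal (indicator {-R..R} x * \<bar>x\<bar> powr (- a)) \<partial>lborel)
      \<le> (\<integral>\<^sup>+x. ennreal (?f x) + ennreal (?f (- x)) \<partial>lborel)"
    by (intro nn_integral_mono) (auto simp: indicator_def)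
  also have "\<dots> = (\<integral>\<^sup>+x. ennreal (?f x) \<partial>lborel) + (\<integral>\<^sup>+x. ennreal (?f (- x)) \<partial>lborel)"
    by (rule nn_integral_add) auto
  also have "\<dots> < \<infinity>" unfolding refl[symmetric] fin by simp
  finally show ?thesis .
qed

text \<open>Uniform in the singular point: translating by \<open>x0\<close> moves [-R, R] into
  [-2R, 2R], where the kernel is centred at 0.\<close>

lemma nn_integral_pker_bound:
  assumes "a < 1" "R \<ge> 0"
  obtains J where "J < \<infinity>" "\<And>x0. \<bar>x0\<bar> \<le> R \<Longrightarrow> (\<integral>\<^sup>+x. pker R a x0 x \<partial>lborel) \<le> J"
proof
  let ?g = "\<lambda>x. ennreal (indicator {-2*R..2*R} x * \<bar>x\<bar> powr (- a))"
  show "(\<integral>\<^sup>+x. ?g x \<partial>lborel) < \<infinity>"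
    using nn_integral_powr_Icc_finite[of a "2 * R"] assms by simp
  fix x0 assume x0: "\<bar>x0\<bar> \<le> R"
  have "(\<integral>\<^sup>+x. pker R a x0 x \<partial>lborel) \<le> (\<integral>\<^sup>+x. ?g (- x0 + 1 * x) \<partial>lborel)"
    using x0 by (intro nn_integral_mono) (auto simp: pker_def indicator_def intro!: ennreal_leI)
  also have "\<dots> = (\<integral>\<^sup>+x. ?g x \<partial>lborel)"
    using nn_integral_real_affine[of ?g 1 "- x0"] by simp
  finally show "(\<integral>\<^sup>+x. pker R a x0 x \<partial>lborel) \<le> (\<integral>\<^sup>+x. ?g x \<partial>lborel)" .
qed

lemma pker_commute: "indicator {-R..R} y * pker R a y x = indicator {-R..R} x * pker R a x y"
  by (auto simp: pker_def indicator_def abs_minus_commute)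

text \<open>As in Schur's test: the symmetric kernel in q - q' has uniformly bounded marginals, so
  it is integrated first and the weight afterwards. The weights are added rather than multiplied, so
  b < 1 and d < 1 are separate conditions instead of one on b + d.\<close>

lemma double_pker_finite:
  assumes "b < 1" "d < 1" "R \<ge> 0" "\<bar>q0\<bar> \<le> R"
  shows "(\<integral>\<^sup>+q. \<integral>\<^sup>+q'. (pker R b q0 q + pker R b q0 q') * (indicator {-R..R} q * pker R d q q') \<partial>lborel \<partial>lborel) < \<infinity>"
proof -
  obtain Jb where Jb: "Jb < \<infinity>" "\<And>x0. \<bar>x0\<bar> \<le> R \<Longrightarrow> (\<integral>\<^sup>+x. pker R b x0 x \<partial>lborel) \<le> Jb"
    using nn_integral_pker_bound[OF assms(1,3)] by blast
  obtain Jd where Jd: "Jd < \<infinity>" "\<And>x0. \<bar>x0\<bar> \<le> R \<Longrightarrow> (\<integral>\<^sup>+x. pker R d x0 x \<partial>lborel) \<le> Jd"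
    using nn_integral_pker_bound[OF assms(2,3)] by blast
  let ?D = "\<lambda>q q'. indicator {-R..R} q * pker R d q q'"
  have D_meas [measurable]: "(\<lambda>x. ?D (fst x) (snd x)) \<in> borel_measurable (borel \<Otimes>\<^sub>M borel)"
    unfolding pker_def by measurable
  have D1: "(\<integral>\<^sup>+q'. ?D q q' \<partial>lborel) \<le> Jd" for q
  proof (cases "q \<in> {-R..R}")
    case True
    then show ?thesis using Jd(2)[of q] by auto
  qed simp
  have D2: "(\<integral>\<^sup>+q. ?D q q' \<partial>lborel) \<le> Jd" for q'
    using D1[of q'] by (subst pker_commute)
  have half1: "(\<integral>\<^sup>+q. \<integral>\<^sup>+q'. pker R b q0 q * ?D q q' \<partial>lborel \<partial>lborel) \<le> Jd * Jb"
  proof -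
    have "(\<integral>\<^sup>+q. \<integral>\<^sup>+q'. pker R b q0 q * ?D q q' \<partial>lborel \<partial>lborel)
        = (\<integral>\<^sup>+q. pker R b q0 q * (\<integral>\<^sup>+q'. ?D q q' \<partial>lborel) \<partial>lborel)"
      by (intro nn_integral_cong nn_integral_cmult) measurable
    also have "\<dots> \<le> (\<integral>\<^sup>+q. pker R b q0 q * Jd \<partial>lborel)"
      by (intro nn_integral_mono mult_left_mono D1) simp
    also have "\<dots> = (\<integral>\<^sup>+q. Jd * pker R b q0 q \<partial>lborel)" by (simp only: mult.commute)
    also have "\<dots> = Jd * (\<integral>\<^sup>+q. pker R b q0 q \<partial>lborel)" by (rule nn_integral_cmult) measurable
    also have "\<dots> \<le> Jd * Jb" using Jb(2)[OF assms(4)] by (rule mult_left_mono) simp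
    finally show ?thesis .
  qed
  have half2: "(\<integral>\<^sup>+q. \<integral>\<^sup>+q'. pker R b q0 q' * ?D q q' \<partial>lborel \<partial>lborel) \<le> Jd * Jb"
  proof -
    have "(\<integral>\<^sup>+q. \<integral>\<^sup>+q'. pker R b q0 q' * ?D q q' \<partial>lborel \<partial>lborel)
        = (\<integral>\<^sup>+q'. \<integral>\<^sup>+q. pker R b q0 q' * ?D q q' \<partial>lborel \<partial>lborel)"
      by (intro lborel_pair.Fubini') (unfold pker_def, measurable)
    also have "\<dots> = (\<integral>\<^sup>+q'. \<integral>\<^sup>+q. pker R b q0 q' * ?D q' q \<partial>lborel \<partial>lborel)"
      by (simp only: pker_commute)
    also have "\<dots> \<le> Jd * Jb" by (rule half1)
    finally show ?thesis .
  qed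
  have "(\<integral>\<^sup>+q. \<integral>\<^sup>+q'. (pker R b q0 q + pker R b q0 q') * ?D q q' \<partial>lborel \<partial>lborel)
      = (\<integral>\<^sup>+q. (\<integral>\<^sup>+q'. pker R b q0 q * ?D q q' \<partial>lborel) + (\<integral>\<^sup>+q'. pker R b q0 q' * ?D q q' \<partial>lborel) \<partial>lborel)"
    unfolding distrib_right by (intro nn_integral_cong nn_integral_add) measurable
  also have "\<dots> = (\<integral>\<^sup>+q. \<integral>\<^sup>+q'. pker R b q0 q * ?D q q' \<partial>lborel \<partial>lborel)
      + (\<integral>\<^sup>+q. \<integral>\<^sup>+q'. pker R b q0 q' * ?D q q' \<partial>lborel \<partial>lborel)"
    by (intro nn_integral_add) (unfold pker_def, measurable)
  also have "\<dots> \<le> Jd * Jb + Jd * Jb" by (intro add_mono half1 half2)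
  also have "\<dots> < \<infinity>" using Jd(1) Jb(1) by (auto simp: ennreal_mult_less_top)
  finally show ?thesis .
qed

section \<open>Weighted bounds that imply finite norms\<close>

text \<open>The points \<open>p0\<close> and \<open>q0\<close> are excluded because \<open>0 powr c = 0\<close> also for negative \<open>c\<close>.\<close>
definition wbound :: "real set \<Rightarrow> real \<Rightarrow> real set \<Rightarrow> real \<Rightarrow> real \<Rightarrow> real \<Rightarrow> (real \<Rightarrow> real \<Rightarrow> real) \<Rightarrow> bool" where
  "wbound S p0 T q0 a b f \<longleftrightarrow> (\<exists>K\<ge>0. \<forall>p\<in>S. \<forall>q\<in>T. p \<noteq> p0 \<longrightarrow> q \<noteq> q0 \<longrightarrow>
     (f p q)\<^sup>2 \<le> K * (\<bar>p - p0\<bar> powr (- a) * \<bar>q - q0\<bar> powr (- b)))"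

text \<open>\<open>p\<close> is frozen and differences are taken in \<open>q\<close>; for
  differences in x the arguments of the function are swapped. The sum of the weights at
  \<open>q\<close> and \<open>q'\<close> fits \<open>double_pker_finite\<close>, and \<theta> > s
  reduces the Gagliardo kernel to the integrable exponent 1 + 2 s - 2 \<theta> < 1.\<close>

definition wholder :: "real set \<Rightarrow> real \<Rightarrow> real set \<Rightarrow> real \<Rightarrow> real \<Rightarrow> real \<Rightarrow> real \<Rightarrow> (real \<Rightarrow> real \<Rightarrow> real) \<Rightarrow> bool" where
  "wholder S p0 T q0 a b \<theta> f \<longleftrightarrow> (\<exists>K\<ge>0. \<forall>p\<in>S. \<forall>q\<in>T. \<forall>q'\<in>T. p \<noteq> p0 \<longrightarrow> q \<noteq> q0 \<longrightarrow> q' \<noteq> q0 \<longrightarrow>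
     (f p q - f p q')\<^sup>2 \<le> K * (\<bar>p - p0\<bar> powr (- a) *
        ((\<bar>q - q0\<bar> powr (- b) + \<bar>q' - q0\<bar> powr (- b)) * \<bar>q - q'\<bar> powr (2 * \<theta>))))"

lemma AE_lborel_neq: "AE x in lborel. x \<noteq> (c::real)"
  by (rule AE_lborel_singleton)

lemma wholder_integrand_le:
  assumes I: "S \<subseteq> {-R..R}" "T \<subseteq> {-R..R}" and "K \<ge> 0"
    and H: "\<And>p q q'. p \<in> S \<Longrightarrow> q \<in> T \<Longrightarrow> q' \<in> T \<Longrightarrow> p \<noteq> p0 \<Longrightarrow> q \<noteq> q0 \<Longrightarrow> q' \<noteq> q0 \<Longrightarrow>
     (f p q - f p q')\<^sup>2 \<le> K * (\<bar>p - p0\<bar> powr (- a) *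
        ((\<bar>q - q0\<bar> powr (- b) + \<bar>q' - q0\<bar> powr (- b)) * \<bar>q - q'\<bar> powr (2 * \<theta>)))"
    and ne: "p \<noteq> p0" "q \<noteq> q0" "q' \<noteq> q0"
  shows "ennreal (indicator S p * indicator T q * indicator T q' * (f p q - f p q')\<^sup>2 / \<bar>q - q'\<bar> powr (1 + 2 * s))
     \<le> ennreal K * (pker R a p0 p * ((pker R b q0 q + pker R b q0 q') *
         (indicator {-R..R} q * pker R (1 + 2 * s - 2 * \<theta>) q q')))"
proof (cases "p \<in> S \<and> q \<in> T \<and> q' \<in> T \<and> q \<noteq> q'")
  case True
  then have *: "p \<in> S" "q \<in> T" "q' \<in> T" "q \<noteq> q'" by auto
  let ?d = "1 + 2 * s - 2 * \<theta>"
  have mem: "p \<in> {-R..R}" "q \<in> {-R..R}" "q' \<in> {-R..R}" using * I by auto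
  have pos: "\<bar>q - q'\<bar> > 0" using * by simp
  have "(f p q - f p q')\<^sup>2 / \<bar>q - q'\<bar> powr (1 + 2 * s)
      \<le> K * (\<bar>p - p0\<bar> powr (- a) * ((\<bar>q - q0\<bar> powr (- b) + \<bar>q' - q0\<bar> powr (- b)) * \<bar>q - q'\<bar> powr (2 * \<theta>)))
        / \<bar>q - q'\<bar> powr (1 + 2 * s)"
    using H[of p q q'] * ne by (intro divide_right_mono) auto
  also have "\<dots> = K * (\<bar>p - p0\<bar> powr (- a) * ((\<bar>q - q0\<bar> powr (- b) + \<bar>q' - q0\<bar> powr (- b)) *
      (\<bar>q - q'\<bar> powr (2 * \<theta>) / \<bar>q - q'\<bar> powr (1 + 2 * s))))" by simp
  also have "\<bar>q - q'\<bar> powr (2 * \<theta>) / \<bar>q - q'\<bar> powr (1 + 2 * s) = \<bar>q' - q\<bar> powr (- ?d)"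
    using pos by (simp add: abs_minus_commute flip: powr_diff)
  finally have "ennreal ((f p q - f p q')\<^sup>2 / \<bar>q - q'\<bar> powr (1 + 2 * s)) \<le> ennreal (K * (\<bar>p - p0\<bar> powr (- a) *
      ((\<bar>q - q0\<bar> powr (- b) + \<bar>q' - q0\<bar> powr (- b)) * \<bar>q' - q\<bar> powr (- ?d))))"
    by (rule ennreal_leI)
  also have "\<dots> = ennreal K * (ennreal (\<bar>p - p0\<bar> powr (- a)) *
      ((ennreal (\<bar>q - q0\<bar> powr (- b)) + ennreal (\<bar>q' - q0\<bar> powr (- b))) * ennreal (\<bar>q' - q\<bar> powr (- ?d))))"
    using \<open>K \<ge> 0\<close> by (simp add: ennreal_mult)
  finally show ?thesis using * mem by (simp add: pker_def)
next
  case False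
  then show ?thesis by (auto simp: indicator_def)
qed

lemma gagliardo_finite_inner:
  assumes W: "wholder S p0 T q0 a b \<theta> f"
    and I: "S \<subseteq> {-R..R}" "T \<subseteq> {-R..R}" "\<bar>p0\<bar> \<le> R" "\<bar>q0\<bar> \<le> R"
    and ex: "a < 1" "b < 1" "s < \<theta>"
  shows "(\<integral>\<^sup>+p. \<integral>\<^sup>+q. \<integral>\<^sup>+q'. ennreal (indicator S p * indicator T q * indicator T q' *
      (f p q - f p q')\<^sup>2 / \<bar>q - q'\<bar> powr (1 + 2 * s)) \<partial>lebesgue \<partial>lebesgue \<partial>lebesgue) < \<infinity>"
proof -
  have R: "R \<ge> 0" using I by linarith
  obtain K where K: "K \<ge> 0" and H: "\<And>p q q'. p \<in> S \<Longrightarrow> q \<in> T \<Longrightarrow> q' \<in> T \<Longrightarrow> p \<noteq> p0 \<Longrightarrow> q \<noteq> q0 \<Longrightarrow> q' \<noteq> q0 \<Longrightarrow>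
     (f p q - f p q')\<^sup>2 \<le> K * (\<bar>p - p0\<bar> powr (- a) *
        ((\<bar>q - q0\<bar> powr (- b) + \<bar>q' - q0\<bar> powr (- b)) * \<bar>q - q'\<bar> powr (2 * \<theta>)))"
    using W unfolding wholder_def by blast
  let ?d = "1 + 2 * s - 2 * \<theta>"
  let ?G = "\<lambda>q q'. (pker R b q0 q + pker R b q0 q') * (indicator {-R..R} q * pker R ?d q q')"
  have [measurable]: "?G q \<in> borel_measurable borel" for q by measurable
  have [measurable]: "(\<lambda>q. \<integral>\<^sup>+q'. ?G q q' \<partial>lborel) \<in> borel_measurable borel"
    unfolding pker_def by measurable
  define w where "w = (\<integral>\<^sup>+q. \<integral>\<^sup>+q'. ?G q q' \<partial>lborel \<partial>lborel)"
  have w: "w < \<infinity>" unfolding w_def using ex R I by (intro double_pker_finite) auto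
  obtain J where J: "J < \<infinity>" "\<And>x0. \<bar>x0\<bar> \<le> R \<Longrightarrow> (\<integral>\<^sup>+x. pker R a x0 x \<partial>lborel) \<le> J"
    using nn_integral_pker_bound[OF ex(1) R] by blast
  have "(\<integral>\<^sup>+p. \<integral>\<^sup>+q. \<integral>\<^sup>+q'. ennreal (indicator S p * indicator T q * indicator T q' *
      (f p q - f p q')\<^sup>2 / \<bar>q - q'\<bar> powr (1 + 2 * s)) \<partial>lborel \<partial>lborel \<partial>lborel)
     \<le> (\<integral>\<^sup>+p. \<integral>\<^sup>+q. \<integral>\<^sup>+q'. ennreal K * (pker R a p0 p * ?G q q') \<partial>lborel \<partial>lborel \<partial>lborel)"
  proof (rule nn_integral_mono_AE, use AE_lborel_neq[of p0] in eventually_elim)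
    case p: (elim p)
    show ?case
    proof (rule nn_integral_mono_AE, use AE_lborel_neq[of q0] in eventually_elim)
      case q: (elim q)
      show ?case
      proof (rule nn_integral_mono_AE, use AE_lborel_neq[of q0] in eventually_elim)
        case q': (elim q')
        show ?case by (rule wholder_integrand_le[OF I(1,2) K H p q q'])
      qed
    qed
  qed
  also have "\<dots> = (\<integral>\<^sup>+p. \<integral>\<^sup>+q. (ennreal K * pker R a p0 p) * (\<integral>\<^sup>+q'. ?G q q' \<partial>lborel) \<partial>lborel \<partial>lborel)"
    unfolding mult.assoc[symmetric, of "ennreal K"] by (intro nn_integral_cong nn_integral_cmult) simp
  also have "\<dots> = (\<integral>\<^sup>+p. (ennreal K * pker R a p0 p) * w \<partial>lborel)"
    unfolding w_def by (intro nn_integral_cong nn_integral_cmult) simp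
  also have "\<dots> = (\<integral>\<^sup>+p. (ennreal K * w) * pker R a p0 p \<partial>lborel)"
    by (simp only: mult_ac)
  also have "\<dots> = (ennreal K * w) * (\<integral>\<^sup>+p. pker R a p0 p \<partial>lborel)"
    by (rule nn_integral_cmult) measurable
  also have "\<dots> \<le> (ennreal K * w) * J" using J(2)[OF I(3)] by (rule mult_left_mono) simp
  also have "\<dots> < \<infinity>" using w J(1) by (auto simp: ennreal_mult_less_top)
  finally show ?thesis by (simp only: nn_integral_completion)
qed

lemma gagliardo_finite_outer:
  assumes W: "wholder S p0 T q0 a b \<theta> f"
    and I: "S \<subseteq> {-R..R}" "T \<subseteq> {-R..R}" "\<bar>p0\<bar> \<le> R" "\<bar>q0\<bar> \<le> R"
    and ex: "a < 1" "b < 1" "s < \<theta>"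
  shows "(\<integral>\<^sup>+q. \<integral>\<^sup>+q'. \<integral>\<^sup>+p. ennreal (indicator T q * indicator T q' * indicator S p *
      (f p q - f p q')\<^sup>2 / \<bar>q - q'\<bar> powr (1 + 2 * s)) \<partial>lebesgue \<partial>lebesgue \<partial>lebesgue) < \<infinity>"
proof -
  have R: "R \<ge> 0" using I by linarith
  obtain K where K: "K \<ge> 0" and H: "\<And>p q q'. p \<in> S \<Longrightarrow> q \<in> T \<Longrightarrow> q' \<in> T \<Longrightarrow> p \<noteq> p0 \<Longrightarrow> q \<noteq> q0 \<Longrightarrow> q' \<noteq> q0 \<Longrightarrow>
     (f p q - f p q')\<^sup>2 \<le> K * (\<bar>p - p0\<bar> powr (- a) *
        ((\<bar>q - q0\<bar> powr (- b) + \<bar>q' - q0\<bar> powr (- b)) * \<bar>q - q'\<bar> powr (2 * \<theta>)))"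
    using W unfolding wholder_def by blast
  let ?d = "1 + 2 * s - 2 * \<theta>"
  let ?G = "\<lambda>q q'. (pker R b q0 q + pker R b q0 q') * (indicator {-R..R} q * pker R ?d q q')"
  have [measurable]: "?G q \<in> borel_measurable borel" for q by measurable
  have [measurable]: "(\<lambda>q. \<integral>\<^sup>+q'. ?G q q' \<partial>lborel) \<in> borel_measurable borel"
    unfolding pker_def by measurable
  define w where "w = (\<integral>\<^sup>+q. \<integral>\<^sup>+q'. ?G q q' \<partial>lborel \<partial>lborel)"
  have w: "w < \<infinity>" unfolding w_def using ex R I by (intro double_pker_finite) auto
  obtain J where J: "J < \<infinity>" "\<And>x0. \<bar>x0\<bar> \<le> R \<Longrightarrow> (\<integral>\<^sup>+x. pker R a x0 x \<partial>lborel) \<le> J"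
    using nn_integral_pker_bound[OF ex(1) R] by blast
  define j where "j = (\<integral>\<^sup>+p. pker R a p0 p \<partial>lborel)"
  have j: "j < \<infinity>" using J I(3) unfolding j_def by (meson order_le_less_trans)
  have "(\<integral>\<^sup>+q. \<integral>\<^sup>+q'. \<integral>\<^sup>+p. ennreal (indicator T q * indicator T q' * indicator S p *
      (f p q - f p q')\<^sup>2 / \<bar>q - q'\<bar> powr (1 + 2 * s)) \<partial>lborel \<partial>lborel \<partial>lborel)
     \<le> (\<integral>\<^sup>+q. \<integral>\<^sup>+q'. \<integral>\<^sup>+p. (ennreal K * ?G q q') * pker R a p0 p \<partial>lborel \<partial>lborel \<partial>lborel)"
  proof (rule nn_integral_mono_AE, use AE_lborel_neq[of q0] in eventually_elim)
    case q: (elim q)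
    show ?case
    proof (rule nn_integral_mono_AE, use AE_lborel_neq[of q0] in eventually_elim)
      case q': (elim q')
      show ?case
      proof (rule nn_integral_mono_AE, use AE_lborel_neq[of p0] in eventually_elim)
        case p: (elim p)
        have "ennreal (indicator S p * indicator T q * indicator T q' * (f p q - f p q')\<^sup>2 / \<bar>q - q'\<bar> powr (1 + 2 * s))
            \<le> ennreal K * (pker R a p0 p * ?G q q')"
          by (rule wholder_integrand_le[OF I(1,2) K H p q q'])
        then show ?case by (simp only: mult_ac)
      qed
    qed
  qed
  also have "\<dots> = (\<integral>\<^sup>+q. \<integral>\<^sup>+q'. (ennreal K * ?G q q') * j \<partial>lborel \<partial>lborel)"
    unfolding j_def by (intro nn_integral_cong nn_integral_cmult) measurable
  also have "\<dots> = (\<integral>\<^sup>+q. \<integral>\<^sup>+q'. (ennreal K * j) * ?G q q' \<partial>lborel \<partial>lborel)"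
    by (simp only: mult_ac)
  also have "\<dots> = (\<integral>\<^sup>+q. (ennreal K * j) * (\<integral>\<^sup>+q'. ?G q q' \<partial>lborel) \<partial>lborel)"
    by (intro nn_integral_cong nn_integral_cmult) simp
  also have "\<dots> = (ennreal K * j) * w"
    unfolding w_def by (rule nn_integral_cmult) simp
  also have "\<dots> < \<infinity>" using w j by (auto simp: ennreal_mult_less_top)
  finally show ?thesis by (simp only: nn_integral_completion)
qed

lemma L2_on_wbound:
  assumes W: "wbound S p0 T q0 a b (\<lambda>x z. u (x, z))"
    and S: "open S" "open T" and cont: "continuous_on (S \<times> T) u"
    and I: "S \<subseteq> {-R..R}" "T \<subseteq> {-R..R}" "\<bar>p0\<bar> \<le> R" "\<bar>q0\<bar> \<le> R"
    and ex: "a < 1" "b < 1"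
  shows "L2_on u (S \<times> T)"
  unfolding L2_on_def
proof
  have op: "open (S \<times> T)" using S by (rule open_Times)
  have m: "(\<lambda>p. indicator (S \<times> T) p * u p) \<in> borel_measurable borel"
    using borel_measurable_continuous_on_indicator[OF _ cont] op by simp
  then show "(\<lambda>p. indicator (S \<times> T) p * u p) \<in> borel_measurable lebesgue"
    by (intro measurable_completion) simp
  have m2: "(\<lambda>p. ennreal (indicator (S \<times> T) p * (u p)\<^sup>2)) \<in> borel_measurable borel"
  proof -
    have "(\<lambda>p. ennreal ((indicator (S \<times> T) p * u p)\<^sup>2)) \<in> borel_measurable borel" using m by measurable
    moreover have "(indicator (S \<times> T) p * u p)\<^sup>2 = indicator (S \<times> T) p * (u p)\<^sup>2" for p
      by (simp add: indicator_def power2_eq_square)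
    ultimately show ?thesis by simp
  qed
  have R: "R \<ge> 0" using I by linarith
  obtain K where K: "K \<ge> 0" and H: "\<And>p q. p \<in> S \<Longrightarrow> q \<in> T \<Longrightarrow> p \<noteq> p0 \<Longrightarrow> q \<noteq> q0 \<Longrightarrow>
     (u (p, q))\<^sup>2 \<le> K * (\<bar>p - p0\<bar> powr (- a) * \<bar>q - q0\<bar> powr (- b))"
    using W unfolding wbound_def by blast
  obtain J where J: "J < \<infinity>" "\<And>x0. \<bar>x0\<bar> \<le> R \<Longrightarrow> (\<integral>\<^sup>+x. pker R a x0 x \<partial>lborel) \<le> J"
    using nn_integral_pker_bound[OF ex(1) R] by blast
  obtain L where L: "L < \<infinity>" "\<And>x0. \<bar>x0\<bar> \<le> R \<Longrightarrow> (\<integral>\<^sup>+x. pker R b x0 x \<partial>lborel) \<le> L"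
    using nn_integral_pker_bound[OF ex(2) R] by blast
  have "(\<integral>\<^sup>+p. ennreal (indicator (S \<times> T) p * (u p)\<^sup>2) \<partial>lebesgue)
      = (\<integral>\<^sup>+p. ennreal (indicator (S \<times> T) p * (u p)\<^sup>2) \<partial>(lborel \<Otimes>\<^sub>M lborel))"
    by (simp only: nn_integral_completion lborel_prod)
  also have "\<dots> = (\<integral>\<^sup>+p. \<integral>\<^sup>+q. ennreal (indicator (S \<times> T) (p, q) * (u (p, q))\<^sup>2) \<partial>lborel \<partial>lborel)"
    using m2 by (intro lborel.nn_integral_fst[symmetric]) (simp add: lborel_prod)
  also have "\<dots> \<le> (\<integral>\<^sup>+p. \<integral>\<^sup>+q. (ennreal K * pker R a p0 p) * pker R b q0 q \<partial>lborel \<partial>lborel)"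
  proof (rule nn_integral_mono_AE, use AE_lborel_neq[of p0] in eventually_elim)
    case p: (elim p)
    show ?case
    proof (rule nn_integral_mono_AE, use AE_lborel_neq[of q0] in eventually_elim)
      case q: (elim q)
      show ?case
      proof (cases "p \<in> S \<and> q \<in> T")
        case True
        have "ennreal ((u (p, q))\<^sup>2) \<le> ennreal (K * (\<bar>p - p0\<bar> powr (- a) * \<bar>q - q0\<bar> powr (- b)))"
          using H[of p q] True p q by (intro ennreal_leI) auto
        also have "\<dots> = (ennreal K * ennreal (\<bar>p - p0\<bar> powr (- a))) * ennreal (\<bar>q - q0\<bar> powr (- b))"
          using K by (simp add: ennreal_mult mult.assoc)
        finally show ?thesis using True I by (auto simp: pker_def indicator_def subset_eq)
      qed (auto simp: indicator_def)
    qed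
  qed
  also have "\<dots> = (\<integral>\<^sup>+p. (ennreal K * pker R a p0 p) * (\<integral>\<^sup>+q. pker R b q0 q \<partial>lborel) \<partial>lborel)"
    by (intro nn_integral_cong nn_integral_cmult) measurable
  also have "\<dots> \<le> (\<integral>\<^sup>+p. (ennreal K * pker R a p0 p) * L \<partial>lborel)"
    using L(2)[OF I(4)] by (intro nn_integral_mono mult_left_mono) auto
  also have "\<dots> = (\<integral>\<^sup>+p. (ennreal K * L) * pker R a p0 p \<partial>lborel)"
    by (simp only: mult_ac)
  also have "\<dots> = (ennreal K * L) * (\<integral>\<^sup>+p. pker R a p0 p \<partial>lborel)"
    by (rule nn_integral_cmult) measurable
  also have "\<dots> \<le> (ennreal K * L) * J" using J(2)[OF I(3)] by (rule mult_left_mono) simp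
  also have "\<dots> < \<infinity>" using L(1) J(1) by (auto simp: ennreal_mult_less_top)
  finally show "(\<integral>\<^sup>+p. ennreal (indicator (S \<times> T) p * (u p)\<^sup>2) \<partial>lebesgue) < \<infinity>" .
qed

section \<open>Weak derivatives and smooth cut-offs\<close>

lemma set_integrable_lebesgue_compact:
  fixes f :: "real \<Rightarrow> real"
  assumes "compact K" "continuous_on K f"
  shows "set_integrable lebesgue K f"
  using borel_integrable_compact[OF assms] unfolding set_integrable_def
  by (intro integrable_completion[THEN iffD2]) auto

lemma smooth_on_UNIV_DERIV:
  fixes \<phi> :: "real \<Rightarrow> real"
  assumes "smooth_on UNIV \<phi>"
  shows "(\<phi> has_real_derivative deriv \<phi> x) (at x)" "continuous_on A (deriv \<phi>)"
proof -
  have "\<phi> differentiable_on UNIV"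
    using assms[unfolded smooth_on_def, rule_format, of "[]"] by simp
  then have d: "\<phi> differentiable (at x)" for x by (simp add: differentiable_on_def)
  then have D: "(\<phi> has_real_derivative deriv \<phi> x) (at x)" for x
    using DERIV_deriv_iff_real_differentiable by blast
  show "(\<phi> has_real_derivative deriv \<phi> x) (at x)" by (rule D)
  have eq: "frechet_derivative \<phi> (at x) 1 = deriv \<phi> x" for x
  proof -
    have "(\<phi> has_derivative (*) (deriv \<phi> x)) (at x)" using D by (simp add: has_field_derivative_def)
    then have "frechet_derivative \<phi> (at x) = (*) (deriv \<phi> x)" by (rule frechet_derivative_at[symmetric])
    then show ?thesis by simp
  qed
  have "(\<lambda>x. frechet_derivative \<phi> (at x) 1) differentiable_on UNIV"
    using assms[unfolded smooth_on_def, rule_format, of "[1]"] by simp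
  then have "continuous_on UNIV (deriv \<phi>)" unfolding eq by (rule differentiable_imp_continuous_on)
  then show "continuous_on A (deriv \<phi>)" by (rule continuous_on_subset) simp
qed

lemma weak_deriv_onI:
  fixes f g :: "real \<Rightarrow> real"
  assumes "a < b" and D: "\<And>z. z \<in> {a<..<b} \<Longrightarrow> (f has_real_derivative g z) (at z)"
    and g: "continuous_on {a<..<b} g"
  shows "weak_deriv_on f g a b"
  unfolding weak_deriv_on_def
proof (intro conjI allI impI)
  have f: "continuous_on {a<..<b} f"
    using D by (meson DERIV_continuous continuous_at_imp_continuous_on)
  {
    fix K assume K: "compact K \<and> K \<subseteq> {a<..<b}"
    show "set_integrable lebesgue K f" "set_integrable lebesgue K g"
      using K f g by (auto intro!: set_integrable_lebesgue_compact intro: continuous_on_subset)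
  }
  fix \<phi> :: "real \<Rightarrow> real"
  assume "smooth_on UNIV \<phi> \<and> compact (closure {x. \<phi> x \<noteq> 0}) \<and> closure {x. \<phi> x \<noteq> 0} \<subseteq> {a<..<b}"
  then have sm: "smooth_on UNIV \<phi>" and co: "compact (closure {x. \<phi> x \<noteq> 0})"
    and sub: "closure {x. \<phi> x \<noteq> 0} \<subseteq> {a<..<b}" by auto
  note D\<phi> = smooth_on_UNIV_DERIV(1)[OF sm] and c\<phi>' = smooth_on_UNIV_DERIV(2)[OF sm]
  have c\<phi>: "continuous_on A \<phi>" for A
    using D\<phi> by (meson DERIV_continuous continuous_at_imp_continuous_on)
  \<comment> \<open>The midpoint keeps the set nonempty when the test function is zero, so that the
    extrema below exist.\<close>
  define Z where "Z = insert ((a + b) / 2) (closure {x. \<phi> x \<noteq> 0})"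
  have Z: "compact Z" "Z \<noteq> {}" "Z \<subseteq> {a<..<b}" using co sub \<open>a < b\<close> by (auto simp: Z_def)
  obtain c where c: "c \<in> Z" "\<And>x. x \<in> Z \<Longrightarrow> c \<le> x" using compact_attains_inf[OF Z(1,2)] by blast
  obtain d where d: "d \<in> Z" "\<And>x. x \<in> Z \<Longrightarrow> x \<le> d" using compact_attains_sup[OF Z(1,2)] by blast
  \<comment> \<open>The margins around the support keep [l, r] inside the open interval, since
    nothing is known about \<open>f\<close> at its end points, and make the boundary terms
    vanish.\<close>
  define l r where "l = (a + c) / 2" and "r = (d + b) / 2"
  have ord: "a < l" "l < c" "c \<le> d" "d < r" "r < b"
    using c d Z(3) by (auto simp: l_def r_def)
  have zero: "\<phi> x = 0" if "x \<notin> {c..d}" for x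
  proof (rule ccontr)
    assume "\<phi> x \<noteq> 0"
    then have "x \<in> Z" using closure_subset[of "{x. \<phi> x \<noteq> 0}"] by (auto simp: Z_def)
    with c d that show False by auto
  qed
  have zero': "deriv \<phi> x = 0" if "x \<notin> {c..d}" for x
  proof -
    have "open (- {c..d})" by (rule open_Compl) simp
    then have "((\<lambda>_. 0) has_real_derivative 0) (at x) \<longleftrightarrow> (\<phi> has_real_derivative 0) (at x)"
      using that zero by (intro DERIV_cong_ev refl eventually_nhds_in_open[THEN eventually_mono]) auto
    then show ?thesis using DERIV_imp_deriv by auto
  qed
  have in_sub: "{l..r} \<subseteq> {a<..<b}" using ord by auto
  have restrict: "(LINT x:{a<..<b}|lebesgue. h x) = (LINT x:{l..r}|lebesgue. h x)"
    if "\<And>x. x \<notin> {c..d} \<Longrightarrow> h x = 0" for h :: "real \<Rightarrow> real"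
    unfolding set_lebesgue_integral_def
    using ord that by (intro Bochner_Integration.integral_cong refl) (auto simp: indicator_def)
  have i1: "set_integrable lebesgue {l..r} (\<lambda>x. f x * deriv \<phi> x)"
    by (intro set_integrable_lebesgue_compact continuous_intros c\<phi>' continuous_on_subset[OF f in_sub]) simp
  have i2: "set_integrable lebesgue {l..r} (\<lambda>x. g x * \<phi> x)"
    by (intro set_integrable_lebesgue_compact continuous_intros c\<phi> continuous_on_subset[OF g in_sub]) simp
  have "((\<lambda>x. f x * deriv \<phi> x + g x * \<phi> x) has_integral (f r * \<phi> r - f l * \<phi> l)) {l..r}"
  proof (rule fundamental_theorem_of_calculus)
    show "l \<le> r" using ord by simp
    fix x assume x: "x \<in> {l..r}"
    have "((\<lambda>x. f x * \<phi> x) has_real_derivative f x * deriv \<phi> x + g x * \<phi> x) (at x)"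
      using DERIV_mult'[OF D[of x] D\<phi>[of x]] x in_sub by (auto simp: mult.commute)
    then show "((\<lambda>x. f x * \<phi> x) has_vector_derivative f x * deriv \<phi> x + g x * \<phi> x) (at x within {l..r})"
      using has_real_derivative_iff_has_vector_derivative has_vector_derivative_at_within by blast
  qed
  moreover have "\<phi> r = 0" "\<phi> l = 0" using ord by (auto intro!: zero)
  ultimately have "((\<lambda>x. f x * deriv \<phi> x + g x * \<phi> x) has_integral 0) {l..r}" by simp
  moreover have "(LINT x:{l..r}|lebesgue. f x * deriv \<phi> x + g x * \<phi> x) = integral {l..r} (\<lambda>x. f x * deriv \<phi> x + g x * \<phi> x)"
    by (intro set_lebesgue_integral_eq_integral(2) set_integral_add(1) i1 i2)
  ultimately have "(LINT x:{l..r}|lebesgue. f x * deriv \<phi> x) + (LINT x:{l..r}|lebesgue. g x * \<phi> x) = 0"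
    using set_integral_add(2)[OF i1 i2] by (simp add: integral_unique)
  moreover have "(LINT x:{a<..<b}|lebesgue. f x * deriv \<phi> x) = (LINT x:{l..r}|lebesgue. f x * deriv \<phi> x)"
    by (rule restrict) (simp add: zero')
  moreover have "(LINT x:{a<..<b}|lebesgue. g x * \<phi> x) = (LINT x:{l..r}|lebesgue. g x * \<phi> x)"
    by (rule restrict) (simp add: zero)
  ultimately show "(LINT x:{a<..<b}|lebesgue. f x * deriv \<phi> x) = - (LINT x:{a<..<b}|lebesgue. g x * \<phi> x)"
    by simp
qed

section \<open>Smooth cut-offs as bounded Lipschitz multipliers\<close>

definition lip_rect :: "real \<Rightarrow> real \<Rightarrow> real \<Rightarrow> (real \<times> real \<Rightarrow> real) \<Rightarrow> bool" where
  "lip_rect x0 x1 D f \<longleftrightarrow> D \<ge> 0 \<and> continuous_on ({x0..x1} \<times> {-1..1}) f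
     \<and> (\<forall>x\<in>{x0..x1}. \<forall>z\<in>{-1..1}. \<bar>f (x, z)\<bar> \<le> D)
     \<and> (\<forall>x\<in>{x0..x1}. \<forall>z\<in>{-1..1}. \<forall>w\<in>{-1..1}. \<bar>f (x, z) - f (x, w)\<bar> \<le> D * \<bar>z - w\<bar>)
     \<and> (\<forall>x\<in>{x0..x1}. \<forall>y\<in>{x0..x1}. \<forall>z\<in>{-1..1}. \<bar>f (x, z) - f (y, z)\<bar> \<le> D * \<bar>x - y\<bar>)"

lemma lip_rect_mono:
  assumes "lip_rect x0 x1 D f" "D \<le> D'"
  shows "lip_rect x0 x1 D' f"
proof -
  have "D * \<bar>t\<bar> \<le> D' * \<bar>t\<bar>" for t using assms by (intro mult_right_mono) auto
  with assms show ?thesis unfolding lip_rect_def by (meson order_trans)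
qed

text \<open>\<open>c1\<close> and \<open>c2\<close> are iterated directional derivatives along
  (0,1). Each Lipschitz constant is a bound for one further partial derivative on the compact
  rectangle.\<close>

lemma smooth_upto_rectangle:
  fixes chi :: "real \<times> real \<Rightarrow> real"
  assumes "x0 < x1" "smooth_upto (Omega x0 x1) chi"
  obtains c1 c2 D where "lip_rect x0 x1 D chi" "lip_rect x0 x1 D c1" "lip_rect x0 x1 D c2"
    "\<And>x z. x \<in> {x0..x1} \<Longrightarrow> z \<in> {-1..1} \<Longrightarrow> ((\<lambda>z. chi (x, z)) has_real_derivative c1 (x, z)) (at z)"
    "\<And>x z. x \<in> {x0..x1} \<Longrightarrow> z \<in> {-1..1} \<Longrightarrow> ((\<lambda>z. c1 (x, z)) has_real_derivative c2 (x, z)) (at z)"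
proof -
  let ?K = "{x0..x1} \<times> {-1..1::real}"
  obtain U where U: "open U" "closure (Omega x0 x1) \<subseteq> U" "smooth_on U chi"
    using assms unfolding smooth_upto_def by blast
  have "closure (Omega x0 x1) = ?K"
    using assms by (simp add: Omega_def closure_Times)
  then have KU: "?K \<subseteq> U" using U by simp
  let ?d = "dirderivs chi"
  have diff: "(?d vs has_derivative frechet_derivative (?d vs) (at p)) (at p)" if "p \<in> U" for vs p
  proof -
    have "?d vs differentiable_on U" using U(3) unfolding smooth_on_def by blast
    then have "?d vs differentiable (at p)"
      using U(1) that differentiable_on_eq_differentiable_at by blast
    then show ?thesis by (simp add: frechet_derivative_works)
  qed
  have dz: "((\<lambda>z. ?d vs (x, z)) has_real_derivative ?d ((0, 1) # vs) (x, z)) (at z)" if "(x, z) \<in> U" for vs x z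
  proof -
    have "((\<lambda>z. (x, z)) has_derivative (\<lambda>h. (0, h))) (at z)" by (auto intro!: derivative_eq_intros)
    from has_derivative_compose[OF this diff[OF that, of vs]]
    have *: "((\<lambda>z. ?d vs (x, z)) has_derivative (\<lambda>h. frechet_derivative (?d vs) (at (x, z)) (0, h))) (at z)" .
    have "linear (frechet_derivative (?d vs) (at (x, z)))"
      using diff[OF that] has_derivative_linear by blast
    then have "frechet_derivative (?d vs) (at (x, z)) (0, h) = ?d ((0, 1) # vs) (x, z) * h" for h
      using linear_scale[of "frechet_derivative (?d vs) (at (x, z))" h "(0, 1)"] by simp
    then have "(\<lambda>h. frechet_derivative (?d vs) (at (x, z)) (0, h)) = (*) (?d ((0, 1) # vs) (x, z))"
      by (rule ext)
    then show ?thesis using * unfolding has_field_derivative_def by (simp only:)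
  qed
  have dx: "((\<lambda>x. ?d vs (x, z)) has_real_derivative ?d ((1, 0) # vs) (x, z)) (at x)" if "(x, z) \<in> U" for vs x z
  proof -
    have "((\<lambda>x. (x, z)) has_derivative (\<lambda>h. (h, 0))) (at x)" by (auto intro!: derivative_eq_intros)
    from has_derivative_compose[OF this diff[OF that, of vs]]
    have *: "((\<lambda>x. ?d vs (x, z)) has_derivative (\<lambda>h. frechet_derivative (?d vs) (at (x, z)) (h, 0))) (at x)" .
    have "linear (frechet_derivative (?d vs) (at (x, z)))"
      using diff[OF that] has_derivative_linear by blast
    then have "frechet_derivative (?d vs) (at (x, z)) (h, 0) = ?d ((1, 0) # vs) (x, z) * h" for h
      using linear_scale[of "frechet_derivative (?d vs) (at (x, z))" h "(1, 0)"] by simp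
    then have "(\<lambda>h. frechet_derivative (?d vs) (at (x, z)) (h, 0)) = (*) (?d ((1, 0) # vs) (x, z))"
      by (rule ext)
    then show ?thesis using * unfolding has_field_derivative_def by (simp only:)
  qed
  have cont: "continuous_on ?K (?d vs)" for vs
    using diff KU has_derivative_continuous by (intro continuous_at_imp_continuous_on ballI) blast
  have bdd: "\<exists>M. \<forall>p\<in>?K. \<bar>?d vs p\<bar> \<le> M" for vs
  proof -
    have "bounded (?d vs ` ?K)"
      by (intro compact_imp_bounded compact_continuous_image cont compact_Times) auto
    then show ?thesis by (auto simp: bounded_iff)
  qed
  have lip: "\<exists>D. lip_rect x0 x1 D (?d vs)" for vs
  proof -
    obtain M0 M1 M2 where M: "\<forall>p\<in>?K. \<bar>?d vs p\<bar> \<le> M0" "\<forall>p\<in>?K. \<bar>?d ((0,1) # vs) p\<bar> \<le> M1"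
      "\<forall>p\<in>?K. \<bar>?d ((1,0) # vs) p\<bar> \<le> M2" using bdd by metis
    define D where "D = max 0 (max M0 (max M1 M2))"
    have D: "D \<ge> 0" "M0 \<le> D" "M1 \<le> D" "M2 \<le> D" by (auto simp: D_def)
    have "\<bar>?d vs (x, z) - ?d vs (x, w)\<bar> \<le> D * \<bar>z - w\<bar>" if "x \<in> {x0..x1}" "z \<in> {-1..1}" "w \<in> {-1..1}" for x z w
    proof -
      have "norm (?d vs (x, z) - ?d vs (x, w)) \<le> D * norm (z - w)"
      proof (rule field_differentiable_bound[where S = "{-1..1}" and f' = "\<lambda>z. ?d ((0,1) # vs) (x, z)"])
        fix t :: real assume t: "t \<in> {-1..1}"
        then have K: "(x, t) \<in> ?K" using that by auto
        then have "(x, t) \<in> U" using KU by blast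
        then show "((\<lambda>z. ?d vs (x, z)) has_field_derivative ?d ((0,1) # vs) (x, t)) (at t within {-1..1})"
          by (rule has_field_derivative_at_within[OF dz])
        show "norm (?d ((0,1) # vs) (x, t)) \<le> D" using M(2)[rule_format, OF K] D by (simp del: dirderivs.simps)
      qed (use that in auto)
      then show ?thesis by simp
    qed
    moreover have "\<bar>?d vs (x, z) - ?d vs (y, z)\<bar> \<le> D * \<bar>x - y\<bar>" if "x \<in> {x0..x1}" "y \<in> {x0..x1}" "z \<in> {-1..1}" for x y z
    proof -
      have "norm (?d vs (x, z) - ?d vs (y, z)) \<le> D * norm (x - y)"
      proof (rule field_differentiable_bound[where S = "{x0..x1}" and f' = "\<lambda>x. ?d ((1,0) # vs) (x, z)" and f = "\<lambda>x. ?d vs (x, z)"])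
        fix t :: real assume t: "t \<in> {x0..x1}"
        then have K: "(t, z) \<in> ?K" using that by auto
        then have "(t, z) \<in> U" using KU by blast
        then show "((\<lambda>x. ?d vs (x, z)) has_field_derivative ?d ((1,0) # vs) (t, z)) (at t within {x0..x1})"
          by (rule has_field_derivative_at_within[OF dx])
        show "norm (?d ((1,0) # vs) (t, z)) \<le> D" using M(3)[rule_format, OF K] D by (simp del: dirderivs.simps)
      qed (use that in auto)
      then show ?thesis by simp
    qed
    moreover have "\<bar>?d vs (x, z)\<bar> \<le> D" if "x \<in> {x0..x1}" "z \<in> {-1..1}" for x z
      using M(1) D that by (meson SigmaI order_trans)
    ultimately show ?thesis using D(1) cont[of vs] unfolding lip_rect_def by blast
  qed
  obtain D0 where D0: "lip_rect x0 x1 D0 (?d [])" using lip by blast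
  obtain D1 where D1: "lip_rect x0 x1 D1 (?d [(0,1)])" using lip by blast
  obtain D2 where D2: "lip_rect x0 x1 D2 (?d [(0,1),(0,1)])" using lip by blast
  define D where "D = max D0 (max D1 D2)"
  have in_U: "(x, z) \<in> U" if "x \<in> {x0..x1}" "z \<in> {-1..1}" for x z using that KU by blast
  show ?thesis
  proof (rule that[of D "?d [(0,1)]" "?d [(0,1),(0,1)]"])
    show "lip_rect x0 x1 D chi" using lip_rect_mono[OF D0, of D] by (simp add: D_def)
    show "lip_rect x0 x1 D (?d [(0,1)])" by (rule lip_rect_mono[OF D1]) (simp add: D_def)
    show "lip_rect x0 x1 D (?d [(0,1),(0,1)])" by (rule lip_rect_mono[OF D2]) (simp add: D_def)
    show "((\<lambda>z. chi (x, z)) has_real_derivative ?d [(0,1)] (x, z)) (at z)"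
      if "x \<in> {x0..x1}" "z \<in> {-1..1}" for x z
      using dz[OF in_U[OF that], of "[]"] by simp
    show "((\<lambda>z. ?d [(0,1)] (x, z)) has_real_derivative ?d [(0,1),(0,1)] (x, z)) (at z)"
      if "x \<in> {x0..x1}" "z \<in> {-1..1}" for x z
      by (rule dz[OF in_U[OF that], of "[(0,1)]"])
  qed
qed

section \<open>Sums and products of weighted bounds\<close>

lemma sq_add_le: "(x + y)\<^sup>2 \<le> 2 * x\<^sup>2 + 2 * (y::real)\<^sup>2"
proof -
  have "0 \<le> (x - y)\<^sup>2" by simp
  then show ?thesis by (simp add: power2_sum power2_diff)
qed

lemma sq_add_le_weighted:
  fixes x y :: real
  assumes "x\<^sup>2 \<le> c * w" "y\<^sup>2 \<le> d * w"
  shows "(x + y)\<^sup>2 \<le> (2 * c + 2 * d) * w"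
proof -
  have "2 * x\<^sup>2 + 2 * y\<^sup>2 \<le> 2 * (c * w) + 2 * (d * w)" using assms by simp
  then show ?thesis using sq_add_le[of x y] by (simp add: algebra_simps)
qed

lemma wbound_add:
  assumes "wbound S p0 T q0 a b f" "wbound S p0 T q0 a b g"
  shows "wbound S p0 T q0 a b (\<lambda>p q. f p q + g p q)"
proof -
  obtain K where K: "K \<ge> 0" "\<And>p q. p \<in> S \<Longrightarrow> q \<in> T \<Longrightarrow> p \<noteq> p0 \<Longrightarrow> q \<noteq> q0 \<Longrightarrow>
       (f p q)\<^sup>2 \<le> K * (\<bar>p - p0\<bar> powr (- a) * \<bar>q - q0\<bar> powr (- b))"
    using assms(1) unfolding wbound_def by blast
  obtain L where L: "L \<ge> 0" "\<And>p q. p \<in> S \<Longrightarrow> q \<in> T \<Longrightarrow> p \<noteq> p0 \<Longrightarrow> q \<noteq> q0 \<Longrightarrow>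
       (g p q)\<^sup>2 \<le> L * (\<bar>p - p0\<bar> powr (- a) * \<bar>q - q0\<bar> powr (- b))"
    using assms(2) unfolding wbound_def by blast
  have "(f p q + g p q)\<^sup>2 \<le> (2 * K + 2 * L) * (\<bar>p - p0\<bar> powr (- a) * \<bar>q - q0\<bar> powr (- b))"
    if "p \<in> S" "q \<in> T" "p \<noteq> p0" "q \<noteq> q0" for p q
    by (rule sq_add_le_weighted[OF K(2)[OF that] L(2)[OF that]])
  then show ?thesis unfolding wbound_def using K(1) L(1) by (intro exI[of _ "2 * K + 2 * L"]) auto
qed

lemma wholder_add:
  assumes "wholder S p0 T q0 a b \<theta> f" "wholder S p0 T q0 a b \<theta> g"
  shows "wholder S p0 T q0 a b \<theta> (\<lambda>p q. f p q + g p q)"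
proof -
  let ?W = "\<lambda>p q q'. \<bar>p - p0\<bar> powr (- a) *
        ((\<bar>q - q0\<bar> powr (- b) + \<bar>q' - q0\<bar> powr (- b)) * \<bar>q - q'\<bar> powr (2 * \<theta>))"
  obtain K where K: "K \<ge> 0" "\<And>p q q'. p \<in> S \<Longrightarrow> q \<in> T \<Longrightarrow> q' \<in> T \<Longrightarrow> p \<noteq> p0 \<Longrightarrow> q \<noteq> q0 \<Longrightarrow> q' \<noteq> q0 \<Longrightarrow>
       (f p q - f p q')\<^sup>2 \<le> K * ?W p q q'"
    using assms(1) unfolding wholder_def by blast
  obtain L where L: "L \<ge> 0" "\<And>p q q'. p \<in> S \<Longrightarrow> q \<in> T \<Longrightarrow> q' \<in> T \<Longrightarrow> p \<noteq> p0 \<Longrightarrow> q \<noteq> q0 \<Longrightarrow> q' \<noteq> q0 \<Longrightarrow>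
       (g p q - g p q')\<^sup>2 \<le> L * ?W p q q'"
    using assms(2) unfolding wholder_def by blast
  have "(f p q + g p q - (f p q' + g p q'))\<^sup>2 \<le> (2 * K + 2 * L) * ?W p q q'"
    if "p \<in> S" "q \<in> T" "q' \<in> T" "p \<noteq> p0" "q \<noteq> q0" "q' \<noteq> q0" for p q q'
  proof -
    have "f p q + g p q - (f p q' + g p q') = (f p q - f p q') + (g p q - g p q')" by simp
    then show ?thesis using sq_add_le_weighted[OF K(2)[OF that] L(2)[OF that]] by (simp only:)
  qed
  then show ?thesis unfolding wholder_def using K(1) L(1) by (intro exI[of _ "2 * K + 2 * L"]) auto
qed

lemma wbound_mult:
  assumes "wbound S p0 T q0 a b f" and phi: "\<And>p q. p \<in> S \<Longrightarrow> q \<in> T \<Longrightarrow> \<bar>\<phi> p q\<bar> \<le> D"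
  shows "wbound S p0 T q0 a b (\<lambda>p q. f p q * \<phi> p q)"
proof -
  obtain K where K: "K \<ge> 0" "\<And>p q. p \<in> S \<Longrightarrow> q \<in> T \<Longrightarrow> p \<noteq> p0 \<Longrightarrow> q \<noteq> q0 \<Longrightarrow>
       (f p q)\<^sup>2 \<le> K * (\<bar>p - p0\<bar> powr (- a) * \<bar>q - q0\<bar> powr (- b))"
    using assms unfolding wbound_def by blast
  have "(f p q * \<phi> p q)\<^sup>2 \<le> (D\<^sup>2 * K) * (\<bar>p - p0\<bar> powr (- a) * \<bar>q - q0\<bar> powr (- b))"
    if "p \<in> S" "q \<in> T" "p \<noteq> p0" "q \<noteq> q0" for p q
  proof -
    have "(\<phi> p q)\<^sup>2 \<le> D\<^sup>2" using phi[OF that(1,2)] by (metis abs_ge_zero order_trans abs_le_square_iff abs_of_nonneg)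
    then have "(\<phi> p q)\<^sup>2 * (f p q)\<^sup>2 \<le> D\<^sup>2 * (K * (\<bar>p - p0\<bar> powr (- a) * \<bar>q - q0\<bar> powr (- b)))"
      using K(2)[OF that] by (intro mult_mono) auto
    then show ?thesis by (simp add: power_mult_distrib mult_ac)
  qed
  then show ?thesis unfolding wbound_def using K(1) by (intro exI[of _ "D\<^sup>2 * K"]) auto
qed

text \<open>Split the difference as (f(q) - f(q')) \<phi>(q) + f(q') (\<phi>(q) - \<phi>(q')): the
  first part uses the Hoelder bound of \<open>f\<close>, the second its size and the Lipschitz bound
  of the multiplier.\<close>

lemma wholder_mult:
  assumes f: "wbound S p0 T q0 a b f" "wholder S p0 T q0 a b \<theta> f"
    and phi: "\<And>p q. p \<in> S \<Longrightarrow> q \<in> T \<Longrightarrow> \<bar>\<phi> p q\<bar> \<le> D"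
    and lip: "\<And>p q q'. p \<in> S \<Longrightarrow> q \<in> T \<Longrightarrow> q' \<in> T \<Longrightarrow> \<bar>\<phi> p q - \<phi> p q'\<bar> \<le> D * \<bar>q - q'\<bar>"
    and T: "T \<subseteq> {-R..R}" and "\<theta> \<le> 1"
  shows "wholder S p0 T q0 a b \<theta> (\<lambda>p q. f p q * \<phi> p q)"
proof -
  let ?w = "\<lambda>p q. \<bar>p - p0\<bar> powr (- a) * \<bar>q - q0\<bar> powr (- b)"
  let ?W = "\<lambda>p q q'. \<bar>p - p0\<bar> powr (- a) *
        ((\<bar>q - q0\<bar> powr (- b) + \<bar>q' - q0\<bar> powr (- b)) * \<bar>q - q'\<bar> powr (2 * \<theta>))"
  obtain K where K: "K \<ge> 0" "\<And>p q q'. p \<in> S \<Longrightarrow> q \<in> T \<Longrightarrow> q' \<in> T \<Longrightarrow> p \<noteq> p0 \<Longrightarrow> q \<noteq> q0 \<Longrightarrow> q' \<noteq> q0 \<Longrightarrow>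
       (f p q - f p q')\<^sup>2 \<le> K * ?W p q q'"
    using f(2) unfolding wholder_def by blast
  obtain L where L: "L \<ge> 0" "\<And>p q. p \<in> S \<Longrightarrow> q \<in> T \<Longrightarrow> p \<noteq> p0 \<Longrightarrow> q \<noteq> q0 \<Longrightarrow> (f p q)\<^sup>2 \<le> L * ?w p q"
    using f(1) unfolding wbound_def by blast
  \<comment> \<open>Trades |q - q'|^2 for |q - q'|^(2 \<theta>) on an interval of length at most 2
    R.\<close>
  define M where "M = (2 * R) powr (2 - 2 * \<theta>)"
  have M: "M \<ge> 0" by (simp add: M_def)
  define A where "A = 2 * (D\<^sup>2 * K) + 2 * (L * (D\<^sup>2 * M))"
  have "(f p q * \<phi> p q - f p q' * \<phi> p q')\<^sup>2 \<le> A * ?W p q q'"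
    if *: "p \<in> S" "q \<in> T" "q' \<in> T" "p \<noteq> p0" "q \<noteq> q0" "q' \<noteq> q0" for p q q'
  proof (cases "q = q'")
    case False
    have "(\<phi> p q)\<^sup>2 \<le> D\<^sup>2" using phi[OF *(1,2)] by (metis abs_ge_zero order_trans abs_le_square_iff abs_of_nonneg)
    then have 1: "((f p q - f p q') * \<phi> p q)\<^sup>2 \<le> D\<^sup>2 * K * ?W p q q'"
      using mult_mono[OF _ K(2)[OF *], of "(\<phi> p q)\<^sup>2" "D\<^sup>2"] by (simp add: power_mult_distrib mult_ac)
    have "\<bar>\<phi> p q - \<phi> p q'\<bar>\<^sup>2 \<le> (D * \<bar>q - q'\<bar>)\<^sup>2" by (intro power_mono lip *) auto
    moreover have "\<bar>q - q'\<bar>\<^sup>2 \<le> M * \<bar>q - q'\<bar> powr (2 * \<theta>)"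
    proof -
      have "\<bar>q - q'\<bar>\<^sup>2 = \<bar>q - q'\<bar> powr (2 - 2 * \<theta>) * \<bar>q - q'\<bar> powr (2 * \<theta>)"
        using False by (simp flip: powr_add)
      also have "\<dots> \<le> M * \<bar>q - q'\<bar> powr (2 * \<theta>)"
      proof -
        have "q \<in> {-R..R}" "q' \<in> {-R..R}" using * T by auto
        then have "\<bar>q - q'\<bar> \<le> 2 * R" by auto
        then show ?thesis unfolding M_def using \<open>\<theta> \<le> 1\<close> by (intro mult_right_mono powr_mono2) auto
      qed
      finally show ?thesis .
    qed
    then have "D\<^sup>2 * \<bar>q - q'\<bar>\<^sup>2 \<le> D\<^sup>2 * (M * \<bar>q - q'\<bar> powr (2 * \<theta>))" by (intro mult_left_mono) auto
    ultimately have "(\<phi> p q - \<phi> p q')\<^sup>2 \<le> D\<^sup>2 * M * \<bar>q - q'\<bar> powr (2 * \<theta>)"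
      by (simp add: power_mult_distrib mult.assoc)
    then have "(f p q')\<^sup>2 * (\<phi> p q - \<phi> p q')\<^sup>2 \<le> (L * ?w p q') * (D\<^sup>2 * M * \<bar>q - q'\<bar> powr (2 * \<theta>))"
      using L(2)[of p q'] * L(1) by (intro mult_mono) auto
    also have "\<dots> = (L * (D\<^sup>2 * M)) * (\<bar>p - p0\<bar> powr (- a) * (\<bar>q' - q0\<bar> powr (- b) * \<bar>q - q'\<bar> powr (2 * \<theta>)))"
      by (simp only: mult_ac)
    also have "\<dots> \<le> (L * (D\<^sup>2 * M)) * ?W p q q'"
      using L(1) M by (intro mult_left_mono mult_right_mono) auto
    finally have 2: "(f p q' * (\<phi> p q - \<phi> p q'))\<^sup>2 \<le> L * (D\<^sup>2 * M) * ?W p q q'"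
      by (simp add: power_mult_distrib)
    have "f p q * \<phi> p q - f p q' * \<phi> p q' = (f p q - f p q') * \<phi> p q + f p q' * (\<phi> p q - \<phi> p q')"
      by (simp add: algebra_simps)
    then show ?thesis using sq_add_le_weighted[OF 1 2] unfolding A_def by (simp only:)
  qed simp
  moreover have "A \<ge> 0" using K L M by (simp add: A_def)
  ultimately show ?thesis unfolding wholder_def by blast
qed

text \<open>On a bounded range a singular power may be replaced by a more singular one. This brings
  all terms of the product rule to common exponents, as \<open>wbound_add\<close> and
  \<open>wholder_add\<close> require.\<close>

lemma powr_mono_exponent_bounded:
  fixes y L :: real
  assumes "0 < y" "y \<le> L" "c \<le> a"
  shows "y powr (- c) \<le> L powr (a - c) * y powr (- a)"
proof -
  have "y powr (- c) = y powr (a - c) * y powr (- a)" by (simp flip: powr_add)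
  also have "\<dots> \<le> L powr (a - c) * y powr (- a)"
    using assms by (intro mult_right_mono powr_mono2) auto
  finally show ?thesis .
qed

lemma one_le_powr_neg:
  fixes z b :: real
  assumes "0 < z" "z \<le> 1" "b \<ge> 0"
  shows "1 \<le> z powr (- b)"
  using powr_mono_exponent_bounded[of z 1 0 b] assms by simp

lemma (in profile) profile_scale: "profile (\<lambda>t. k * F t) (\<lambda>t. k * P t) (\<lambda>t. k * Q t) (\<lambda>t. k * T t) (\<bar>k\<bar> * C)"
proof
  fix t
  show "((\<lambda>t. k * F t) has_real_derivative k * P t) (at t)" by (intro DERIV_cmult DERIV_F)
  show "((\<lambda>t. k * P t) has_real_derivative k * Q t) (at t)" by (intro DERIV_cmult DERIV_P)
  show "((\<lambda>t. k * Q t) has_real_derivative k * T t) (at t)" by (intro DERIV_cmult DERIV_Q)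
  show "\<bar>k * F t\<bar> \<le> \<bar>k\<bar> * C * (1 + \<bar>t\<bar>)"
    using mult_left_mono[OF F_bound[of t], of "\<bar>k\<bar>"] by (simp add: abs_mult mult_ac)
  show "\<bar>k * P t\<bar> \<le> \<bar>k\<bar> * C" using mult_left_mono[OF P_bound[of t], of "\<bar>k\<bar>"] by (simp add: abs_mult)
  show "(1 + \<bar>t\<bar>) * \<bar>k * Q t\<bar> \<le> \<bar>k\<bar> * C"
    using mult_left_mono[OF Q_bound[of t], of "\<bar>k\<bar>"] by (simp add: abs_mult mult.left_commute)
  show "\<bar>k * T t\<bar> \<le> \<bar>k\<bar> * C" using mult_left_mono[OF T_bound[of t], of "\<bar>k\<bar>"] by (simp add: abs_mult)
  have "k * F t / 6 - t * (k * P t) / 3 = k * (F t / 6 - t * P t / 3)" by (simp add: algebra_simps)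
  then show "(1 + \<bar>t\<bar>) * \<bar>k * F t / 6 - t * (k * P t) / 3\<bar> \<le> \<bar>k\<bar> * C"
    using mult_left_mono[OF Euler_bound[of t], of "\<bar>k\<bar>"] by (simp only: abs_mult mult.left_commute)
qed

section \<open>The similarity solution and its partial derivatives\<close>

context profile
begin

lemma C_nonneg: "C \<ge> 0"
  using P_bound[of 0] by linarith

definition V0 :: "real \<Rightarrow> real \<Rightarrow> real" where "V0 y z = y powr (1/6) * F (z * y powr (-1/3))"
definition V1 :: "real \<Rightarrow> real \<Rightarrow> real" where "V1 y z = y powr (-1/6) * P (z * y powr (-1/3))"
definition V2 :: "real \<Rightarrow> real \<Rightarrow> real" where "V2 y z = y powr (-1/2) * Q (z * y powr (-1/3))"

lemma DERIV_V0_z: "y > 0 \<Longrightarrow> ((\<lambda>z. V0 y z) has_real_derivative V1 y z) (at z)"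
proof -
  assume y: "y > 0"
  have "((\<lambda>z. z * y powr (-1/3)) has_real_derivative y powr (-1/3)) (at z)"
    by (auto intro!: derivative_eq_intros)
  from DERIV_cmult[OF DERIV_chain2[OF DERIV_F this], of "y powr (1/6)"]
  have "((\<lambda>z. V0 y z) has_real_derivative (y powr (1/6) * y powr (-1/3)) * P (z * y powr (-1/3))) (at z)"
    by (simp add: V0_def mult_ac)
  moreover have "y powr (1/6) * y powr (-1/3) = y powr (-1/6)" by (simp flip: powr_add)
  ultimately show ?thesis unfolding V1_def by simp
qed

lemma DERIV_V1_z: "y > 0 \<Longrightarrow> ((\<lambda>z. V1 y z) has_real_derivative V2 y z) (at z)"
proof -
  assume y: "y > 0"
  have "((\<lambda>z. z * y powr (-1/3)) has_real_derivative y powr (-1/3)) (at z)"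
    by (auto intro!: derivative_eq_intros)
  from DERIV_cmult[OF DERIV_chain2[OF DERIV_P this], of "y powr (-1/6)"]
  have "((\<lambda>z. V1 y z) has_real_derivative (y powr (-1/6) * y powr (-1/3)) * Q (z * y powr (-1/3))) (at z)"
    by (simp add: V1_def mult_ac)
  moreover have "y powr (-1/6) * y powr (-1/3) = y powr (-1/2)" by (simp flip: powr_add)
  ultimately show ?thesis unfolding V2_def by simp
qed

lemma DERIV_V0_y:
  assumes y: "y > 0"
  shows "((\<lambda>y. V0 y z) has_real_derivative
    y powr (-5/6) * (F (z * y powr (-1/3)) / 6 - (z * y powr (-1/3)) * P (z * y powr (-1/3)) / 3)) (at y)"
proof -
  have a: "((\<lambda>y. z * y powr (-1/3)) has_real_derivative z * ((-1/3) * y powr (-1/3 - 1))) (at y)"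
    by (intro DERIV_cmult has_real_derivative_powr y)
  have b: "((\<lambda>y. y powr (1/6)) has_real_derivative (1/6) * y powr (1/6 - 1)) (at y)"
    by (intro has_real_derivative_powr y)
  have e1: "y powr (1/6 - 1) = y powr (-5/6)" by simp
  have e2: "y powr (1/6) * y powr (-1/3 - 1) = y powr (-5/6) * y powr (-1/3)"
    by (simp flip: powr_add)
  have eq: "F (z * y powr (-1/3)) * ((1/6) * y powr (1/6 - 1)) + y powr (1/6) * (P (z * y powr (-1/3)) * (z * ((-1/3) * y powr (-1/3 - 1))))
     = y powr (-5/6) * (F (z * y powr (-1/3)) / 6 - (z * y powr (-1/3)) * P (z * y powr (-1/3)) / 3)"
  proof -
    have "A * (1/6 * c) + d * (B * (z * (-1/3 * e))) = c * (A / 6 - (z * g) * B / 3)"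
      if "d * e = c * g" for A B c d e g :: real
    proof -
      have "d * (B * (z * (-1/3 * e))) = (-1/3) * (B * z) * (d * e)" by simp
      moreover have "c * (A / 6 - (z * g) * B / 3) = A * (1/6 * c) + (-1/3) * (B * z) * (c * g)"
        by (simp add: algebra_simps)
      ultimately show ?thesis by (simp only: that)
    qed
    from this[OF e2, of "F (z * y powr (-1/3))" "P (z * y powr (-1/3))"] show ?thesis unfolding e1 .
  qed
  have "((\<lambda>y. y powr (1/6) * F (z * y powr (-1/3))) has_real_derivative
     y powr (1/6) * (P (z * y powr (-1/3)) * (z * ((-1/3) * y powr (-1/3 - 1)))) +
     (1/6) * y powr (1/6 - 1) * F (z * y powr (-1/3))) (at y)"
    by (rule DERIV_mult'[OF b DERIV_chain2[OF DERIV_F a]])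
  then show ?thesis unfolding V0_def eq[symmetric] by (simp add: add.commute mult.commute)
qed

end

section \<open>Estimates for the similarity solution\<close>

lemma lipschitz_of_deriv_bound:
  fixes f :: "real \<Rightarrow> real"
  assumes "\<And>t. (f has_real_derivative f' t) (at t)" "\<And>t. \<bar>f' t\<bar> \<le> B"
  shows "\<bar>f t - f s\<bar> \<le> B * \<bar>t - s\<bar>"
proof -
  have "norm (f t - f s) \<le> B * norm (t - s)"
    by (rule field_differentiable_bound[of UNIV f f']) (use assms in auto)
  then show ?thesis by simp
qed

text \<open>|t|^\<mu> <= max(1, |t|) <= 1 + |t|. With t = z y^(-1/3) the gain is |t|^(-\<mu>) =
  y^(\<mu>/3) |z|^(-\<mu>): part of the singularity moves from y to z.\<close>

lemma decay_interp:
  fixes t q B \<mu> :: real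
  assumes "(1 + \<bar>t\<bar>) * \<bar>q\<bar> \<le> B" "0 \<le> \<mu>" "\<mu> \<le> 1" "t \<noteq> 0"
  shows "\<bar>q\<bar> \<le> B * \<bar>t\<bar> powr (- \<mu>)"
proof -
  have "\<bar>t\<bar> powr \<mu> \<le> 1 + \<bar>t\<bar>"
  proof (cases "\<bar>t\<bar> \<le> 1")
    case True
    then have "\<bar>t\<bar> powr \<mu> \<le> 1 powr \<mu>" using assms by (intro powr_mono2) auto
    then show ?thesis by simp
  next
    case False
    then have "\<bar>t\<bar> powr \<mu> \<le> \<bar>t\<bar> powr 1" using assms by (intro powr_mono) auto
    then show ?thesis using assms by simp
  qed
  then have "\<bar>t\<bar> powr \<mu> * \<bar>q\<bar> \<le> (1 + \<bar>t\<bar>) * \<bar>q\<bar>" by (intro mult_right_mono) auto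
  then have "\<bar>q\<bar> * \<bar>t\<bar> powr \<mu> \<le> B" using assms by (simp add: mult.commute)
  then show ?thesis using assms by (simp add: powr_minus field_simps)
qed

lemma abs_scaled_powr:
  fixes y z \<mu> :: real
  assumes "y > 0"
  shows "\<bar>z * y powr (-1/3)\<bar> powr (- \<mu>) = y powr (\<mu>/3) * \<bar>z\<bar> powr (- \<mu>)"
  using assms by (simp add: abs_mult powr_mult powr_powr)

lemma powr_square: "(x powr c)\<^sup>2 = (x::real) powr (2 * c)"
  by (simp add: power2_eq_square flip: powr_add)

context profile
begin

lemma V0_bound:
  assumes "0 < y" "y \<le> L" "\<bar>z\<bar> \<le> 1"
  shows "(V0 y z)\<^sup>2 \<le> (C * (L powr (1/3) + 1))\<^sup>2 * y powr (- (1/3))"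
proof -
  let ?t = "z * y powr (-1/3)"
  have "\<bar>?t\<bar> \<le> y powr (-1/3)"
    using assms mult_right_mono[OF assms(3), of "y powr (-1/3)"] by (simp add: abs_mult)
  then have "\<bar>F ?t\<bar> \<le> C * (1 + y powr (-1/3))"
    using F_bound[of ?t] C_nonneg mult_left_mono[of "1 + \<bar>?t\<bar>" "1 + y powr (-1/3)" C] by linarith
  then have "\<bar>V0 y z\<bar> \<le> y powr (1/6) * (C * (1 + y powr (-1/3)))"
    unfolding V0_def abs_mult by (intro mult_mono) auto
  also have "\<dots> = C * (y powr (1/6) + y powr (1/6) * y powr (-1/3))" by (simp add: algebra_simps)
  also have "y powr (1/6) = y powr (1/3) * y powr (-1/6)" by (simp flip: powr_add)
  also have "y powr (1/3) * y powr (-1/6) * y powr (-1/3) = y powr (-1/6)"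
    using assms by (simp flip: powr_add)
  also have "C * (y powr (1/3) * y powr (-1/6) + y powr (-1/6)) = C * (y powr (1/3) + 1) * y powr (-1/6)"
    by (simp add: algebra_simps)
  also have "\<dots> \<le> C * (L powr (1/3) + 1) * y powr (-1/6)"
    using assms C_nonneg by (intro mult_right_mono mult_left_mono add_mono powr_mono2) auto
  finally have "\<bar>V0 y z\<bar> \<le> C * (L powr (1/3) + 1) * y powr (-1/6)" .
  then have "\<bar>V0 y z\<bar>\<^sup>2 \<le> (C * (L powr (1/3) + 1) * y powr (-1/6))\<^sup>2" by (intro power_mono) auto
  then show ?thesis by (simp add: power_mult_distrib powr_square)
qed

lemma V1_bound: "(V1 y z)\<^sup>2 \<le> C\<^sup>2 * y powr (- (1/3))"
proof -
  have "\<bar>V1 y z\<bar> \<le> y powr (-1/6) * C"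
    unfolding V1_def abs_mult using P_bound by (intro mult_mono) auto
  then have "\<bar>V1 y z\<bar>\<^sup>2 \<le> (y powr (-1/6) * C)\<^sup>2" by (intro power_mono) auto
  then show ?thesis by (simp add: power_mult_distrib powr_square mult.commute)
qed

text \<open>b = 0 gives the non-integrable 1/y; every b > 0 improves the power of y at the price of
  |z|^(-b).\<close>

lemma V2_bound:
  assumes "0 < y" "z \<noteq> 0" "0 \<le> b" "b \<le> 2"
  shows "(V2 y z)\<^sup>2 \<le> C\<^sup>2 * (y powr (- (1 - b/3)) * \<bar>z\<bar> powr (- b))"
proof -
  let ?t = "z * y powr (-1/3)"
  have "\<bar>Q ?t\<bar> \<le> C * \<bar>?t\<bar> powr (- (b/2))"
    using assms Q_bound[of ?t] by (intro decay_interp) auto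
  also have "\<dots> = C * (y powr (b/2/3) * \<bar>z\<bar> powr (- (b/2)))" by (simp only: abs_scaled_powr[OF assms(1)])
  finally have "\<bar>V2 y z\<bar> \<le> y powr (-1/2) * (C * (y powr (b/2/3) * \<bar>z\<bar> powr (- (b/2))))"
    unfolding V2_def abs_mult by (intro mult_mono) auto
  also have "\<dots> = C * ((y powr (-1/2) * y powr (b/2/3)) * \<bar>z\<bar> powr (- (b/2)))" by (simp only: mult_ac)
  also have "y powr (-1/2) * y powr (b/2/3) = y powr (-1/2 + b/2/3)" by (simp only: powr_add)
  finally have "\<bar>V2 y z\<bar>\<^sup>2 \<le> (C * (y powr (-1/2 + b/2/3) * \<bar>z\<bar> powr (- (b/2))))\<^sup>2" by (intro power_mono) auto
  also have "\<dots> = C\<^sup>2 * (y powr (2 * (-1/2 + b/2/3)) * \<bar>z\<bar> powr (2 * (- (b/2))))"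
    by (simp only: power_mult_distrib powr_square)
  also have "2 * (-1/2 + b/2/3) = - (1 - b/3)" by simp
  also have "2 * (- (b/2)) = - b" by simp
  finally show ?thesis by simp
qed

lemma V0_diff_z:
  assumes "0 < y"
  shows "(V0 y z - V0 y w)\<^sup>2 \<le> C\<^sup>2 * y powr (- (1/3)) * \<bar>z - w\<bar>\<^sup>2"
proof -
  have "\<bar>V0 y z - V0 y w\<bar> \<le> (y powr (-1/6) * C) * \<bar>z - w\<bar>"
  proof (rule lipschitz_of_deriv_bound)
    show "(V0 y has_real_derivative V1 y t) (at t)" for t using DERIV_V0_z[OF assms] by simp
    show "\<bar>V1 y t\<bar> \<le> y powr (-1/6) * C" for t
      unfolding V1_def abs_mult using P_bound by (intro mult_mono) auto
  qed
  then have "\<bar>V0 y z - V0 y w\<bar>\<^sup>2 \<le> ((y powr (-1/6) * C) * \<bar>z - w\<bar>)\<^sup>2" by (intro power_mono) auto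
  then show ?thesis by (simp add: power_mult_distrib powr_square mult_ac)
qed

lemma scaled_diff:
  assumes "0 < (y::real)"
  shows "\<bar>z * y powr (-1/3) - w * y powr (-1/3)\<bar> powr \<theta> = y powr (- (\<theta>/3)) * \<bar>z - w\<bar> powr \<theta>"
proof -
  have "z * y powr (-1/3) - w * y powr (-1/3) = (z - w) * y powr (-1/3)" by (simp add: algebra_simps)
  then show ?thesis using abs_scaled_powr[OF assms, of "z - w" "- \<theta>"] by simp
qed

text \<open>P is both Lipschitz and bounded, and min(C d, 2 C) <= 2 C d^\<theta> for 0 <= \<theta>
  <= 1.\<close>

lemma V1_diff_z:
  assumes "0 < y" "0 \<le> \<theta>" "\<theta> \<le> 1" "z \<noteq> w"
  shows "(V1 y z - V1 y w)\<^sup>2 \<le> (2 * C)\<^sup>2 * (y powr (- (1/3 + 2*\<theta>/3)) * \<bar>z - w\<bar> powr (2 * \<theta>))"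
proof -
  let ?t = "z * y powr (-1/3)" and ?s = "w * y powr (-1/3)"
  have CQ: "\<bar>Q t\<bar> \<le> C" for t
    using Q_bound[of t] mult_right_mono[of 1 "1 + \<bar>t\<bar>" "\<bar>Q t\<bar>"] by simp
  have lip: "\<bar>P ?t - P ?s\<bar> \<le> C * \<bar>?t - ?s\<bar>" by (rule lipschitz_of_deriv_bound[OF DERIV_P CQ])
  have "\<bar>P ?t - P ?s\<bar> \<le> 2 * C * \<bar>?t - ?s\<bar> powr \<theta>"
  proof (cases "\<bar>?t - ?s\<bar> \<le> 1")
    case True
    have "\<bar>?t - ?s\<bar> > 0" using assms by simp
    then have "\<bar>?t - ?s\<bar> powr 1 \<le> \<bar>?t - ?s\<bar> powr \<theta>" using True assms by (intro powr_mono') auto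
    then have "\<bar>?t - ?s\<bar> \<le> \<bar>?t - ?s\<bar> powr \<theta>" by simp
    then have "C * \<bar>?t - ?s\<bar> \<le> C * \<bar>?t - ?s\<bar> powr \<theta>" using C_nonneg by (rule mult_left_mono)
    moreover have "0 \<le> C * \<bar>?t - ?s\<bar> powr \<theta>" using C_nonneg by simp
    ultimately show ?thesis using lip by linarith
  next
    case False
    then have "1 powr \<theta> \<le> \<bar>?t - ?s\<bar> powr \<theta>" using assms by (intro powr_mono2) auto
    then have "2 * C * 1 \<le> 2 * C * \<bar>?t - ?s\<bar> powr \<theta>" using C_nonneg by (intro mult_left_mono) auto
    then show ?thesis using P_bound[of ?t] P_bound[of ?s] by linarith
  qed
  also have "\<dots> = 2 * C * (y powr (- (\<theta>/3)) * \<bar>z - w\<bar> powr \<theta>)" by (simp only: scaled_diff[OF assms(1)])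
  finally have "\<bar>V1 y z - V1 y w\<bar> \<le> y powr (-1/6) * (2 * C * (y powr (- (\<theta>/3)) * \<bar>z - w\<bar> powr \<theta>))"
    unfolding V1_def right_diff_distrib[symmetric] abs_mult by (intro mult_mono) auto
  also have "\<dots> = 2 * C * ((y powr (-1/6) * y powr (- (\<theta>/3))) * \<bar>z - w\<bar> powr \<theta>)" by (simp only: mult_ac)
  also have "y powr (-1/6) * y powr (- (\<theta>/3)) = y powr (-1/6 + - (\<theta>/3))" by (simp only: powr_add)
  finally have "\<bar>V1 y z - V1 y w\<bar>\<^sup>2 \<le> (2 * C * (y powr (-1/6 + - (\<theta>/3)) * \<bar>z - w\<bar> powr \<theta>))\<^sup>2" by (intro power_mono) auto
  also have "\<dots> = (2 * C)\<^sup>2 * (y powr (2 * (-1/6 + - (\<theta>/3))) * \<bar>z - w\<bar> powr (2 * \<theta>))"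
    by (simp only: power_mult_distrib powr_square)
  also have "2 * (-1/6 + - (\<theta>/3)) = - (1/3 + 2*\<theta>/3)" by simp
  finally show ?thesis by simp
qed

text \<open>Interpolation: the square is split into the powers 2 \<theta> and 2 - 2 \<theta> of |Q t
  - Q s|. The first is estimated by the Lipschitz bound from T, the second by the decay of
  Q.\<close>

lemma Q_diff:
  assumes \<theta>: "0 \<le> \<theta>" "\<theta> < 1" and b: "0 \<le> b" "b \<le> 2 - 2 * \<theta>" and ts: "t \<noteq> 0" "s \<noteq> 0"
  shows "(Q t - Q s)\<^sup>2 \<le> C powr (2 * \<theta>) * (2 * C) powr (2 - 2 * \<theta>) *
     (\<bar>t - s\<bar> powr (2 * \<theta>) * (\<bar>t\<bar> powr (- b) + \<bar>s\<bar> powr (- b)))"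
proof (cases "Q t = Q s")
  case False
  \<comment> \<open>The decay exponent whose power 2 - 2 \<theta> is exactly b; it is at most 1
    because b <= 2 - 2 \<theta>.\<close>
  define \<mu> where "\<mu> = b / (2 - 2 * \<theta>)"
  have \<mu>: "0 \<le> \<mu>" "\<mu> \<le> 1" "\<mu> * (2 - 2 * \<theta>) = b" using assms by (auto simp: \<mu>_def)
  have x: "\<bar>Q t - Q s\<bar> > 0" using False by simp
  have "\<bar>Q t - Q s\<bar> \<le> C * \<bar>t - s\<bar>" by (rule lipschitz_of_deriv_bound[OF DERIV_Q T_bound])
  then have "\<bar>Q t - Q s\<bar> powr (2 * \<theta>) \<le> (C * \<bar>t - s\<bar>) powr (2 * \<theta>)"
    using \<theta> by (intro powr_mono2) auto
  then have 1: "\<bar>Q t - Q s\<bar> powr (2 * \<theta>) \<le> C powr (2 * \<theta>) * \<bar>t - s\<bar> powr (2 * \<theta>)"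
    using C_nonneg by (simp add: powr_mult)
  define m where "m = max (\<bar>t\<bar> powr (- \<mu>)) (\<bar>s\<bar> powr (- \<mu>))"
  have "\<bar>Q t\<bar> \<le> C * \<bar>t\<bar> powr (- \<mu>)" "\<bar>Q s\<bar> \<le> C * \<bar>s\<bar> powr (- \<mu>)"
    using decay_interp[OF Q_bound \<mu>(1,2)] ts by auto
  moreover have "C * \<bar>t\<bar> powr (- \<mu>) \<le> C * m" "C * \<bar>s\<bar> powr (- \<mu>) \<le> C * m"
    using C_nonneg by (auto simp: m_def intro!: mult_left_mono)
  ultimately have "\<bar>Q t - Q s\<bar> \<le> 2 * C * m" by linarith
  then have "\<bar>Q t - Q s\<bar> powr (2 - 2 * \<theta>) \<le> (2 * C * m) powr (2 - 2 * \<theta>)"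
    using \<theta> by (intro powr_mono2) auto
  also have "\<dots> = (2 * C) powr (2 - 2 * \<theta>) * m powr (2 - 2 * \<theta>)"
    using C_nonneg by (intro powr_mult)
  also have "m powr (2 - 2 * \<theta>) \<le> \<bar>t\<bar> powr (- b) + \<bar>s\<bar> powr (- b)"
  proof -
    have "m = \<bar>t\<bar> powr (- \<mu>) \<or> m = \<bar>s\<bar> powr (- \<mu>)" by (auto simp: m_def)
    moreover have "(x powr (- \<mu>)) powr (2 - 2 * \<theta>) = x powr (- b)" for x
      using \<mu>(3) by (simp add: powr_powr)
    ultimately show ?thesis by auto
  qed
  finally have 2: "\<bar>Q t - Q s\<bar> powr (2 - 2 * \<theta>) \<le> (2 * C) powr (2 - 2 * \<theta>) * (\<bar>t\<bar> powr (- b) + \<bar>s\<bar> powr (- b))"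
    by (simp add: mult_left_mono)
  have "(Q t - Q s)\<^sup>2 = \<bar>Q t - Q s\<bar> powr (2 * \<theta>) * \<bar>Q t - Q s\<bar> powr (2 - 2 * \<theta>)"
    using x by (simp flip: powr_add)
  also have "\<dots> \<le> (C powr (2 * \<theta>) * \<bar>t - s\<bar> powr (2 * \<theta>)) * ((2 * C) powr (2 - 2 * \<theta>) * (\<bar>t\<bar> powr (- b) + \<bar>s\<bar> powr (- b)))"
    by (intro mult_mono 1 2) auto
  finally show ?thesis by (simp only: mult_ac)
qed simp

lemma V2_diff_z:
  assumes y: "0 < y" and \<theta>: "0 \<le> \<theta>" "\<theta> < 1" and b: "0 \<le> b" "b \<le> 2 - 2 * \<theta>" and zw: "z \<noteq> 0" "w \<noteq> 0"
  shows "(V2 y z - V2 y w)\<^sup>2 \<le> C powr (2 * \<theta>) * (2 * C) powr (2 - 2 * \<theta>) *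
     (y powr (- (1 + 2*\<theta>/3 - b/3)) * ((\<bar>z\<bar> powr (- b) + \<bar>w\<bar> powr (- b)) * \<bar>z - w\<bar> powr (2 * \<theta>)))"
proof -
  let ?t = "z * y powr (-1/3)" and ?s = "w * y powr (-1/3)" and ?K = "C powr (2 * \<theta>) * (2 * C) powr (2 - 2 * \<theta>)"
  have "(V2 y z - V2 y w)\<^sup>2 = y powr (-1) * (Q ?t - Q ?s)\<^sup>2"
    unfolding V2_def right_diff_distrib[symmetric] power_mult_distrib powr_square by simp
  also have "\<dots> \<le> y powr (-1) * (?K * (\<bar>?t - ?s\<bar> powr (2 * \<theta>) * (\<bar>?t\<bar> powr (- b) + \<bar>?s\<bar> powr (- b))))"
    using y zw by (intro mult_left_mono Q_diff[OF \<theta> b]) auto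
  also have "\<dots> = y powr (-1) * (?K * ((y powr (- (2*\<theta>/3)) * \<bar>z - w\<bar> powr (2 * \<theta>)) *
      (y powr (b/3) * (\<bar>z\<bar> powr (- b) + \<bar>w\<bar> powr (- b)))))"
    by (simp only: scaled_diff[OF y] abs_scaled_powr[OF y] distrib_left[of "y powr (b/3)"])
  also have "\<dots> = ?K * ((y powr (-1) * y powr (- (2*\<theta>/3)) * y powr (b/3)) *
      ((\<bar>z\<bar> powr (- b) + \<bar>w\<bar> powr (- b)) * \<bar>z - w\<bar> powr (2 * \<theta>)))" by (simp only: mult_ac)
  also have "y powr (-1) * y powr (- (2*\<theta>/3)) * y powr (b/3) = y powr (-1 + - (2*\<theta>/3) + b/3)"
    by (simp only: powr_add)
  also have "-1 + - (2*\<theta>/3) + b/3 = - (1 + 2*\<theta>/3 - b/3)" by simp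
  finally show ?thesis .
qed

text \<open>The y-derivative is y^(-5/6) times the Euler combination, hence at most C |z|^(-\<mu>)
  s^(-5/6 + \<mu>/3) at s; condition \<open>e\<close> splits this power into the weight s^(-\<beta>)
  and the integrable s^(\<theta> - 1).\<close>

lemma V0_diff_y:
  assumes y: "0 < y" "y < y'" and z: "z \<noteq> 0" and \<mu>: "0 \<le> \<mu>" "\<mu> \<le> 1" and "\<beta> \<ge> 0" "0 < \<theta>" "\<theta> \<le> 1"
    and e: "\<theta> - 1 - \<beta> = -5/6 + \<mu>/3"
  shows "\<bar>V0 y' z - V0 y z\<bar> \<le> C / \<theta> * (\<bar>z\<bar> powr (- \<mu>) * (y powr (- \<beta>) * (y' - y) powr \<theta>))"
proof -
  define B where "B = C * (\<bar>z\<bar> powr (- \<mu>) * y powr (- \<beta>))"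
  have B: "B \<ge> 0" using C_nonneg by (simp add: B_def)
  let ?d = "\<lambda>s. s powr (-5/6) * (F (z * s powr (-1/3)) / 6 - (z * s powr (-1/3)) * P (z * s powr (-1/3)) / 3)"
  have "norm (V0 y' z - V0 y z) \<le> B * ((y' - y) powr \<theta> / \<theta>) - B * ((y - y) powr \<theta> / \<theta>)"
  proof (rule differentiable_bound_general[OF y(2), where f = "\<lambda>s. V0 s z" and f' = ?d
        and \<phi> = "\<lambda>s. B * ((s - y) powr \<theta> / \<theta>)" and \<phi>' = "\<lambda>s. B * (s - y) powr (\<theta> - 1)"])
    show "continuous_on {y..y'} (\<lambda>s. V0 s z)"
    proof (intro continuous_at_imp_continuous_on ballI)
      fix s assume "s \<in> {y..y'}"
      then have "s > 0" using y by simp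
      then show "isCont (\<lambda>s. V0 s z) s" using DERIV_V0_y DERIV_isCont by blast
    qed
    show "continuous_on {y..y'} (\<lambda>s. B * ((s - y) powr \<theta> / \<theta>))"
      using \<open>0 < \<theta>\<close> by (intro continuous_intros continuous_on_powr') auto
    fix s assume s: "y < s" "s < y'"
    then have s0: "s > 0" using y by simp
    show "((\<lambda>s. V0 s z) has_vector_derivative ?d s) (at s)"
      using DERIV_V0_y[OF s0] by (simp only: has_real_derivative_iff_has_vector_derivative)
    have "((\<lambda>s. B * ((s - y) powr \<theta> / \<theta>)) has_real_derivative B * (s - y) powr (\<theta> - 1)) (at s)"
      using s \<open>0 < \<theta>\<close> by (auto intro!: derivative_eq_intros)
    then show "((\<lambda>s. B * ((s - y) powr \<theta> / \<theta>)) has_vector_derivative B * (s - y) powr (\<theta> - 1)) (at s)"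
      by (simp only: has_real_derivative_iff_has_vector_derivative)
    let ?t = "z * s powr (-1/3)"
    have "\<bar>F ?t / 6 - ?t * P ?t / 3\<bar> \<le> C * \<bar>?t\<bar> powr (- \<mu>)"
      using s0 z by (intro decay_interp[OF Euler_bound \<mu>]) auto
    also have "\<dots> = C * (s powr (\<mu>/3) * \<bar>z\<bar> powr (- \<mu>))" by (simp only: abs_scaled_powr[OF s0])
    finally have "norm (?d s) \<le> s powr (-5/6) * (C * (s powr (\<mu>/3) * \<bar>z\<bar> powr (- \<mu>)))"
      unfolding real_norm_def abs_mult by (intro mult_mono) auto
    also have "\<dots> = C * \<bar>z\<bar> powr (- \<mu>) * (s powr (-5/6) * s powr (\<mu>/3))" by (simp only: mult_ac)
    also have "s powr (-5/6) * s powr (\<mu>/3) = s powr (- \<beta>) * s powr (\<theta> - 1)"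
    proof -
      have "-5/6 + \<mu>/3 = - \<beta> + (\<theta> - 1)" using e by simp
      then show ?thesis by (simp flip: powr_add)
    qed
    \<comment> \<open>Both exponents are nonpositive, while s >= y and s >= s - y. The right side is
      the derivative of the comparison function B (s - y)^\<theta> / \<theta>.\<close>
    also have "C * \<bar>z\<bar> powr (- \<mu>) * (s powr (- \<beta>) * s powr (\<theta> - 1))
        \<le> C * \<bar>z\<bar> powr (- \<mu>) * (y powr (- \<beta>) * (s - y) powr (\<theta> - 1))"
      using s y \<open>\<beta> \<ge> 0\<close> \<open>\<theta> \<le> 1\<close> C_nonneg
      by (intro mult_left_mono mult_mono powr_mono2') auto
    also have "\<dots> = B * (s - y) powr (\<theta> - 1)" by (simp add: B_def mult_ac)
    finally show "norm (?d s) \<le> B * (s - y) powr (\<theta> - 1)" .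
  qed
  then show ?thesis by (simp add: B_def mult_ac)
qed

end

section \<open>Weighted bounds near an end point of the interval\<close>

lemma wholder_cong:
  assumes "\<And>p q. p \<in> S \<Longrightarrow> q \<in> T \<Longrightarrow> f p q = g p q" "wholder S p0 T q0 a b \<theta> f"
  shows "wholder S p0 T q0 a b \<theta> g"
  using assms(2) unfolding wholder_def by (simp add: assms(1))

lemma wbound_cong:
  assumes "\<And>p q. p \<in> S \<Longrightarrow> q \<in> T \<Longrightarrow> f p q = g p q" "wbound S p0 T q0 a b f"
  shows "wbound S p0 T q0 a b g"
  using assms(2) unfolding wbound_def by (simp add: assms(1))

text \<open>For bounds that depend only on the distance to \<open>xi\<close>: |z| < 1 allows the
  weight |z|^(-b) >= 1 to be inserted, and bounded distance allows \<open>c\<close> to be raised to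
  \<open>a\<close>.\<close>

lemma wbound_powr:
  assumes S: "\<And>x. x \<in> S \<Longrightarrow> 0 < \<bar>x - xi\<bar> \<and> \<bar>x - xi\<bar> \<le> L"
    and f: "\<And>x z. x \<in> S \<Longrightarrow> z \<in> {-1<..<1} \<Longrightarrow> (f x z)\<^sup>2 \<le> K * \<bar>x - xi\<bar> powr (- c)"
    and "K \<ge> 0" "c \<le> a" "b \<ge> 0"
  shows "wbound S xi {-1<..<1} 0 a b f"
  unfolding wbound_def
proof (intro exI[of _ "K * L powr (a - c)"] conjI ballI impI)
  show "0 \<le> K * L powr (a - c)" using assms by simp
  fix x z :: real assume x: "x \<in> S" and z: "z \<in> {-1<..<1}" "z \<noteq> 0"
  have "(f x z)\<^sup>2 \<le> K * (L powr (a - c) * \<bar>x - xi\<bar> powr (- a))"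
    using f[OF x z(1)] mult_left_mono[OF powr_mono_exponent_bounded \<open>K \<ge> 0\<close>, of "\<bar>x - xi\<bar>" L c a] S[OF x] \<open>c \<le> a\<close>
    by linarith
  also have "\<dots> = K * L powr (a - c) * (\<bar>x - xi\<bar> powr (- a) * 1)" by simp
  also have "\<dots> \<le> K * L powr (a - c) * (\<bar>x - xi\<bar> powr (- a) * \<bar>z - 0\<bar> powr (- b))"
    using z assms by (intro mult_left_mono one_le_powr_neg) auto
  finally show "(f x z)\<^sup>2 \<le> K * L powr (a - c) * (\<bar>x - xi\<bar> powr (- a) * \<bar>z - 0\<bar> powr (- b))" .
qed

lemma wholder_powr:
  assumes S: "\<And>x. x \<in> S \<Longrightarrow> 0 < \<bar>x - xi\<bar> \<and> \<bar>x - xi\<bar> \<le> L"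
    and f: "\<And>x z w. x \<in> S \<Longrightarrow> z \<in> {-1<..<1} \<Longrightarrow> w \<in> {-1<..<1} \<Longrightarrow> z \<noteq> w \<Longrightarrow>
        (f x z - f x w)\<^sup>2 \<le> K * (\<bar>x - xi\<bar> powr (- c) * \<bar>z - w\<bar> powr (2 * \<theta>))"
    and "K \<ge> 0" "c \<le> a" "b \<ge> 0"
  shows "wholder S xi {-1<..<1} 0 a b \<theta> f"
  unfolding wholder_def
proof (intro exI[of _ "K * L powr (a - c)"] conjI ballI impI)
  show "0 \<le> K * L powr (a - c)" using assms by simp
  fix x z w :: real assume x: "x \<in> S" and z: "z \<in> {-1<..<1}" "z \<noteq> 0" and w: "w \<in> {-1<..<1}" "w \<noteq> 0"
  show "(f x z - f x w)\<^sup>2 \<le> K * L powr (a - c) * (\<bar>x - xi\<bar> powr (- a) *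
      ((\<bar>z - 0\<bar> powr (- b) + \<bar>w - 0\<bar> powr (- b)) * \<bar>z - w\<bar> powr (2 * \<theta>)))"
  proof (cases "z = w")
    case False
    have "\<bar>x - xi\<bar> powr (- c) * \<bar>z - w\<bar> powr (2 * \<theta>)
        \<le> (L powr (a - c) * \<bar>x - xi\<bar> powr (- a)) * ((\<bar>z - 0\<bar> powr (- b) + \<bar>w - 0\<bar> powr (- b)) * \<bar>z - w\<bar> powr (2 * \<theta>))"
    proof (rule mult_mono)
      show "\<bar>x - xi\<bar> powr (- c) \<le> L powr (a - c) * \<bar>x - xi\<bar> powr (- a)"
        using S[OF x] \<open>c \<le> a\<close> by (intro powr_mono_exponent_bounded) auto
      have "1 \<le> \<bar>z - 0\<bar> powr (- b)" using z \<open>b \<ge> 0\<close> by (intro one_le_powr_neg) auto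
      then have "1 \<le> \<bar>z - 0\<bar> powr (- b) + \<bar>w - 0\<bar> powr (- b)"
        using powr_ge_zero[of "\<bar>w - 0\<bar>" "- b"] by linarith
      then have "1 * \<bar>z - w\<bar> powr (2 * \<theta>) \<le> (\<bar>z - 0\<bar> powr (- b) + \<bar>w - 0\<bar> powr (- b)) * \<bar>z - w\<bar> powr (2 * \<theta>)"
        by (rule mult_right_mono) simp
      then show "\<bar>z - w\<bar> powr (2 * \<theta>) \<le> (\<bar>z - 0\<bar> powr (- b) + \<bar>w - 0\<bar> powr (- b)) * \<bar>z - w\<bar> powr (2 * \<theta>)"
        by simp
    qed auto
    from mult_left_mono[OF this \<open>K \<ge> 0\<close>] f[OF x z(1) w(1) False]
    have "(f x z - f x w)\<^sup>2 \<le> K * ((L powr (a - c) * \<bar>x - xi\<bar> powr (- a)) * ((\<bar>z - 0\<bar> powr (- b) + \<bar>w - 0\<bar> powr (- b)) * \<bar>z - w\<bar> powr (2 * \<theta>)))"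
      by (rule order_trans[rotated])
    then show ?thesis by (simp only: mult_ac)
  qed simp
qed

context profile
begin

context
  fixes S :: "real set" and xi L :: real
  assumes S: "\<And>x. x \<in> S \<Longrightarrow> 0 < \<bar>x - xi\<bar> \<and> \<bar>x - xi\<bar> \<le> L"
begin

lemma wbound_V0: "1/3 \<le> a \<Longrightarrow> 0 \<le> b \<Longrightarrow> wbound S xi {-1<..<1} 0 a b (\<lambda>x z. V0 \<bar>x - xi\<bar> z)"
  by (rule wbound_powr[OF S, where c = "1/3" and K = "(C * (L powr (1/3) + 1))\<^sup>2"])
    (use S in \<open>auto intro!: V0_bound\<close>)

lemma wbound_V1: "1/3 \<le> a \<Longrightarrow> 0 \<le> b \<Longrightarrow> wbound S xi {-1<..<1} 0 a b (\<lambda>x z. V1 \<bar>x - xi\<bar> z)"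
  by (rule wbound_powr[OF S, where c = "1/3" and K = "C\<^sup>2"]) (auto intro!: V1_bound)

lemma wbound_V2:
  assumes "0 \<le> b" "b \<le> 2" "1 - b/3 \<le> a"
  shows "wbound S xi {-1<..<1} 0 a b (\<lambda>x z. V2 \<bar>x - xi\<bar> z)"
  unfolding wbound_def
proof (intro exI[of _ "C\<^sup>2 * L powr (a - (1 - b/3))"] conjI ballI impI)
  show "0 \<le> C\<^sup>2 * L powr (a - (1 - b/3))" by simp
  fix x z :: real assume x: "x \<in> S" and z: "z \<in> {-1<..<1}" "z \<noteq> 0"
  have "(V2 \<bar>x - xi\<bar> z)\<^sup>2 \<le> C\<^sup>2 * (\<bar>x - xi\<bar> powr (- (1 - b/3)) * \<bar>z\<bar> powr (- b))"
    using S[OF x] z assms by (intro V2_bound) auto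
  also have "\<dots> \<le> C\<^sup>2 * ((L powr (a - (1 - b/3)) * \<bar>x - xi\<bar> powr (- a)) * \<bar>z\<bar> powr (- b))"
    using S[OF x] assms by (intro mult_left_mono mult_right_mono powr_mono_exponent_bounded) auto
  finally show "(V2 \<bar>x - xi\<bar> z)\<^sup>2 \<le> C\<^sup>2 * L powr (a - (1 - b/3)) * (\<bar>x - xi\<bar> powr (- a) * \<bar>z - 0\<bar> powr (- b))"
    by (simp add: mult_ac)
qed

lemma wholder_V0:
  assumes "1/3 \<le> a" "0 \<le> b" "\<theta> \<le> 1"
  shows "wholder S xi {-1<..<1} 0 a b \<theta> (\<lambda>x z. V0 \<bar>x - xi\<bar> z)"
proof (rule wholder_powr[OF S, where c = "1/3" and K = "C\<^sup>2 * 2 powr (2 - 2 * \<theta>)"])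
  fix x z w :: real assume x: "x \<in> S" and z: "z \<in> {-1<..<1}" "w \<in> {-1<..<1}" "z \<noteq> w"
  have "\<bar>z - w\<bar>\<^sup>2 = \<bar>z - w\<bar> powr (2 - 2 * \<theta>) * \<bar>z - w\<bar> powr (2 * \<theta>)"
    using z by (simp flip: powr_add)
  also have "\<dots> \<le> 2 powr (2 - 2 * \<theta>) * \<bar>z - w\<bar> powr (2 * \<theta>)"
    using z assms by (intro mult_right_mono powr_mono2) auto
  finally have "C\<^sup>2 * \<bar>x - xi\<bar> powr (- (1/3)) * \<bar>z - w\<bar>\<^sup>2
      \<le> C\<^sup>2 * \<bar>x - xi\<bar> powr (- (1/3)) * (2 powr (2 - 2 * \<theta>) * \<bar>z - w\<bar> powr (2 * \<theta>))"
    by (rule mult_left_mono) simp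
  then have "(V0 \<bar>x - xi\<bar> z - V0 \<bar>x - xi\<bar> w)\<^sup>2
      \<le> C\<^sup>2 * \<bar>x - xi\<bar> powr (- (1/3)) * (2 powr (2 - 2 * \<theta>) * \<bar>z - w\<bar> powr (2 * \<theta>))"
    using S[OF x] V0_diff_z[of "\<bar>x - xi\<bar>" z w] by (meson order_trans)
  then show "(V0 \<bar>x - xi\<bar> z - V0 \<bar>x - xi\<bar> w)\<^sup>2
      \<le> C\<^sup>2 * 2 powr (2 - 2 * \<theta>) * (\<bar>x - xi\<bar> powr (- (1/3)) * \<bar>z - w\<bar> powr (2 * \<theta>))"
    by (simp only: mult_ac)
qed (use assms in auto)

lemma wholder_V1:
  assumes "1/3 + 2*\<theta>/3 \<le> a" "0 \<le> b" "0 \<le> \<theta>" "\<theta> \<le> 1"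
  shows "wholder S xi {-1<..<1} 0 a b \<theta> (\<lambda>x z. V1 \<bar>x - xi\<bar> z)"
  by (rule wholder_powr[OF S, where c = "1/3 + 2*\<theta>/3" and K = "(2 * C)\<^sup>2"])
    (use S assms V1_diff_z in auto)

lemma wholder_V2:
  assumes "a = 1 + 2*\<theta>/3 - b/3" "0 \<le> \<theta>" "\<theta> < 1" "0 \<le> b" "b \<le> 2 - 2 * \<theta>"
  shows "wholder S xi {-1<..<1} 0 a b \<theta> (\<lambda>x z. V2 \<bar>x - xi\<bar> z)"
  unfolding wholder_def assms(1)
proof (intro exI[of _ "C powr (2 * \<theta>) * (2 * C) powr (2 - 2 * \<theta>)"] conjI ballI impI)
  fix x z w :: real assume "x \<in> S" "z \<noteq> 0" "w \<noteq> 0"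
  then show "(V2 \<bar>x - xi\<bar> z - V2 \<bar>x - xi\<bar> w)\<^sup>2 \<le> C powr (2 * \<theta>) * (2 * C) powr (2 - 2 * \<theta>) *
     (\<bar>x - xi\<bar> powr (- (1 + 2*\<theta>/3 - b/3)) * ((\<bar>z - 0\<bar> powr (- b) + \<bar>w - 0\<bar> powr (- b)) * \<bar>z - w\<bar> powr (2 * \<theta>)))"
    using V2_diff_z[of "\<bar>x - xi\<bar>" \<theta> b z w] S assms by simp
qed simp

lemma wbound_V0_swap:
  assumes "0 \<le> a" "1/3 \<le> b"
  shows "wbound {-1<..<1} 0 S xi a b (\<lambda>z x. V0 \<bar>x - xi\<bar> z)"
  using wbound_V0[of b a] assms unfolding wbound_def by (simp add: mult.commute) blast

text \<open>By \<open>side\<close>, differences of the distance to \<open>xi\<close> are differences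
  of x. \<open>V0_diff_y\<close> has its weight at the smaller distance; adding the weight at the
  other one makes the bound symmetric.\<close>

lemma wholder_V0_swap:
  assumes side: "\<And>x x'. x \<in> S \<Longrightarrow> x' \<in> S \<Longrightarrow> \<bar>\<bar>x - xi\<bar> - \<bar>x' - xi\<bar>\<bar> = \<bar>x - x'\<bar>"
    and \<mu>: "0 \<le> \<mu>" "\<mu> \<le> 1" and \<beta>: "\<beta> \<ge> 0" "0 < \<theta>" "\<theta> \<le> 1"
    and e: "\<theta> - 1 - \<beta> = -5/6 + \<mu>/3"
  shows "wholder {-1<..<1} 0 S xi (2 * \<mu>) (2 * \<beta>) \<theta> (\<lambda>z x. V0 \<bar>x - xi\<bar> z)"
proof -
  have ordered: "(V0 y z - V0 y' z)\<^sup>2 \<le> (C / \<theta>)\<^sup>2 * (\<bar>z\<bar> powr (- (2 * \<mu>)) *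
      ((y powr (- (2 * \<beta>)) + y' powr (- (2 * \<beta>))) * \<bar>y - y'\<bar> powr (2 * \<theta>)))"
    if "0 < y" "y < y'" "z \<noteq> 0" for y y' z
  proof -
    have "\<bar>V0 y' z - V0 y z\<bar>\<^sup>2 \<le> (C / \<theta> * (\<bar>z\<bar> powr (- \<mu>) * (y powr (- \<beta>) * (y' - y) powr \<theta>)))\<^sup>2"
      using V0_diff_y[OF that \<mu> \<beta> e] by (intro power_mono) auto
    also have "\<dots> = (C / \<theta>)\<^sup>2 * (\<bar>z\<bar> powr (2 * - \<mu>) * (y powr (2 * - \<beta>) * (y' - y) powr (2 * \<theta>)))"
      by (simp only: power_mult_distrib powr_square)
    also have "\<dots> \<le> (C / \<theta>)\<^sup>2 * (\<bar>z\<bar> powr (2 * - \<mu>) * ((y powr (2 * - \<beta>) + y' powr (2 * - \<beta>)) * (y' - y) powr (2 * \<theta>)))"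
      by (intro mult_left_mono mult_right_mono) auto
    finally show ?thesis using that by (simp add: power2_commute)
  qed
  have gen: "(V0 y z - V0 y' z)\<^sup>2 \<le> (C / \<theta>)\<^sup>2 * (\<bar>z\<bar> powr (- (2 * \<mu>)) *
      ((y powr (- (2 * \<beta>)) + y' powr (- (2 * \<beta>))) * \<bar>y - y'\<bar> powr (2 * \<theta>)))"
    if "0 < y" "0 < y'" "z \<noteq> 0" for y y' z
  proof -
    consider "y < y'" | "y' < y" | "y = y'" by linarith
    then show ?thesis
    proof cases
      case 1 then show ?thesis using ordered that by blast
    next
      case 2
      show ?thesis using ordered[OF that(2) 2 that(3)]
        by (simp only: power2_commute[of "V0 y z"] abs_minus_commute[of y] add.commute[of "y powr _"])
    qed simp
  qed
  show ?thesis unfolding wholder_def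
  proof (intro exI[of _ "(C / \<theta>)\<^sup>2"] conjI ballI impI)
    fix z x x' :: real assume x: "x \<in> S" "x' \<in> S" "z \<noteq> 0"
    from gen[of "\<bar>x - xi\<bar>" "\<bar>x' - xi\<bar>" z] S[OF x(1)] S[OF x(2)] x(3)
    show "(V0 \<bar>x - xi\<bar> z - V0 \<bar>x' - xi\<bar> z)\<^sup>2 \<le> (C / \<theta>)\<^sup>2 * (\<bar>z - 0\<bar> powr (- (2 * \<mu>)) *
      ((\<bar>x - xi\<bar> powr (- (2 * \<beta>)) + \<bar>x' - xi\<bar> powr (- (2 * \<beta>))) * \<bar>x - x'\<bar> powr (2 * \<theta>)))"
      by (simp add: side[OF x(1,2)])
  qed simp
qed

lemma continuous_V:
  "continuous_on (S \<times> T') (\<lambda>p. V0 \<bar>fst p - xi\<bar> (snd p))"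
  "continuous_on (S \<times> T') (\<lambda>p. V1 \<bar>fst p - xi\<bar> (snd p))"
  "continuous_on (S \<times> T') (\<lambda>p. V2 \<bar>fst p - xi\<bar> (snd p))"
proof -
  have c: "continuous_on UNIV F" "continuous_on UNIV P" "continuous_on UNIV Q"
    using DERIV_F DERIV_P DERIV_Q by (meson DERIV_isCont continuous_at_imp_continuous_on)+
  have ne: "\<forall>p\<in>S \<times> T'. \<bar>fst p - xi\<bar> \<noteq> 0" using S by fastforce
  have pw: "continuous_on (S \<times> T') (\<lambda>p. \<bar>fst p - xi\<bar> powr e)" for e
    using ne by (intro continuous_intros) auto
  have *: "continuous_on (S \<times> T') (\<lambda>p. h (snd p * \<bar>fst p - xi\<bar> powr e))" if "continuous_on UNIV h" for e and h :: "real \<Rightarrow> real"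
    by (rule continuous_on_compose2[OF that]) (auto intro!: continuous_intros pw)
  show "continuous_on (S \<times> T') (\<lambda>p. V0 \<bar>fst p - xi\<bar> (snd p))"
    unfolding V0_def by (intro continuous_on_mult pw * c)
  show "continuous_on (S \<times> T') (\<lambda>p. V1 \<bar>fst p - xi\<bar> (snd p))"
    unfolding V1_def by (intro continuous_on_mult pw * c)
  show "continuous_on (S \<times> T') (\<lambda>p. V2 \<bar>fst p - xi\<bar> (snd p))"
    unfolding V2_def by (intro continuous_on_mult pw * c)
qed

end

theorem singular_regularity:
  fixes u chi :: "real \<times> real \<Rightarrow> real"
  assumes x01: "x0 < x1" and xi: "xi \<in> {x0, x1}" and smooth: "smooth_upto (Omega x0 x1) chi"
    and u: "\<And>x z. x \<in> {x0<..<x1} \<Longrightarrow> u (x, z) = V0 \<bar>x - xi\<bar> z * chi (x, z)"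
    and \<sigma>: "0 \<le> \<sigma>" "\<sigma> < 1/2"
  shows "Hs_L2 u x0 x1 (-1) 1 ((2 + \<sigma>) / 3) \<and> L2_H2s u x0 x1 (-1) 1 \<sigma>"
proof -
  obtain c1 c2 D where lip: "lip_rect x0 x1 D chi" "lip_rect x0 x1 D c1" "lip_rect x0 x1 D c2"
    and dchi: "\<And>x z. x \<in> {x0..x1} \<Longrightarrow> z \<in> {-1..1} \<Longrightarrow> ((\<lambda>z. chi (x, z)) has_real_derivative c1 (x, z)) (at z)"
    and dc1: "\<And>x z. x \<in> {x0..x1} \<Longrightarrow> z \<in> {-1..1} \<Longrightarrow> ((\<lambda>z. c1 (x, z)) has_real_derivative c2 (x, z)) (at z)"
    by (rule smooth_upto_rectangle[OF x01 smooth], rule that)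
  let ?S = "{x0<..<x1}" and ?T = "{-1<..<1::real}"
  define R where "R = \<bar>x0\<bar> + \<bar>x1\<bar> + 1"
  have R: "?S \<subseteq> {-R..R}" "?T \<subseteq> {-R..R}" "\<bar>xi\<bar> \<le> R" "\<bar>0\<bar> \<le> R"
    using xi by (auto simp: R_def)
  have S: "0 < \<bar>x - xi\<bar> \<and> \<bar>x - xi\<bar> \<le> x1 - x0" if "x \<in> ?S" for x using xi that by auto
  have side: "\<bar>\<bar>x - xi\<bar> - \<bar>x' - xi\<bar>\<bar> = \<bar>x - x'\<bar>" if "x \<in> ?S" "x' \<in> ?S" for x x'
    using xi that by auto
  \<comment> \<open>any \<open>\<sigma> < \<theta>\<close> and \<open>2 \<theta> < b < 1\<close> would do: the latter gives \<open>a < 1\<close>\<close>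
  define \<theta> b a where "\<theta> = (\<sigma> + 1/2) / 2" and "b = (2 * \<theta> + 1) / 2" and "a = 1 + 2*\<theta>/3 - b/3"
  have \<theta>: "\<sigma> < \<theta>" "\<theta> < 1/2" "0 \<le> \<theta>" using \<sigma> by (auto simp: \<theta>_def)
  have b: "2 * \<theta> < b" "b < 1" "0 \<le> b" using \<theta> by (auto simp: b_def)
  have a: "a < 1" "1/3 + 2*\<theta>/3 \<le> a" "1/3 \<le> a" "1 - b/3 \<le> a" using b \<theta> by (auto simp: a_def)
  have w: "wbound ?S xi ?T 0 a b (\<lambda>x z. V0 \<bar>x - xi\<bar> z)" "wbound ?S xi ?T 0 a b (\<lambda>x z. V1 \<bar>x - xi\<bar> z)"
    "wbound ?S xi ?T 0 a b (\<lambda>x z. V2 \<bar>x - xi\<bar> z)"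
    "wholder ?S xi ?T 0 a b \<theta> (\<lambda>x z. V0 \<bar>x - xi\<bar> z)" "wholder ?S xi ?T 0 a b \<theta> (\<lambda>x z. V1 \<bar>x - xi\<bar> z)"
    "wholder ?S xi ?T 0 a b \<theta> (\<lambda>x z. V2 \<bar>x - xi\<bar> z)"
    using a b \<theta> by (auto intro!: wbound_V0[OF S] wbound_V1[OF S] wbound_V2[OF S] wholder_V0[OF S] wholder_V1[OF S]
        wholder_V2[OF S] simp: a_def)
  have lipD: "\<bar>f (x, z)\<bar> \<le> D" "\<bar>f (x, z) - f (x, z')\<bar> \<le> D * \<bar>z - z'\<bar>" "\<bar>f (x, z) - f (x', z)\<bar> \<le> D * \<bar>x - x'\<bar>"
    if "lip_rect x0 x1 D f" "x \<in> ?S" "x' \<in> ?S" "z \<in> ?T" "z' \<in> ?T" for f x x' z z'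
  proof -
    have "x \<in> {x0..x1}" "x' \<in> {x0..x1}" "z \<in> {-1..1}" "z' \<in> {-1..1}" using that by auto
    with that(1) show "\<bar>f (x, z)\<bar> \<le> D" "\<bar>f (x, z) - f (x, z')\<bar> \<le> D * \<bar>z - z'\<bar>" "\<bar>f (x, z) - f (x', z)\<bar> \<le> D * \<bar>x - x'\<bar>"
      unfolding lip_rect_def by blast+
  qed
  have wb: "wbound ?S xi ?T 0 a b (\<lambda>x z. V x z * f (x, z))"
    if "wbound ?S xi ?T 0 a b V" "lip_rect x0 x1 D f" for V f
    by (rule wbound_mult[OF that(1), of _ D]) (use lipD(1)[OF that(2)] in blast)
  have wh: "wholder ?S xi ?T 0 a b \<theta> (\<lambda>x z. V x z * f (x, z))"
    if "wbound ?S xi ?T 0 a b V" "wholder ?S xi ?T 0 a b \<theta> V" "lip_rect x0 x1 D f" for V f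
    by (rule wholder_mult[OF that(1,2), of _ D R])
      (use lipD(1,2)[OF that(3)] R(2) \<theta> in \<open>blast | simp\<close>)+
  \<comment> \<open>The z-derivatives by the product rule. Repeated terms of \<open>g2\<close> are
    left uncollected, so that each summand is one of the V times one of chi, \<open>c1\<close>,
    \<open>c2\<close>.\<close>
  define g1 where "g1 = (\<lambda>(x, z). V1 \<bar>x - xi\<bar> z * chi (x, z) + V0 \<bar>x - xi\<bar> z * c1 (x, z))"
  define g2 where "g2 = (\<lambda>(x, z). (V2 \<bar>x - xi\<bar> z * chi (x, z) + V1 \<bar>x - xi\<bar> z * c1 (x, z))
     + (V1 \<bar>x - xi\<bar> z * c1 (x, z) + V0 \<bar>x - xi\<bar> z * c2 (x, z)))"
  have b_u: "wbound ?S xi ?T 0 a b (\<lambda>x z. u (x, z))"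
    by (rule wbound_cong[OF _ wb[OF w(1) lip(1)]]) (simp add: u)
  have b_g1: "wbound ?S xi ?T 0 a b (\<lambda>x z. g1 (x, z))"
    unfolding g1_def prod.case by (intro wbound_add wb w lip)
  have b_g2: "wbound ?S xi ?T 0 a b (\<lambda>x z. g2 (x, z))"
    unfolding g2_def prod.case by (intro wbound_add wb w lip)
  have h_g2: "wholder ?S xi ?T 0 a b \<theta> (\<lambda>x z. g2 (x, z))"
    unfolding g2_def prod.case by (intro wholder_add wh w lip)
  have sub: "?S \<times> ?T \<subseteq> {x0..x1} \<times> {-1..1}" by auto
  have cc: "continuous_on (?S \<times> ?T) chi" "continuous_on (?S \<times> ?T) c1" "continuous_on (?S \<times> ?T) c2"
    using lip by (auto simp: lip_rect_def intro: continuous_on_subset[OF _ sub])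
  note cV = continuous_V[OF S, where T' = ?T]
  have c_u: "continuous_on (?S \<times> ?T) u"
  proof -
    have "continuous_on (?S \<times> ?T) (\<lambda>p. V0 \<bar>fst p - xi\<bar> (snd p) * chi p)"
      by (intro continuous_on_mult cV cc)
    moreover have "u p = V0 \<bar>fst p - xi\<bar> (snd p) * chi p" if "p \<in> ?S \<times> ?T" for p
      using u[of "fst p" "snd p"] that by auto
    ultimately show ?thesis by (subst continuous_on_cong[OF refl]) auto
  qed
  have c_g1: "continuous_on (?S \<times> ?T) g1"
  proof -
    have "g1 = (\<lambda>p. V1 \<bar>fst p - xi\<bar> (snd p) * chi p + V0 \<bar>fst p - xi\<bar> (snd p) * c1 p)"
      by (auto simp: g1_def fun_eq_iff)
    then show ?thesis by (simp only:) (intro continuous_on_add continuous_on_mult cV cc)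
  qed
  have c_g2: "continuous_on (?S \<times> ?T) g2"
  proof -
    have "g2 = (\<lambda>p. (V2 \<bar>fst p - xi\<bar> (snd p) * chi p + V1 \<bar>fst p - xi\<bar> (snd p) * c1 p)
       + (V1 \<bar>fst p - xi\<bar> (snd p) * c1 p + V0 \<bar>fst p - xi\<bar> (snd p) * c2 p))"
      by (auto simp: g2_def fun_eq_iff)
    then show ?thesis by (simp only:) (intro continuous_on_add continuous_on_mult cV cc)
  qed
  have L2: "L2_on u (?S \<times> ?T)" "L2_on g1 (?S \<times> ?T)" "L2_on g2 (?S \<times> ?T)"
    by (rule L2_on_wbound[OF b_u _ _ c_u R a(1) b(2)] L2_on_wbound[OF b_g1 _ _ c_g1 R a(1) b(2)]
        L2_on_wbound[OF b_g2 _ _ c_g2 R a(1) b(2)]; simp)+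
  have weak: "weak_deriv_on (\<lambda>z. u (x, z)) (\<lambda>z. g1 (x, z)) (-1) 1 \<and> weak_deriv_on (\<lambda>z. g1 (x, z)) (\<lambda>z. g2 (x, z)) (-1) 1"
    if x: "x \<in> ?S" for x
  proof
    have y: "\<bar>x - xi\<bar> > 0" using S[OF x] by simp
    have slice: "continuous_on ?T (\<lambda>z. g (x, z))" if "continuous_on (?S \<times> ?T) g" for g :: "real \<times> real \<Rightarrow> real"
      by (rule continuous_on_compose2[OF that]) (use x in \<open>auto intro!: continuous_intros\<close>)
    have xI: "x \<in> {x0..x1}" using x by auto
    show "weak_deriv_on (\<lambda>z. u (x, z)) (\<lambda>z. g1 (x, z)) (-1) 1"
    proof (rule weak_deriv_onI)
      fix z :: real assume "z \<in> ?T"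
      then have z: "z \<in> {-1..1}" by auto
      have "((\<lambda>z. V0 \<bar>x - xi\<bar> z * chi (x, z)) has_real_derivative
          V0 \<bar>x - xi\<bar> z * c1 (x, z) + V1 \<bar>x - xi\<bar> z * chi (x, z)) (at z)"
        by (rule DERIV_mult'[OF DERIV_V0_z[OF y] dchi[OF xI z]])
      moreover have "(\<lambda>z. u (x, z)) = (\<lambda>z. V0 \<bar>x - xi\<bar> z * chi (x, z))" using u[OF x] by auto
      ultimately show "((\<lambda>z. u (x, z)) has_real_derivative g1 (x, z)) (at z)"
        by (simp add: g1_def add.commute)
    qed (use slice[OF c_g1] in auto)
    show "weak_deriv_on (\<lambda>z. g1 (x, z)) (\<lambda>z. g2 (x, z)) (-1) 1"
    proof (rule weak_deriv_onI)
      fix z :: real assume "z \<in> ?T"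
      then have z: "z \<in> {-1..1}" by auto
      have "((\<lambda>z. V1 \<bar>x - xi\<bar> z * chi (x, z) + V0 \<bar>x - xi\<bar> z * c1 (x, z)) has_real_derivative
          (V1 \<bar>x - xi\<bar> z * c1 (x, z) + V2 \<bar>x - xi\<bar> z * chi (x, z))
           + (V0 \<bar>x - xi\<bar> z * c2 (x, z) + V1 \<bar>x - xi\<bar> z * c1 (x, z))) (at z)"
        by (intro DERIV_add DERIV_mult'[OF DERIV_V1_z[OF y] dchi[OF xI z]] DERIV_mult'[OF DERIV_V0_z[OF y] dc1[OF xI z]])
      then show "((\<lambda>z. g1 (x, z)) has_real_derivative g2 (x, z)) (at z)"
        by (simp add: g1_def g2_def add_ac)
    qed (use slice[OF c_g2] in auto)
  qed
  have "L2_H2s u x0 x1 (-1) 1 \<sigma>"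
    unfolding L2_H2s_def
  proof (rule exI[of _ g1], rule exI[of _ g2], intro conjI impI L2)
    show "AE x in lebesgue. x \<in> ?S \<longrightarrow> weak_deriv_on (\<lambda>z. u (x, z)) (\<lambda>z. g1 (x, z)) (-1) 1 \<and>
        weak_deriv_on (\<lambda>z. g1 (x, z)) (\<lambda>z. g2 (x, z)) (-1) 1"
      using weak by (intro AE_I2) auto
    show "(\<integral>\<^sup>+x. \<integral>\<^sup>+z. \<integral>\<^sup>+w. ennreal (indicator ?S x * indicator ?T z * indicator ?T w *
            (g2 (x, z) - g2 (x, w))\<^sup>2 / \<bar>z - w\<bar> powr (1 + 2 * \<sigma>)) \<partial>lebesgue \<partial>lebesgue \<partial>lebesgue) < \<infinity>"
      by (rule gagliardo_finite_inner[OF h_g2 R a(1) b(2) \<theta>(1)])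
  qed
  moreover have "Hs_L2 u x0 x1 (-1) 1 ((2 + \<sigma>) / 3)"
    unfolding Hs_L2_def
  proof (intro conjI L2)
    \<comment> \<open>Both weights get the exponent 2 \<mu> = 1 - \<delta> < 1, and \<beta> = \<mu>
      in \<open>wholder_V0_swap\<close> forces \<tau> = 1/6 + 4 \<mu>/3 = 5/6 - 2 \<delta>/3. Then
      \<tau> > (2 + \<sigma>)/3 means \<delta> < 1/4 - \<sigma>/2; \<delta> is half of that.\<close>
    define \<delta> where "\<delta> = 1/8 - \<sigma>/4"
    define \<mu> where "\<mu> = (1 - \<delta>) / 2"
    define \<tau> where "\<tau> = 5/6 - 2*\<delta>/3"
    have \<delta>: "0 < \<delta>" "\<delta> \<le> 1/8" using \<sigma> by (auto simp: \<delta>_def)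
    have \<mu>: "0 \<le> \<mu>" "\<mu> \<le> 1" "2 * \<mu> < 1" "1/3 \<le> 2 * \<mu>" using \<delta> by (auto simp: \<mu>_def)
    have \<tau>: "0 < \<tau>" "\<tau> \<le> 1" "\<tau> - 1 - \<mu> = -5/6 + \<mu>/3" using \<delta> by (auto simp: \<tau>_def \<mu>_def field_simps)
    have s: "(2 + \<sigma>) / 3 < \<tau>" unfolding \<tau>_def \<delta>_def using \<sigma> by (simp add: field_simps)
    have "wholder ?T 0 ?S xi (2 * \<mu>) (2 * \<mu>) \<tau> (\<lambda>z x. V0 \<bar>x - xi\<bar> z * chi (x, z))"
    proof (rule wholder_mult[of _ _ _ _ _ _ _ _ _ D R])
      show "wbound ?T 0 ?S xi (2 * \<mu>) (2 * \<mu>) (\<lambda>z x. V0 \<bar>x - xi\<bar> z)"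
        using \<mu> by (intro wbound_V0_swap[OF S]) auto
      show "wholder ?T 0 ?S xi (2 * \<mu>) (2 * \<mu>) \<tau> (\<lambda>z x. V0 \<bar>x - xi\<bar> z)"
        by (rule wholder_V0_swap[OF S side \<mu>(1,2) \<mu>(1) \<tau>])
    qed (use lipD(1,3)[OF lip(1)] R(1) \<tau> in \<open>blast | simp\<close>)+
    then have "wholder ?T 0 ?S xi (2 * \<mu>) (2 * \<mu>) \<tau> (\<lambda>z x. u (x, z))"
      by (rule wholder_cong[rotated]) (simp add: u)
    from gagliardo_finite_outer[OF this R(2,1,4,3) \<mu>(3,3) s]
    show "(\<integral>\<^sup>+x. \<integral>\<^sup>+y. \<integral>\<^sup>+z. ennreal (indicator ?S x * indicator ?S y * indicator ?T z *
         (u (x, z) - u (y, z))\<^sup>2 / \<bar>x - y\<bar> powr (1 + 2 * ((2 + \<sigma>) / 3))) \<partial>lebesgue \<partial>lebesgue \<partial>lebesgue) < \<infinity>" .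
  qed
  ultimately show ?thesis by blast
qed

end

text \<open>Squaring removes the sign (-1)^i from \<open>t_i\<close>, so r_i^2 = y^(2/3) (1 + t^2)
  for either end point, and the sign survives only in the argument of the profile. Away from y = 0
  the powers of y combine as usual.\<close>

lemma u_sing_eq:
  assumes "fst p \<noteq> xi"
  shows "u_sing i xi chi p = \<bar>fst p - xi\<bar> powr (1/6) *
    (9 powr (1/6) * profF singA singB ((-1) ^ i * (snd p * \<bar>fst p - xi\<bar> powr (-1/3)))) * chi p"
proof -
  define y z where "y = \<bar>fst p - xi\<bar>" and "z = snd p"
  have y: "y > 0" using assms by (simp add: y_def)
  define t where "t = (-1) ^ i * (z * y powr (-1/3))"
  have t: "t_i i xi p = t" by (simp add: t_i_def t_def y_def z_def)
  have t2: "t\<^sup>2 = z\<^sup>2 * y powr (-2/3)"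
    by (simp add: t_def power_mult_distrib powr_square flip: power_mult)
  have "y powr (2/3) * y powr (-2/3) = 1" using y by (simp flip: powr_add)
  then have "z\<^sup>2 + y powr (2/3) = y powr (2/3) * (1 + t\<^sup>2)" unfolding t2 by (simp add: algebra_simps)
  then have "r_i xi p powr (1/2) = ((y powr (2/3) * (1 + t\<^sup>2)) powr (1/2)) powr (1/2)"
    by (simp add: r_i_def y_def z_def powr_half_sqrt)
  also have "\<dots> = (y powr (2/3) * (1 + t\<^sup>2)) powr (1/4)" by (simp add: powr_powr)
  also have "\<dots> = y powr (1/6) * (1 + t\<^sup>2) powr (1/4)" by (simp add: powr_mult powr_powr)
  finally have r: "r_i xi p powr (1/2) = y powr (1/6) * (1 + t\<^sup>2) powr (1/4)" .
  have "1 + t\<^sup>2 > 0" by (simp add: add_pos_nonneg)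
  then have "(1 + t\<^sup>2) powr (1/4) * (1 + t\<^sup>2) powr (-1/4) = 1" by (simp flip: powr_add)
  moreover have "u_sing i xi chi p = y powr (1/6) * ((1 + t\<^sup>2) powr (1/4) * (1 + t\<^sup>2) powr (-1/4)) *
      (9 powr (1/6) * profF singA singB t) * chi p"
    unfolding u_sing_def r t Lambda0_eq by (simp only: mult_ac)
  ultimately show ?thesis by (simp add: t_def y_def z_def)
qed

theorem lemma2p19:
  fixes x0 x1 Rbar \<sigma> :: real and i :: nat and chi :: "real \<times> real \<Rightarrow> real"
  assumes "x0 < x1"
    and "Rbar < min 1 (x1 - x0) / 2"
    and "i \<in> {0, 1}"
    and "smooth_upto (Omega x0 x1) chi"
    and "\<exists>\<epsilon>>0. \<forall>p \<in> ball ((if i = 0 then x0 else x1), 0) \<epsilon> \<inter> closure (Omega x0 x1). chi p = 1"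
    and "closure {p \<in> closure (Omega x0 x1). chi p \<noteq> 0} \<subseteq> ball ((if i = 0 then x0 else x1), 0) Rbar"
    and "0 \<le> \<sigma>" and "\<sigma> < 1/2"
  shows "Hs_L2 (u_sing i (if i = 0 then x0 else x1) chi) x0 x1 (-1) 1 ((2 + \<sigma>) / 3)
       \<and> L2_H2s (u_sing i (if i = 0 then x0 else x1) chi) x0 x1 (-1) 1 \<sigma>"
proof -
  define xi where "xi = (if i = 0 then x0 else x1)"
  obtain P Q T C where "profile (profF singA singB) P Q T C" using profile_Lambda0 by blast
  then interpret p0: profile "profF singA singB" P Q T C .
  \<comment> \<open>Reflection of the profile handles the sign for \<open>i = 1\<close>, and scaling
    absorbs the factor 9^(1/6).\<close>
  have "\<exists>P Q T C. profile (\<lambda>t. 9 powr (1/6) * profF singA singB ((-1) ^ i * t)) P Q T C"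
  proof (cases "i = 0")
    case True
    then show ?thesis using p0.profile_scale[of "9 powr (1/6)"] by (intro exI) simp
  next
    case False
    then have "i = 1" using assms by simp
    then show ?thesis
      using profile.profile_scale[OF p0.profile_reflect, of "9 powr (1/6)"] by (intro exI) simp
  qed
  then obtain P' Q' T' C' where
    "profile (\<lambda>t. 9 powr (1/6) * profF singA singB ((-1) ^ i * t)) P' Q' T' C'" by blast
  then interpret p: profile "\<lambda>t. 9 powr (1/6) * profF singA singB ((-1) ^ i * t)" P' Q' T' C' .
  show ?thesis
    unfolding xi_def[symmetric]
  proof (rule p.singular_regularity[OF assms(1) _ assms(4) _ assms(7,8)])
    show "xi \<in> {x0, x1}" by (simp add: xi_def)
    show "u_sing i xi chi (x, z) = p.V0 \<bar>x - xi\<bar> z * chi (x, z)" if "x \<in> {x0<..<x1}" for x z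
      using that u_sing_eq[of "(x, z)" xi i chi] by (auto simp: p.V0_def xi_def split: if_splits)
  qed
qed

end
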